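(* Let $f(z)$ be a transcendental meromorphic function in $\mathbb{C}$ of finite order with two (distinct) Borel exceptional values $a,b\in\mathbb{C}\cup\{\infty\}$, let $\eta$ be a non-zero complex number, and let $n\ge 2$ be an integer. Suppose that $s(z)\not\equiv 0$ is a small meromorphic function of $f(z)$, and that one of the following two conditions holds: (i) $a,b\in\mathbb{C}$, $a^{n+1}-s(z)\not\equiv 0$ and $b^{n+1}-s(z)\not\equiv 0$; (ii) $a\in\mathbb{C}$, $b=\infty$ and $a^{n+1}-s(z)\not\equiv 0$. Then $f(z)^nf(z+\eta)-s(z)$ has infinitely many zeros.
   Context: Standard notation of Nevanlinna theory is used: $T(r,f)$ is the characteristic function and $N(r,f)$ is the integrated counting function of the poles of $f$ counted with multiplicity. The order is $\sigma(f)=\limsup_{r\to\infty}\frac{\log^+T(r,f)}{\log r}$. A value $a\in\mathbb{C}$ (resp. $a=\infty$) is a Borel exceptional value of $f$ if $\limsup_{r\to\infty}\frac{\log^+N(r,1/(f-a))}{\log r}<\sigma(f)$ (resp. the same with $N(r,f)$ in place of $N(r,1/(f-a))$). $S(r,f)$ denotes any real function that is $o(T(r,f))$ as $r\to\infty$ outside a possible exceptional set $E$ of finite logarithmic measure ($\int_{E\cap[1,\infty)}dr/r<\infty$). A meromorphic function $\alpha$ is a small function of $f$ if $T(r,\alpha)=S(r,f)$. *)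

theory Defs
  imports "HOL-Complex_Analysis.Complex_Analysis" "HOL-Library.Landau_Symbols"
begin

text \<open>
  As in \<^theory>\<open>HOL-Complex_Analysis.Meromorphic\<close>, the values of a function that is meromorphic on
  the plane are arbitrary on a sparse set.  Accordingly, an identity of meromorphic functions means
  equality off a sparse set, and poles and zeros are detected by limits.  None of the notions below
  changes when a function is modified on a sparse set.
\<close>

definition transcendental_meromorphic :: "(complex \<Rightarrow> complex) \<Rightarrow> bool" where
  "transcendental_meromorphic f \<longleftrightarrow>
     f meromorphic_on UNIV \<and>
     \<not> (\<exists>p q :: complex poly. q \<noteq> 0 \<and> (\<forall>\<^sub>\<approx>z. f z = poly p z / poly q z))"

definition log_plus :: "real \<Rightarrow> real" where
  "log_plus x = ln (max 1 x)"

definition proximity :: "real \<Rightarrow> (complex \<Rightarrow> complex) \<Rightarrow> real" where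
  "proximity r f =
     1 / (2 * pi) * integral {0..2 * pi} (\<lambda>\<theta>. log_plus (cmod (f (of_real r * cis \<theta>))))"

text \<open>At a pole, the order \<^const>\<open>zorder\<close> is minus the multiplicity of the pole.\<close>

definition pole_count :: "real \<Rightarrow> (complex \<Rightarrow> complex) \<Rightarrow> nat" where
  "pole_count r f = (\<Sum>z | z \<in> cball 0 r \<and> is_pole f z. nat (- zorder f z))"

definition int_pole_count :: "real \<Rightarrow> (complex \<Rightarrow> complex) \<Rightarrow> real" where
  "int_pole_count r f =
     integral {0..r} (\<lambda>t. (real (pole_count t f) - real (pole_count 0 f)) / t)
     + real (pole_count 0 f) * ln r"

definition characteristic :: "real \<Rightarrow> (complex \<Rightarrow> complex) \<Rightarrow> real" where
  "characteristic r f = proximity r f + int_pole_count r f"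

definition growth_exponent :: "(real \<Rightarrow> real) \<Rightarrow> ereal" where
  "growth_exponent g = Limsup at_top (\<lambda>r. ereal (log_plus (g r) / ln r))"

definition growth_order :: "(complex \<Rightarrow> complex) \<Rightarrow> ereal" where
  "growth_order f = growth_exponent (\<lambda>r. characteristic r f)"

datatype ext_complex = Fin complex | Infty

fun int_value_count :: "real \<Rightarrow> (complex \<Rightarrow> complex) \<Rightarrow> ext_complex \<Rightarrow> real" where
  "int_value_count r f (Fin a) = int_pole_count r (\<lambda>z. 1 / (f z - a))"
| "int_value_count r f Infty = int_pole_count r f"

definition borel_exceptional :: "(complex \<Rightarrow> complex) \<Rightarrow> ext_complex \<Rightarrow> bool" where
  "borel_exceptional f a \<longleftrightarrow>
     growth_exponent (\<lambda>r. int_value_count r f a) < growth_order f"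

definition finite_log_measure :: "real set \<Rightarrow> bool" where
  "finite_log_measure E \<longleftrightarrow>
     E \<in> sets lebesgue \<and> (\<integral>\<^sup>+ r \<in> E \<inter> {1..}. ennreal (1 / r) \<partial>lebesgue) < \<infinity>"

text \<open>\<open>is_S g f\<close> renders \<open>g(r) = S(r, f)\<close>.\<close>

definition is_S :: "(real \<Rightarrow> real) \<Rightarrow> (complex \<Rightarrow> complex) \<Rightarrow> bool" where
  "is_S g f \<longleftrightarrow>
     (\<exists>E. finite_log_measure E \<and>
          g \<in> o[inf at_top (principal (- E))](\<lambda>r. characteristic r f))"

definition small_function :: "(complex \<Rightarrow> complex) \<Rightarrow> (complex \<Rightarrow> complex) \<Rightarrow> bool" where
  "small_function \<alpha> f \<longleftrightarrow> \<alpha> meromorphic_on UNIV \<and> is_S (\<lambda>r. characteristic r \<alpha>) f"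

end

theory Submission
  imports Defs
begin

text \<open>
  Let \<open>v\<close> be \<open>f - a\<close> if \<open>b = \<infinity>\<close> and \<open>(f - a) / (f - b)\<close> otherwise, so that zeros and poles of \<open>v\<close> are
  rare compared with \<open>T(r, v) = T(r, f) + O(1)\<close>.  Along suitable radii \<open>r\<^sub>k\<close>, with \<open>T\<^sub>k = T(r\<^sub>k, v)\<close>,
  the functions \<open>ln |v (r\<^sub>k z)| / T\<^sub>k\<close> differ little from bounded harmonic functions, and by Montel's theorem
  a subsequence converges to a harmonic function with trace \<open>H\<close> on the unit circle; \<open>H\<close> has mean 0, its positive part has
  mean 1, and \<open>H \<noteq> 0\<close> almost everywhere.  The shift by \<open>\<eta>\<close> is invisible at this scale, and
  \<open>ln |u| / T\<^sub>k\<close> tends to 0 for every small function \<open>u\<close>.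

  Put \<open>F = f\<^sup>n f(\<cdot> + \<eta>) - s\<close>.  If \<open>b = \<infinity>\<close>, then \<open>ln |F| / T\<^sub>k\<close> tends to \<open>(n + 1) H\<^sup>+\<close>: where \<open>H > 0\<close> the
  product dominates, and where \<open>H < 0\<close> it is exponentially close to \<open>a\<^sup>n\<^sup>+\<^sup>1\<close>.  Jensen's formula then forces
  \<open>N(r\<^sub>k, 1/F) \<ge> (n + 1 - o(1)) T\<^sub>k\<close>, which exceeds any multiple of \<open>ln r\<^sub>k\<close>.  If \<open>b\<close> is finite, the limit is 0, so finitely many
  zeros would make \<open>F\<close> small; but \<open>F + s - b\<^sup>n\<^sup>+\<^sup>1\<close> and \<open>F + s - a\<^sup>n\<^sup>+\<^sup>1\<close> are exponentially small where \<open>H > 0\<close> and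
  \<open>H < 0\<close> respectively, hence vanish identically.  Thus \<open>f\<^sup>n f(\<cdot> + \<eta>)\<close> is a nonzero constant, so
  \<open>T(r, f(\<cdot> + \<eta>)) = n T(r, f) + O(1)\<close>, whereas \<open>T(r\<^sub>k, f(\<cdot> + \<eta>)) / T\<^sub>k\<close> tends to 1.
\<close>

subsection \<open>The circle as a probability space\<close>

text \<open>The order is a limsup, so nothing is asserted for all large radii. The scales are radii
  where T(r, f) >= r^\<rho>2, with \<rho>2 strictly between the growth of the rare counting
  functions and the order, and where also T(1000 r, f) <= C T(r, f); finite order supplies the
  latter. That factor pays for every passage to a larger disc: Poisson bounds, counts of zeros and
  poles, the shift, and the exceptional set of a small function. Logarithms are unbounded near zeros
  and poles, so almost everywhere convergence of ln |F| / T_k does not pass to circle means by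
  itself; uniform mean square bounds, traced back to the kernel ln |1 - b e^(it)|, make it pass.
  Almost every angle must fall into H > 0 or H < 0: the zero set of H is a level set of the modulus
  of a holomorphic function on the circle, hence finite unless H vanishes. The shift needs no
  estimate of f(z + \<eta>) / f(z): rescaling turns it into a displacement by \<eta> / r_k, and the
  convergence is locally uniform on a disc larger than the unit disc.\<close>

definition circ :: "real measure" where
  "circ = density lborel (\<lambda>t. ennreal (indicator {0..2*pi} t / (2*pi)))"

lemma space_circ [simp]: "space circ = UNIV"
  and sets_circ [simp, measurable_cong]: "sets circ = sets borel"
  by (auto simp: circ_def)

lemma borel_measurable_circ_iff [simp]: "x \<in> borel_measurable circ \<longleftrightarrow> x \<in> borel_measurable borel"
  by (simp add: measurable_def)

lemma emeasure_circ_UNIV: "emeasure circ UNIV = 1"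
proof -
  have "emeasure circ UNIV = (\<integral>\<^sup>+t. ennreal (1/(2*pi)) * indicator {0..2*pi} t \<partial>lborel)"
    unfolding circ_def
    by (subst emeasure_density) (auto intro!: nn_integral_cong simp: indicator_def)
  also have "\<dots> = ennreal (1/(2*pi)) * ennreal (2*pi)"
    by (simp add: nn_integral_cmult_indicator)
  also have "\<dots> = 1"
    by (simp flip: ennreal_mult)
  finally show ?thesis .
qed

interpretation circ: finite_measure circ
  by standard (simp add: emeasure_circ_UNIV)

lemma measure_circ_UNIV [simp]: "measure circ UNIV = 1"
  by (simp add: measure_def emeasure_circ_UNIV)

lemma circ_integral_eq_set_lebesgue:
  fixes x :: "real \<Rightarrow> 'b::{banach, second_countable_topology}"
  assumes "x \<in> borel_measurable borel"
  shows "integral\<^sup>L circ x = (1/(2*pi)) *\<^sub>R (LINT t:{0..2*pi}|lborel. x t)"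
    and "integrable circ x \<longleftrightarrow> set_integrable lborel {0..2*pi} x"
proof -
  have eq: "(\<lambda>t. (indicator {0..2*pi} t / (2*pi)) *\<^sub>R x t) =
            (\<lambda>t. (1/(2*pi)) *\<^sub>R (indicator {0..2*pi} t *\<^sub>R x t))"
    by (auto simp: fun_eq_iff)
  show "integral\<^sup>L circ x = (1/(2*pi)) *\<^sub>R (LINT t:{0..2*pi}|lborel. x t)"
    unfolding circ_def set_lebesgue_integral_def
    by (subst integral_density) (use assms in \<open>auto simp: eq simp del: scaleR_scaleR\<close>)
  show "integrable circ x \<longleftrightarrow> set_integrable lborel {0..2*pi} x"
    unfolding circ_def set_integrable_def
  proof (subst integrable_density)
    let ?y = "\<lambda>t. indicator {0..2*pi} t *\<^sub>R x t"
    have "integrable lborel ?y" if "integrable lborel (\<lambda>t. (1/(2*pi)) *\<^sub>R ?y t)"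
      using Bochner_Integration.integrable_scaleR_right[OF that, of "2 * pi"] by simp
    thus "integrable lborel (\<lambda>t. (indicator {0..2*pi} t / (2*pi)) *\<^sub>R x t) = integrable lborel ?y"
      unfolding eq using Bochner_Integration.integrable_scaleR_right[where c = "1/(2*pi)" and f = ?y and M = lborel] by blast
  qed (use assms in auto)
qed

lemma circ_integral_eq_integral:
  fixes x :: "real \<Rightarrow> 'b::euclidean_space"
  assumes "integrable circ x"
  shows "integral\<^sup>L circ x = (1/(2*pi)) *\<^sub>R integral {0..2*pi} x"
proof -
  have m: "x \<in> borel_measurable borel"
    using assms by (metis borel_measurable_circ_iff borel_measurable_integrable
      measurable_cong_sets sets_circ)
  thus ?thesis
    using assms circ_integral_eq_set_lebesgue[OF m] set_borel_integral_eq_integral(2)[of "{0..2*pi}" x]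
    by auto
qed

lemma AE_circ_iff: "(AE t in circ. P t) \<longleftrightarrow> (AE t in lborel. t \<in> {0..2*pi} \<longrightarrow> P t)"
  unfolding circ_def by (subst AE_density) (auto simp: indicator_def)

lemma AE_circ_countable:
  assumes "countable X" shows "AE t in circ. t \<notin> X"
proof -
  have "AE t in lborel. t \<notin> X"
    using assms by (intro AE_not_in) (auto simp: countable_imp_null_set_lborel)
  thus ?thesis unfolding AE_circ_iff by auto
qed

text \<open>The angles over one point of the circle form an arithmetic progression, so a countable
  exceptional set stays countable when pulled back. The translate by \<eta> is built in because
  shifted functions are evaluated over the same angles.\<close>

lemma countable_vimage_circle:
  assumes "countable X" "r \<noteq> 0"
  shows "countable {t. of_real r * cis t + \<eta> \<in> X}"
proof -
  have c: "countable {t. cis t = w}" for w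
  proof (cases "\<exists>t0. cis t0 = w")
    case True
    then obtain t0 where t0: "cis t0 = w" by auto
    have "{t. cis t = w} \<subseteq> range (\<lambda>n::int. t0 + 2 * pi * of_int n)"
    proof
      fix t assume "t \<in> {t. cis t = w}"
      hence "cis t = cis t0" using t0 by auto
      hence "sin t = sin t0 \<and> cos t = cos t0" by (auto simp: complex_eq_iff)
      then obtain n :: int where "t = t0 + 2 * pi * of_int n"
        using sin_cos_eq_iff[of t t0] by (auto simp: algebra_simps)
      thus "t \<in> range (\<lambda>n::int. t0 + 2 * pi * of_int n)" by auto
    qed
    thus ?thesis by (rule countable_subset) auto
  qed auto
  have "{t. of_real r * cis t + \<eta> \<in> X} = (\<Union>w\<in>X. {t. cis t = (w - \<eta>) / of_real r})"
    using assms(2) by (auto simp: field_simps)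
  thus ?thesis using assms(1) c by auto
qed

lemma AE_circ_avoid:
  assumes "countable X" "r \<noteq> 0"
  shows "AE t in circ. of_real r * cis t + \<eta> \<notin> X"
  using AE_circ_countable[OF countable_vimage_circle[OF assms]] by auto

lemma continuous_on_cis [continuous_intros]:
  "continuous_on A f \<Longrightarrow> continuous_on A (\<lambda>x. cis (f x))"
  unfolding cis_conv_exp by (intro continuous_intros)

lemma borel_measurable_cis [measurable]: "cis \<in> borel_measurable borel"
  by (intro borel_measurable_continuous_onI continuous_intros)

lemma circ_integrable_bounded:
  fixes x :: "real \<Rightarrow> 'b::{banach, second_countable_topology}"
  assumes "x \<in> borel_measurable borel" "\<And>t. norm (x t) \<le> B"
  shows "integrable circ x"
  using assms by (intro circ.integrable_const_bound[where B = B]) auto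

lemma circ_integrable_continuous:
  fixes \<phi> :: "complex \<Rightarrow> 'b::{banach, second_countable_topology}"
  assumes "continuous_on (sphere 0 r) \<phi>" "r \<ge> 0"
  shows "integrable circ (\<lambda>t. \<phi> (of_real r * cis t))"
proof -
  have "bounded (\<phi> ` sphere 0 r)"
    using assms by (intro compact_imp_bounded compact_continuous_image) auto
  then obtain B where B: "\<And>z. z \<in> sphere 0 r \<Longrightarrow> norm (\<phi> z) \<le> B"
    unfolding bounded_iff by blast
  show ?thesis
  proof (rule circ_integrable_bounded)
    show "(\<lambda>t. \<phi> (of_real r * cis t)) \<in> borel_measurable borel"
      by (intro borel_measurable_continuous_onI continuous_on_compose2[OF assms(1)] continuous_intros)
         (use assms(2) in \<open>auto simp: norm_mult\<close>)
    show "norm (\<phi> (of_real r * cis t)) \<le> B" for t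
      by (rule B) (use assms(2) in \<open>auto simp: norm_mult\<close>)
  qed
qed

section \<open>Mean values and the Poisson formula on a circle\<close>

lemma circ_integral_contour:
  assumes "(\<phi> has_contour_integral I) (circlepath 0 r)" "continuous_on (sphere 0 r) \<phi>" "r \<ge> 0"
  shows "(\<integral>t. of_real r * cis t * \<phi> (of_real r * cis t) \<partial>circ) = I / (2 * of_real pi * \<i>)"
proof -
  have "integrable circ (\<lambda>t. (\<lambda>w. w * \<phi> w) (of_real r * cis t))"
    by (rule circ_integrable_continuous) (use assms in \<open>auto intro!: continuous_intros\<close>)
  hence "(\<integral>t. of_real r * cis t * \<phi> (of_real r * cis t) \<partial>circ) =
         (1/(2*pi)) *\<^sub>R integral {0..2*pi} (\<lambda>t. of_real r * cis t * \<phi> (of_real r * cis t))"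
    by (subst circ_integral_eq_integral) auto
  also have "((\<lambda>t. \<phi> (0 + of_real r * cis t) * r * \<i> * cis t) has_integral I) {0..2*pi}"
    using assms(1) unfolding circlepath_def
    by (subst (asm) has_contour_integral_part_circlepath_iff) auto
  hence "((\<lambda>t. (1/\<i>) * (\<phi> (0 + of_real r * cis t) * r * \<i> * cis t)) has_integral (1/\<i>) * I) {0..2*pi}"
    by (rule has_integral_mult_right)
  hence "integral {0..2*pi} (\<lambda>t. of_real r * cis t * \<phi> (of_real r * cis t)) = I / \<i>"
    by (intro integral_unique) (simp add: mult_ac)
  finally show ?thesis
    by (simp add: scaleR_conv_of_real field_simps)
qed

lemma circ_mean_value:
  assumes "g holomorphic_on cball 0 r" "r > 0"
  shows "(\<integral>t. g (of_real r * cis t) \<partial>circ) = g 0"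
proof -
  have "((\<lambda>u. g u/(u-0)) has_contour_integral (2 * of_real pi * \<i> * g 0)) (circlepath 0 r)"
    using assms by (intro Cauchy_integral_circlepath_simple) auto
  hence "(\<integral>t. of_real r * cis t * (g (of_real r * cis t) / (of_real r * cis t - 0)) \<partial>circ) =
        (2 * of_real pi * \<i> * g 0) / (2 * of_real pi * \<i>)"
    by (rule circ_integral_contour)
       (use assms in \<open>auto intro!: continuous_intros
          intro: continuous_on_subset[OF holomorphic_on_imp_continuous_on]\<close>)
  thus ?thesis using assms by simp
qed

lemma circ_mean_value_Re:
  assumes "g holomorphic_on cball 0 r" "r > 0"
  shows "(\<integral>t. Re (g (of_real r * cis t)) \<partial>circ) = Re (g 0)"
    "integrable circ (\<lambda>t. Re (g (of_real r * cis t)))"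
proof -
  have *: "integrable circ (\<lambda>t. g (of_real r * cis t))"
    using assms by (intro circ_integrable_continuous)
      (auto intro: continuous_on_subset[OF holomorphic_on_imp_continuous_on])
  thus "integrable circ (\<lambda>t. Re (g (of_real r * cis t)))" by auto
  show "(\<integral>t. Re (g (of_real r * cis t)) \<partial>circ) = Re (g 0)"
    using circ_mean_value[OF assms] * by (simp add: integral_Re)
qed

text \<open>Cauchy's formula at \<open>z\<close> minus Cauchy's theorem for the term belonging to
  the point reflected in the circle. On the circle the difference of the two kernels is the real
  Poisson kernel.\<close>

lemma circ_Poisson:
  assumes "g holomorphic_on cball 0 r" "norm z < r"
  shows "(\<integral>t. g (of_real r * cis t) * of_real ((r\<^sup>2 - (norm z)\<^sup>2) / (norm (of_real r * cis t - z))\<^sup>2) \<partial>circ) = g z"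
proof -
  have r: "r > 0" using assms(2) norm_ge_zero[of z] by linarith
  \<comment> \<open>The only possible pole of \<open>h\<close> is the reflected point r^2 / cnj z,
    outside the closed disc. Writing the fraction without dividing by \<open>cnj z\<close> includes
    the case z = 0, where \<open>h\<close> vanishes.\<close>
  define h where "h = (\<lambda>w. g w * cnj z / (w * cnj z - of_real (r\<^sup>2)))"
  have nz: "w * cnj z \<noteq> of_real (r\<^sup>2)" if "norm w \<le> r" for w
  proof
    assume "w * cnj z = of_real (r\<^sup>2)"
    hence "norm (w * cnj z) = norm (complex_of_real (r\<^sup>2))" by simp
    hence "norm w * norm z = r * r" by (simp add: norm_mult power2_eq_square)
    moreover have "norm w * norm z \<le> r * norm z" using that by (intro mult_right_mono) auto
    moreover have "r * norm z < r * r" using assms(2) r by simp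
    ultimately show False by simp
  qed
  have 1: "((\<lambda>u. g u/(u-z)) has_contour_integral (2 * of_real pi * \<i> * g z)) (circlepath 0 r)"
    using assms by (intro Cauchy_integral_circlepath_simple) auto
  have holh: "h holomorphic_on cball 0 r"
    unfolding h_def by (intro holomorphic_intros assms) (use nz in auto)
  have 2: "(h has_contour_integral 0) (circlepath 0 r)"
    by (rule Cauchy_theorem_convex_simple[OF holh]) (use r in auto)
  have gc: "continuous_on (sphere 0 r) g"
    using assms by (auto intro: continuous_on_subset[OF holomorphic_on_imp_continuous_on])
  have "(\<integral>t. of_real r * cis t * (g (of_real r * cis t) / (of_real r * cis t - z) - h (of_real r * cis t)) \<partial>circ) =
        (2 * of_real pi * \<i> * g z - 0) / (2 * of_real pi * \<i>)"
    by (rule circ_integral_contour[OF has_contour_integral_diff[OF 1 2]])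
       (use assms r gc continuous_on_subset[OF holomorphic_on_imp_continuous_on[OF holh], of "sphere 0 r"]
         in \<open>auto intro!: continuous_intros\<close>)
  also have "\<dots> = g z" by simp
  finally have fin: "(\<integral>t. of_real r * cis t * (g (of_real r * cis t) / (of_real r * cis t - z) - h (of_real r * cis t)) \<partial>circ) = g z" .
  have "of_real r * cis t * (g (of_real r * cis t) / (of_real r * cis t - z) - h (of_real r * cis t)) =
     g (of_real r * cis t) * of_real ((r\<^sup>2 - (norm z)\<^sup>2) / (norm (of_real r * cis t - z))\<^sup>2)" for t
  proof -
    define w where "w = of_real r * cis t"
    have w: "norm w = r" using r by (simp add: w_def norm_mult)
    have wz: "w \<noteq> z" using w assms(2) by auto
    hence wz': "cnj w \<noteq> cnj z" by simp
    have w0: "w \<noteq> 0" using w r by auto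
    have rw: "of_real (r\<^sup>2) = w * cnj w" using w by (simp add: complex_norm_square[symmetric])
    have zz: "of_real ((norm z)\<^sup>2) = z * cnj z" by (simp add: complex_norm_square[symmetric])
    have d: "of_real ((norm (w - z))\<^sup>2) = (w - z) * (cnj w - cnj z)"
      by (metis complex_norm_square complex_cnj_diff of_real_power)
    have e: "w * cnj z - w * cnj w = w * (cnj z - cnj w)" by (simp add: algebra_simps)
    have "w * h w = g w * (cnj z / (cnj z - cnj w))"
      unfolding h_def rw e using w0 by simp
    hence "w * (g w / (w - z) - h w) = g w * (w / (w - z) - cnj z / (cnj z - cnj w))"
      by (simp add: algebra_simps)
    also have "w / (w - z) - cnj z / (cnj z - cnj w) = (w * cnj w - z * cnj z) / ((w - z) * (cnj w - cnj z))"
      using wz wz' by (simp add: divide_simps) (simp add: algebra_simps)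
    also have "\<dots> = of_real ((r\<^sup>2 - (norm z)\<^sup>2) / (norm (w - z))\<^sup>2)"
      unfolding of_real_divide of_real_diff rw zz d ..
    finally show ?thesis unfolding w_def .
  qed
  thus ?thesis using fin by simp
qed

text \<open>For |z| <= r/2 the Poisson kernel is at most (r + |z|) / (r - |z|) <= 3. This turns a
  bound in mean on one circle into a pointwise bound on the disc of half the radius.\<close>

lemma circ_Poisson_bound:
  assumes "g holomorphic_on cball 0 r" "norm z \<le> r / 2" "r > 0"
  shows "\<bar>Re (g z)\<bar> \<le> 3 * (\<integral>t. \<bar>Re (g (of_real r * cis t))\<bar> \<partial>circ)"
proof -
  define k where "k = (\<lambda>t. (r\<^sup>2 - (norm z)\<^sup>2) / (norm (of_real r * cis t - z))\<^sup>2)"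
  have zr: "norm z < r" using assms by linarith
  have gc: "continuous_on (sphere 0 r) g"
    using assms by (auto intro: continuous_on_subset[OF holomorphic_on_imp_continuous_on])
  have ne: "w \<noteq> z" if "norm w = r" for w using zr that by auto
  have I: "integrable circ (\<lambda>t. g (of_real r * cis t) * of_real (k t))"
    unfolding k_def
    by (rule circ_integrable_continuous[where \<phi> = "\<lambda>w. g w * of_real ((r\<^sup>2 - (norm z)\<^sup>2) / (norm (w - z))\<^sup>2)"])
       (use ne assms in \<open>auto intro!: continuous_intros gc\<close>)
  have I2: "integrable circ (\<lambda>t. \<bar>Re (g (of_real r * cis t))\<bar>)"
    by (intro integrable_abs circ_mean_value_Re assms)
  have k: "0 \<le> k t" "k t \<le> 3" for t
  proof -
    have a: "norm (of_real r * cis t - z) \<ge> r - norm z"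
      using norm_triangle_ineq2[of "of_real r * cis t" z] assms(3) by (simp add: norm_mult)
    have b: "r\<^sup>2 - (norm z)\<^sup>2 = (r - norm z) * (r + norm z)" by (simp add: power2_eq_square algebra_simps)
    have c: "(norm z)\<^sup>2 \<le> r\<^sup>2" using zr by (intro power_mono) auto
    show "0 \<le> k t" unfolding k_def using c by auto
    have "(r - norm z) * (r + norm z) \<le> (r - norm z) * (3 * (r - norm z))"
      using assms zr by (intro mult_left_mono) auto
    also have "\<dots> = 3 * (r - norm z)\<^sup>2" by (simp add: power2_eq_square)
    also have "\<dots> \<le> 3 * (norm (of_real r * cis t - z))\<^sup>2"
      using power_mono[OF a, of 2] zr by simp
    finally show "k t \<le> 3" unfolding k_def b
      using a zr by (intro divide_le_eq[THEN iffD2]) auto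
  qed
  have "g z = (\<integral>t. g (of_real r * cis t) * of_real (k t) \<partial>circ)"
    unfolding k_def using circ_Poisson[OF assms(1) zr] by simp
  hence "Re (g z) = (\<integral>t. Re (g (of_real r * cis t) * of_real (k t)) \<partial>circ)"
    using integral_Re[OF I] by simp
  hence "\<bar>Re (g z)\<bar> \<le> (\<integral>t. \<bar>Re (g (of_real r * cis t) * of_real (k t))\<bar> \<partial>circ)"
    using integral_abs_bound[of circ] by simp
  also have "\<dots> \<le> (\<integral>t. 3 * \<bar>Re (g (of_real r * cis t))\<bar> \<partial>circ)"
  proof (rule integral_mono)
    show "integrable circ (\<lambda>t. \<bar>Re (g (of_real r * cis t) * of_real (k t))\<bar>)"
      by (intro integrable_abs integrable_Re I)
    show "integrable circ (\<lambda>t. 3 * \<bar>Re (g (of_real r * cis t))\<bar>)"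
      by (intro integrable_mult_right I2)
    show "\<bar>Re (g (of_real r * cis t) * of_real (k t))\<bar> \<le> 3 * \<bar>Re (g (of_real r * cis t))\<bar>" for t
      using k[of t] mult_right_mono[of "k t" 3 "\<bar>Re (g (of_real r * cis t))\<bar>"] by (simp add: abs_mult mult.commute)
  qed
  finally show ?thesis by simp
qed

section \<open>Mean and mean square of the logarithmic kernel\<close>

lemma abs_le_1_plus_square: "\<bar>y\<bar> \<le> 1 + y\<^sup>2" for y :: real
  using zero_le_power2[of "\<bar>y\<bar> - 1/2"] by (simp add: power2_diff power_divide)

lemma circ_integrable_if_square:
  fixes x :: "real \<Rightarrow> real"
  assumes "x \<in> borel_measurable borel" "integrable circ (\<lambda>t. (x t)\<^sup>2)"
  shows "integrable circ x"
proof (rule Bochner_Integration.integrable_bound)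
  show "integrable circ (\<lambda>t. 1 + (x t)\<^sup>2)" using assms by auto
  have "\<bar>y\<bar> \<le> \<bar>1 + y\<^sup>2\<bar>" for y :: real
    using abs_le_1_plus_square[of y] by simp
  thus "AE t in circ. norm (x t) \<le> norm (1 + (x t)\<^sup>2)" by auto
qed (use assms in auto)

text \<open>On \<open>|b| < 1\<close> the square of \<open>Ln (1 - b z)\<close> is holomorphic and vanishes at 0, so its real part
  \<open>(ln |1 - b z|)\<^sup>2 - Arg\<^sup>2\<close> has mean 0.\<close>

lemma log_kernel_disc:
  assumes "norm b < 1"
  shows "(\<integral>t. ln (norm (1 - b * cis t)) \<partial>circ) = 0"
    and "integrable circ (\<lambda>t. (ln (norm (1 - b * cis t)))\<^sup>2)"
    and "(\<integral>t. (ln (norm (1 - b * cis t)))\<^sup>2 \<partial>circ) \<le> pi\<^sup>2"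
proof -
  define L where "L = (\<lambda>z. Ln (1 - b * z))"
  have pos: "Re (1 - b * z) > 0" if "norm z \<le> 1" for z
  proof -
    have "norm (b * z) < 1" using that assms
      by (metis norm_mult mult_left_le norm_ge_zero order.strict_trans1)
    thus ?thesis using abs_Re_le_cmod[of "b * z"] by simp
  qed
  hence nn: "1 - b * z \<notin> \<real>\<^sub>\<le>\<^sub>0" if "norm z \<le> 1" for z
    using that by (metis complex_nonpos_Reals_iff not_le)
  have hol: "L holomorphic_on cball 0 1" unfolding L_def
    by (intro holomorphic_intros) (use nn in auto)
  hence hol2: "(\<lambda>z. (L z)\<^sup>2) holomorphic_on cball 0 1" by (intro holomorphic_intros)
  have nz: "1 - b * cis t \<noteq> 0" for t
    using pos[of "cis t"] by (metis norm_cis order_refl zero_complex.sel(1) less_irrefl)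
  have ReL: "Re (L (cis t)) = ln (norm (1 - b * cis t))" for t
    unfolding L_def using nz by (simp add: Re_Ln)
  have ImL: "\<bar>Im (L (cis t))\<bar> \<le> pi" for t
    unfolding L_def using nz[of t] mpi_less_Im_Ln[of "1 - b * cis t"] Im_Ln_le_pi[of "1 - b * cis t"] by auto
  show "(\<integral>t. ln (norm (1 - b * cis t)) \<partial>circ) = 0"
    using circ_mean_value_Re(1)[OF hol] ReL by (simp add: L_def)
  have cL: "continuous_on (sphere 0 1) L"
    using hol by (auto intro: continuous_on_subset[OF holomorphic_on_imp_continuous_on])
  have I1: "integrable circ (\<lambda>t. (Re (L (of_real 1 * cis t)))\<^sup>2)"
    by (rule circ_integrable_continuous) (auto intro!: continuous_intros cL)
  thus "integrable circ (\<lambda>t. (ln (norm (1 - b * cis t)))\<^sup>2)" using ReL by simp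
  have I2: "integrable circ (\<lambda>t. (Im (L (of_real 1 * cis t)))\<^sup>2)"
    by (rule circ_integrable_continuous) (auto intro!: continuous_intros cL)
  have "0 = (\<integral>t. Re ((L (of_real 1 * cis t))\<^sup>2) \<partial>circ)"
    using circ_mean_value_Re(1)[OF hol2] by (simp add: L_def)
  also have "\<dots> = (\<integral>t. (Re (L (of_real 1 * cis t)))\<^sup>2 - (Im (L (of_real 1 * cis t)))\<^sup>2 \<partial>circ)"
    by (simp add: power2_eq_square)
  also have "\<dots> = (\<integral>t. (Re (L (of_real 1 * cis t)))\<^sup>2 \<partial>circ) - (\<integral>t. (Im (L (of_real 1 * cis t)))\<^sup>2 \<partial>circ)"
    by (rule Bochner_Integration.integral_diff[OF I1 I2])
  finally have *: "(\<integral>t. (Re (L (of_real 1 * cis t)))\<^sup>2 \<partial>circ) = (\<integral>t. (Im (L (of_real 1 * cis t)))\<^sup>2 \<partial>circ)"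
    by simp
  also have "(\<integral>t. (Im (L (of_real 1 * cis t)))\<^sup>2 \<partial>circ) \<le> (\<integral>t. pi\<^sup>2 \<partial>circ)"
    by (rule integral_mono[OF I2]) (use ImL in \<open>auto intro: abs_le_square_iff[THEN iffD1]\<close>)
  finally show "(\<integral>t. (ln (norm (1 - b * cis t)))\<^sup>2 \<partial>circ) \<le> pi\<^sup>2" using ReL by simp
qed

text \<open>The boundary case |b| = 1 is reached from \<rho> b with \<rho> -> 1. Fatou's lemma
  carries the mean square bound over. For the mean, dominated convergence applies because |1 -
  \<rho> w| >= |1 - w| / 2 whenever |w| <= 1: the distance from 1 - \<rho> w to 1 - w is at most 1 -
  \<rho>, which is itself at most |1 - \<rho> w|.\<close>

lemma log_kernel:
  assumes "norm b \<le> 1"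
  shows "integrable circ (\<lambda>t. ln (norm (1 - b * cis t)))"
    and "(\<integral>t. ln (norm (1 - b * cis t)) \<partial>circ) = 0"
    and "integrable circ (\<lambda>t. (ln (norm (1 - b * cis t)))\<^sup>2)"
    and "(\<integral>t. (ln (norm (1 - b * cis t)))\<^sup>2 \<partial>circ) \<le> pi\<^sup>2"
proof -
  define \<rho> where "\<rho> = (\<lambda>n. 1 - 1 / real (n + 2))"
  define y where "y = (\<lambda>n t. ln (norm (1 - of_real (\<rho> n) * b * cis t)))"
  define y' where "y' = (\<lambda>t. ln (norm (1 - b * cis t)))"
  have \<rho>: "0 \<le> \<rho> n" "\<rho> n < 1" for n by (auto simp: \<rho>_def field_simps)
  have \<rho>lim: "\<rho> \<longlonglongrightarrow> 1" unfolding \<rho>_def by real_asymp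
  have bn: "norm (of_real (\<rho> n) * b) < 1" for n
    using \<rho>[of n] assms mult_left_mono[of "norm b" 1 "\<rho> n"] by (simp add: norm_mult)
  note K = log_kernel_disc[OF bn]
  have ym: "y n \<in> borel_measurable borel" for n unfolding y_def by measurable
  have ym': "y' \<in> borel_measurable borel" unfolding y'_def by measurable
  have "AE t in circ. of_real 1 * cis t + 0 \<notin> {1 / b}"
    by (intro AE_circ_avoid) auto
  hence ae: "AE t in circ. 1 - b * cis t \<noteq> 0"
    by eventually_elim (auto simp: field_simps, metis mult.commute nonzero_eq_divide_eq mult_zero_left zero_neq_one)
  have lim: "AE t in circ. (\<lambda>n. y n t) \<longlonglongrightarrow> y' t"
    using ae
  proof eventually_elim
    case (elim t)
    have "(\<lambda>n. norm (1 - of_real (\<rho> n) * b * cis t)) \<longlonglongrightarrow> norm (1 - of_real 1 * b * cis t)"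
      by (intro tendsto_intros \<rho>lim)
    thus ?case unfolding y_def y'_def using elim
      by (intro tendsto_ln) auto
  qed
  have "(\<integral>\<^sup>+t. ennreal ((y' t)\<^sup>2) \<partial>circ) = (\<integral>\<^sup>+t. liminf (\<lambda>n. ennreal ((y n t)\<^sup>2)) \<partial>circ)"
  proof (rule nn_integral_cong_AE)
    show "AE t in circ. ennreal ((y' t)\<^sup>2) = liminf (\<lambda>n. ennreal ((y n t)\<^sup>2))"
      using lim
    proof eventually_elim
      case (elim t)
      have "(\<lambda>n. ennreal ((y n t)\<^sup>2)) \<longlonglongrightarrow> ennreal ((y' t)\<^sup>2)"
        by (intro tendsto_intros elim)
      thus ?case by (metis lim_imp_Liminf trivial_limit_sequentially)
    qed
  qed
  also have "\<dots> \<le> liminf (\<lambda>n. \<integral>\<^sup>+t. ennreal ((y n t)\<^sup>2) \<partial>circ)"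
    by (intro nn_integral_liminf) (use ym in measurable)
  also have "\<dots> \<le> ennreal (pi\<^sup>2)"
  proof -
    have *: "(\<integral>\<^sup>+t. ennreal ((y n t)\<^sup>2) \<partial>circ) \<le> ennreal (pi\<^sup>2)" for n
      unfolding y_def using K(2,3)[of n] by (subst nn_integral_eq_integral) (auto intro: ennreal_leI)
    show ?thesis by (rule Liminf_le) (use * in auto)
  qed
  finally have fin: "(\<integral>\<^sup>+t. ennreal ((y' t)\<^sup>2) \<partial>circ) \<le> ennreal (pi\<^sup>2)" .
  have I2: "integrable circ (\<lambda>t. (y' t)\<^sup>2)"
    by (rule integrableI_bounded) (use ym' fin in \<open>auto simp: le_less_trans\<close>)
  thus "integrable circ (\<lambda>t. (ln (norm (1 - b * cis t)))\<^sup>2)" unfolding y'_def .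
  have "ennreal (\<integral>t. (y' t)\<^sup>2 \<partial>circ) \<le> ennreal (pi\<^sup>2)"
    using fin I2 by (subst (asm) nn_integral_eq_integral) auto
  thus "(\<integral>t. (ln (norm (1 - b * cis t)))\<^sup>2 \<partial>circ) \<le> pi\<^sup>2" unfolding y'_def by simp
  have I: "integrable circ y'" by (rule circ_integrable_if_square[OF ym' I2])
  thus "integrable circ (\<lambda>t. ln (norm (1 - b * cis t)))" unfolding y'_def .
  have dom: "AE t in circ. norm (y n t) \<le> \<bar>y' t\<bar> + ln 2" for n
    using ae
  proof eventually_elim
    case (elim t)
    define w where "w = b * cis t"
    have w: "norm w \<le> 1" using assms by (simp add: w_def norm_mult)
    have y: "y n t = ln (norm (1 - of_real (\<rho> n) * w))" by (simp add: y_def w_def mult_ac)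
    have up: "norm (1 - of_real (\<rho> n) * w) \<le> 2"
      using norm_triangle_ineq4[of 1 "of_real (\<rho> n) * w"] bn[of n] by (simp add: w_def norm_mult mult_ac)
    have *: "norm (of_real (\<rho> n) * w) \<le> \<rho> n"
      using w \<rho>[of n] mult_left_mono[of "norm w" 1 "\<rho> n"] by (simp add: norm_mult)
    hence lo1: "norm (1 - of_real (\<rho> n) * w) \<ge> 1 - \<rho> n"
      using norm_triangle_ineq2[of 1 "of_real (\<rho> n) * w"] by simp
    have "norm (1 - w) \<le> norm (1 - of_real (\<rho> n) * w) + norm (of_real (\<rho> n - 1) * w)"
      using norm_triangle_ineq[of "1 - of_real (\<rho> n) * w" "of_real (\<rho> n - 1) * w"] by (simp add: algebra_simps)
    also have "norm (of_real (\<rho> n - 1) * w) \<le> 1 - \<rho> n"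
      using w \<rho>[of n] mult_left_mono[of "norm w" 1 "1 - \<rho> n"] unfolding norm_mult norm_of_real by simp
    finally have lo: "norm (1 - w) / 2 \<le> norm (1 - of_real (\<rho> n) * w)" using lo1 by linarith
    have p: "norm (1 - w) > 0" using elim by (simp add: w_def)
    have p': "norm (1 - of_real (\<rho> n) * w) > 0" using lo1 \<rho>[of n] by linarith
    have "ln (norm (1 - w) / 2) \<le> y n t" unfolding y
      by (subst ln_le_cancel_iff) (use lo p p' in auto)
    hence a: "y' t - ln 2 \<le> y n t" using p by (simp add: ln_div y'_def w_def)
    have "y n t \<le> ln 2" unfolding y by (subst ln_le_cancel_iff) (use up p' in auto)
    thus ?case using a by (auto simp: abs_if)
  qed
  have "(\<lambda>n. \<integral>t. y n t \<partial>circ) \<longlonglongrightarrow> (\<integral>t. y' t \<partial>circ)"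
    by (rule integral_dominated_convergence[OF _ _ _ lim dom]) (use ym ym' I in auto)
  hence "(\<integral>t. y' t \<partial>circ) = 0" unfolding y_def using K(1)
    by (simp add: LIMSEQ_const_iff)
  thus "(\<integral>t. ln (norm (1 - b * cis t)) \<partial>circ) = 0" unfolding y'_def .
qed

subsection \<open>Poles, zeros and local factorization\<close>

text \<open>By the identity theorem this is the same as not vanishing identically
  (\<open>nonzero_meroI\<close>). The cosparse form feeds directly into almost everywhere statements
  on circles.\<close>

definition nonzero_mero :: "(complex \<Rightarrow> complex) \<Rightarrow> bool" where
  "nonzero_mero f \<longleftrightarrow> f meromorphic_on UNIV \<and> (\<forall>\<^sub>\<approx>z. f z \<noteq> 0)"

text \<open>\<open>zorder\<close> carries no information about a function that vanishes identically
  near the point; the guard gives such a function multiplicity 0.\<close>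

definition pmult :: "(complex \<Rightarrow> complex) \<Rightarrow> complex \<Rightarrow> nat" where
  "pmult f z = (if is_pole f z then nat (- zorder f z) else 0)"

text \<open>The weight with which a simple pole at \<open>z\<close> enters N(r, f): the integral of
  dt / t over |z| <= t <= r, or the term ln r that is split off for a pole at the origin.\<close>

definition lweight :: "real \<Rightarrow> complex \<Rightarrow> real" where
  "lweight r z = (if z = 0 then ln r else ln (r / norm z))"

lemma nonzero_meroI:
  assumes "f meromorphic_on UNIV" "\<not> (\<forall>\<^sub>\<approx>z. f z = 0)"
  shows "nonzero_mero f"
  using meromorphic_imp_constant_or_avoid[of f UNIV 0] assms by (auto simp: nonzero_mero_def)

lemma mero_at: "f meromorphic_on UNIV \<Longrightarrow> f meromorphic_on A"
  by (erule meromorphic_on_subset) auto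

lemma mero_at_iff: "f meromorphic_on UNIV \<Longrightarrow> isolated_singularity_at f z \<and> not_essential f z"
  using mero_at[of f "{z}"] meromorphic_at_iff by blast

lemma nonzero_mero_D:
  assumes "nonzero_mero f"
  shows "f meromorphic_on UNIV" "f meromorphic_on A" "eventually (\<lambda>z. f z \<noteq> 0) (at z)"
    "frequently (\<lambda>z. f z \<noteq> 0) (at z)" "isolated_singularity_at f z" "not_essential f z"
proof -
  show 1: "f meromorphic_on UNIV" using assms by (simp add: nonzero_mero_def)
  show "f meromorphic_on A" using mero_at[OF 1] .
  show 2: "eventually (\<lambda>z. f z \<noteq> 0) (at z)"
    using assms by (auto simp: nonzero_mero_def eventually_cosparse_open_eq)
  show "frequently (\<lambda>z. f z \<noteq> 0) (at z)"
    using 2 by (simp add: eventually_frequently)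
  show "isolated_singularity_at f z" "not_essential f z" using mero_at_iff[OF 1] by auto
qed

lemma nonzero_mero_inverse: "nonzero_mero f \<Longrightarrow> nonzero_mero (\<lambda>z. 1 / f z)"
  unfolding nonzero_mero_def by (auto intro!: meromorphic_intros)

lemma nonzero_mero_mult: "nonzero_mero f \<Longrightarrow> nonzero_mero g \<Longrightarrow> nonzero_mero (\<lambda>z. f z * g z)"
  unfolding nonzero_mero_def by (auto intro!: meromorphic_intros elim: eventually_elim2)

lemma nonzero_mero_power:
  assumes f: "nonzero_mero f" shows "nonzero_mero (\<lambda>z. f z ^ n)"
proof -
  from f have "\<forall>\<^sub>\<approx>z. f z \<noteq> 0" by (simp add: nonzero_mero_def)
  hence "\<forall>\<^sub>\<approx>z. f z ^ n \<noteq> 0" by eventually_elim auto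
  moreover have "(\<lambda>z. f z ^ n) meromorphic_on UNIV"
    using f by (intro meromorphic_intros) (simp add: nonzero_mero_def)
  ultimately show ?thesis by (simp add: nonzero_mero_def)
qed

lemma mero_shift: "f meromorphic_on UNIV \<Longrightarrow> (\<lambda>z. f (z + \<eta>)) meromorphic_on UNIV"
  by (rule meromorphic_on_compose[where f = "\<lambda>z. z + \<eta>"]) (auto intro!: analytic_intros)

lemma cosparse_shift:
  assumes "\<forall>\<^sub>\<approx>z::complex. P z" shows "\<forall>\<^sub>\<approx>z. P (z + \<eta>)"
proof -
  have "(+) (-\<eta>) ` {z. \<not> P z} sparse_in UNIV"
    using assms unfolding eventually_cosparse by (rule sparse_in_translate_UNIV)
  also have "(+) (-\<eta>) ` {z. \<not> P z} = {z. \<not> P (z + \<eta>)}"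
    by (force simp: image_iff algebra_simps intro: exI[of _ "_ + \<eta>"])
  finally show ?thesis unfolding eventually_cosparse .
qed

lemma nonzero_mero_shift: "nonzero_mero f \<Longrightarrow> nonzero_mero (\<lambda>z. f (z + \<eta>))"
  unfolding nonzero_mero_def using mero_shift cosparse_shift by fast

text \<open>This converts identities of meromorphic functions, valid off a sparse set, into
  identities at almost every angle; all integrals over circles use them in this form.\<close>

lemma AE_circ_cosparse:
  assumes "\<forall>\<^sub>\<approx>z. P z" "r \<noteq> 0"
  shows "AE t in circ. P (of_real r * cis t + \<eta>)"
proof -
  have "countable {z. \<not> P z}"
    using assms(1) sparse_imp_countable[OF open_UNIV] unfolding eventually_cosparse by auto
  from AE_circ_avoid[OF this assms(2), of \<eta>] show ?thesis by eventually_elim auto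
qed

lemma mero_borel_measurable:
  assumes "f meromorphic_on UNIV" shows "f \<in> borel_measurable borel"
proof -
  have "\<forall>\<^sub>\<approx>z. f analytic_on {z}"
    by (rule meromorphic_on_imp_analytic_cosparse) fact
  hence "countable {z. \<not> f analytic_on {z}}"
    using sparse_imp_countable[OF open_UNIV] unfolding eventually_cosparse by auto
  thus ?thesis
    by (rule borel_measurable_continuous_countable_exceptions)
       (auto intro!: continuous_at_imp_continuous_on analytic_at_imp_isCont)
qed

lemma mero_circ_measurable:
  assumes "f meromorphic_on UNIV"
  shows "(\<lambda>t. f (of_real r * cis t + \<eta>)) \<in> borel_measurable borel"
  using mero_borel_measurable[OF assms] by measurable

section \<open>Pole multiplicities of sums, products and shifts\<close>

lemma zorder_ge_pmult:
  assumes "nonzero_mero f" shows "zorder f z \<ge> - int (pmult f z)"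
proof (cases "is_pole f z")
  case False
  hence "\<not> zorder f z < 0"
    using zorder_neg_imp_is_pole[of f z] nonzero_mero_D[OF assms] by auto
  thus ?thesis by (simp add: pmult_def False)
qed (auto simp: pmult_def)

lemma pmult_leI:
  assumes "f meromorphic_on UNIV" "nonzero_mero f \<Longrightarrow> zorder f z \<ge> - int m"
  shows "pmult f z \<le> m"
proof (cases "nonzero_mero f")
  case True
  thus ?thesis using assms(2) by (auto simp: pmult_def)
next
  case False
  hence "\<forall>\<^sub>\<approx>z. f z = 0" using nonzero_meroI[OF assms(1)] by auto
  hence "eventually (\<lambda>z. f z = 0) (at z)" by (auto simp: eventually_cosparse_open_eq)
  hence "is_pole f z \<longleftrightarrow> is_pole (\<lambda>_. 0 :: complex) z" by (intro is_pole_cong) auto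
  thus ?thesis by (simp add: pmult_def)
qed

lemma pmult_const [simp]: "pmult (\<lambda>_. c) z = 0"
  by (simp add: pmult_def)

lemma mero_zero_cases:
  assumes "f meromorphic_on UNIV"
  obtains "nonzero_mero f" | "\<forall>\<^sub>\<approx>z. f z = 0"
  using nonzero_meroI[OF assms] by blast

lemma pmult_cong:
  assumes "\<forall>\<^sub>\<approx>z. f z = g z" shows "pmult f z = pmult g z"
proof -
  have "eventually (\<lambda>z. f z = g z) (at z)"
    using assms by (auto simp: eventually_cosparse_open_eq)
  thus ?thesis unfolding pmult_def by (metis is_pole_cong zorder_cong)
qed

text \<open>Identically vanishing summands are separated first, since the additivity estimate for
  \<open>zorder\<close> speaks only about functions that do not vanish near the point.\<close>

lemma pmult_add:
  assumes f: "f meromorphic_on UNIV" and g: "g meromorphic_on UNIV"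
  shows "pmult (\<lambda>z. f z + g z) z \<le> pmult f z + pmult g z"
  using f
proof (cases rule: mero_zero_cases)
  case 1
  note f' = this
  show ?thesis using g
  proof (cases rule: mero_zero_cases)
    case 1
    show ?thesis
    proof (rule pmult_leI)
      show "(\<lambda>z. f z + g z) meromorphic_on UNIV" by (intro meromorphic_intros f g)
      assume n: "nonzero_mero (\<lambda>z. f z + g z)"
      show "- int (pmult f z + pmult g z) \<le> zorder (\<lambda>z. f z + g z) z"
        using zorder_ge_pmult[OF f', of z] zorder_ge_pmult[OF 1, of z]
        by (intro zorder_add_ge nonzero_mero_D(2,4)[OF f'] nonzero_mero_D(2,4)[OF 1]
            nonzero_mero_D(4)[OF n]) auto
    qed
  next
    case 2
    have "pmult (\<lambda>z. f z + g z) z = pmult f z"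
      by (rule pmult_cong) (use 2 in \<open>auto elim: eventually_mono\<close>)
    thus ?thesis by simp
  qed
next
  case 2
  have "pmult (\<lambda>z. f z + g z) z = pmult g z"
    by (rule pmult_cong) (use 2 in \<open>auto elim: eventually_mono\<close>)
  thus ?thesis by simp
qed

lemma pmult_mult:
  assumes f: "f meromorphic_on UNIV" and g: "g meromorphic_on UNIV"
  shows "pmult (\<lambda>z. f z * g z) z \<le> pmult f z + pmult g z"
proof (rule pmult_leI)
  show "(\<lambda>z. f z * g z) meromorphic_on UNIV" by (intro meromorphic_intros f g)
  assume n: "nonzero_mero (\<lambda>z. f z * g z)"
  have f': "nonzero_mero f" and g': "nonzero_mero g"
    using n f g by (auto simp: nonzero_mero_def elim: eventually_mono)
  show "- int (pmult f z + pmult g z) \<le> zorder (\<lambda>z. f z * g z) z"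
    using zorder_ge_pmult[OF f', of z] zorder_ge_pmult[OF g', of z]
    by (subst zorder_mult) (auto intro!: nonzero_mero_D(2,4)[OF f'] nonzero_mero_D(2,4)[OF g'])
qed

lemma pmult_shift: "pmult (\<lambda>z. f (z + \<eta>)) z = pmult f (z + \<eta>)"
proof -
  have "is_pole (\<lambda>z. f (z + \<eta>)) z = is_pole f (z + \<eta>)"
    by (subst (1 2) is_pole_shift_0) (simp add: algebra_simps)
  moreover have "zorder (\<lambda>z. f (z + \<eta>)) z = zorder f (z + \<eta>)"
    by (subst (1 2) zorder_shift) (simp add: algebra_simps)
  ultimately show ?thesis by (simp add: pmult_def)
qed

text \<open>Zeros are counted as poles of the reciprocal, which is how N(r, 1/f) is encoded. With
  this, the signed sum over the divisor in Jensen's formula becomes a difference of two counting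
  functions.\<close>

lemma zorder_eq_pmult:
  assumes f: "nonzero_mero f"
  shows "zorder f z = int (pmult (\<lambda>z. 1 / f z) z) - int (pmult f z)"
proof -
  have p: "is_pole (\<lambda>z. 1 / f z) z \<longleftrightarrow> isolated_zero f z"
    using is_pole_inverse_iff[of f z] by (simp add: inverse_eq_divide)
  have zi: "zorder (\<lambda>z. 1 / f z) z = - zorder f z"
    using zorder_divide[of "\<lambda>_. 1" z f] nonzero_mero_D[OF f] meromorphic_on_const[of 1 "{z}"] by simp
  consider "is_pole f z" | "isolated_zero f z" | "\<not> is_pole f z" "\<not> isolated_zero f z" by blast
  thus ?thesis
  proof cases
    case 1
    hence "\<not> isolated_zero f z" using pole_is_not_zero by blast
    moreover have "zorder f z < 0"
      using isolated_pole_imp_neg_zorder[OF nonzero_mero_D(5)[OF f] 1] .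
    ultimately show ?thesis using 1 p zi by (simp add: pmult_def)
  next
    case 2
    hence "\<not> is_pole f z" using pole_is_not_zero by blast
    moreover have "zorder f z > 0"
      using zorder_isolated_zero_pos'[OF 2 nonzero_mero_D(5)[OF f]] .
    ultimately show ?thesis using 2 p zi by (simp add: pmult_def)
  next
    case 3
    thus ?thesis
      using p not_pole_not_isolated_zero_imp_zorder_eq_0[of f z] nonzero_mero_D[OF f]
      by (simp add: pmult_def)
  qed
qed

section \<open>The integrated counting function as a weighted sum over poles\<close>

lemma finite_poles_cball:
  assumes "f meromorphic_on UNIV" shows "finite {z \<in> cball 0 r. is_pole f z}"
proof -
  have "\<forall>\<^sub>\<approx>z. \<not> is_pole f z"
    using meromorphic_on_imp_not_pole_cosparse[OF assms] .
  hence "{z. is_pole f z} sparse_in UNIV" by (simp add: eventually_cosparse)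
  hence "{z. is_pole f z} sparse_in cball 0 r" by (rule sparse_in_subset) auto
  from sparse_in_compact_finite[OF this] have "finite (cball 0 r \<inter> {z. is_pole f z})" by simp
  also have "cball 0 r \<inter> {z. is_pole f z} = {z \<in> cball 0 r. is_pole f z}" by blast
  finally show ?thesis .
qed

lemma has_integral_inverse_cut:
  assumes "0 < c" "c \<le> r"
  shows "((\<lambda>t. if c \<le> t then 1 / t else 0) has_integral ln (r / c)) {0..r::real}"
proof -
  have "((\<lambda>t. 1 / t) has_integral (ln r - ln c)) {c..r}"
    by (rule fundamental_theorem_of_calculus)
       (use assms in \<open>auto intro!: derivative_eq_intros simp flip: has_real_derivative_iff_has_vector_derivative\<close>)
  hence "((\<lambda>t. if t \<in> {c..r} then 1 / t else 0) has_integral (ln r - ln c)) {0..r}"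
    by (subst has_integral_restrict) (use assms in auto)
  moreover have "(\<lambda>t. if t \<in> {c..r} then 1 / t else 0) t = (if c \<le> t then 1 / t else 0)" if "t \<in> {0..r}" for t
    using that by auto
  ultimately have "((\<lambda>t. if c \<le> t then 1 / t else 0) has_integral (ln r - ln c)) {0..r}"
    by (rule has_integral_eq[rotated]) 
  thus ?thesis using assms by (simp add: ln_div)
qed

text \<open>For t <= r the count n(t) is a finite sum of steps at the moduli of the poles, and each
  step integrates against dt / t to \<open>lweight\<close>. A pole at the origin would make the
  integrand non-integrable, which is why its contribution appears as the separate term with ln
  r.\<close>

lemma int_pole_count_eq:
  assumes f: "f meromorphic_on UNIV" and r: "r > 0"
  shows "int_pole_count r f = (\<Sum>z | z \<in> cball 0 r \<and> is_pole f z. real (pmult f z) * lweight r z)"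
proof -
  define P where "P = {z. z \<in> cball 0 r \<and> is_pole f z}"
  have fin: "finite P" unfolding P_def using finite_poles_cball[OF f, of r] by simp
  have cnt: "real (pole_count t f) = (\<Sum>z\<in>P. if norm z \<le> t then real (pmult f z) else 0)" if "t \<le> r" for t
  proof -
    have "real (pole_count t f) = (\<Sum>z\<in>{z\<in>P. norm z \<le> t}. real (pmult f z))"
      unfolding pole_count_def of_nat_sum
      by (rule sum.cong) (use that in \<open>auto simp: P_def pmult_def\<close>)
    also have "\<dots> = (\<Sum>z\<in>P. if norm z \<le> t then real (pmult f z) else 0)"
      by (subst sum.inter_filter[OF fin]) auto
    finally show ?thesis .
  qed
  have c0: "real (pole_count 0 f) = (\<Sum>z\<in>P. if z = 0 then real (pmult f z) else 0)"
    using cnt[of 0] r by simp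
  have eq: "(real (pole_count t f) - real (pole_count 0 f)) / t =
     (\<Sum>z\<in>P-{0}. real (pmult f z) * (if norm z \<le> t then 1 / t else 0))" if "t \<in> {0..r}" for t
  proof (cases "t = 0")
    case False
    have "real (pole_count t f) - real (pole_count 0 f) =
          (\<Sum>z\<in>P. (if norm z \<le> t then real (pmult f z) else 0) - (if z = 0 then real (pmult f z) else 0))"
    proof -
      have "t \<le> r" using that by simp
      show ?thesis by (simp only: cnt[OF \<open>t \<le> r\<close>] c0 sum_subtractf)
    qed
    also have "\<dots> = (\<Sum>z\<in>P-{0}. if norm z \<le> t then real (pmult f z) else 0)"
      using that fin by (intro sum.mono_neutral_cong_right) auto
    finally have "(real (pole_count t f) - real (pole_count 0 f)) / t =
        (\<Sum>z\<in>P-{0}. (if norm z \<le> t then real (pmult f z) else 0) / t)"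
      by (simp only: sum_divide_distrib)
    also have "\<dots> = (\<Sum>z\<in>P-{0}. real (pmult f z) * (if norm z \<le> t then 1 / t else 0))"
      by (intro sum.cong refl) simp
    finally show ?thesis .
  next
    case True
    \<comment> \<open>At \<open>t = 0\<close> both sides are 0, by the convention on division by
      zero and because no nonzero pole has modulus at most 0.\<close>
    thus ?thesis by (auto intro!: sum.neutral[symmetric])
  qed
  have "((\<lambda>t. \<Sum>z\<in>P-{0}. real (pmult f z) * (if norm z \<le> t then 1 / t else 0)) has_integral
         (\<Sum>z\<in>P-{0}. real (pmult f z) * ln (r / norm z))) {0..r}"
    using fin by (intro has_integral_sum has_integral_mult_right has_integral_inverse_cut) (auto simp: P_def)
  from integral_unique[OF this]
  have "integral {0..r} (\<lambda>t. (real (pole_count t f) - real (pole_count 0 f)) / t) =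
     (\<Sum>z\<in>P-{0}. real (pmult f z) * ln (r / norm z))"
    by (rule trans[OF Henstock_Kurzweil_Integration.integral_cong, rotated]) (rule eq)
  also have "\<dots> = (\<Sum>z\<in>P-{0}. real (pmult f z) * lweight r z)"
    by (intro sum.cong) (auto simp: lweight_def)
  also have "\<dots> + real (pole_count 0 f) * ln r = (\<Sum>z\<in>P. real (pmult f z) * lweight r z)"
  proof (cases "0 \<in> P")
    case True
    have "(\<Sum>z\<in>P. real (pmult f z) * lweight r z) =
        real (pmult f 0) * lweight r 0 + (\<Sum>z\<in>P-{0}. real (pmult f z) * lweight r z)"
      by (rule sum.remove[OF fin True])
    moreover have "real (pole_count 0 f) = real (pmult f 0)"
      unfolding c0 using fin True by simp
    ultimately show ?thesis by (simp add: lweight_def)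
  next
    case False
    hence "P - {0} = P" by auto
    thus ?thesis unfolding c0 using fin False by simp
  qed
  finally show ?thesis unfolding int_pole_count_def P_def .
qed

text \<open>Any finite set containing the poles may serve as index set, so that the counting
  functions of several functions can be compared over one common set.\<close>

lemma int_pole_count_eq_superset:
  assumes f: "f meromorphic_on UNIV" and r: "r > 0" and A: "finite A" "A \<subseteq> cball 0 r"
    and P: "\<And>z. z \<in> cball 0 r \<Longrightarrow> pmult f z \<noteq> 0 \<Longrightarrow> z \<in> A"
  shows "int_pole_count r f = (\<Sum>z\<in>A. real (pmult f z) * lweight r z)"
proof -
  define P where "P = {z. z \<in> cball 0 r \<and> is_pole f z}"
  have fin: "finite P" unfolding P_def using finite_poles_cball[OF f, of r] by simp
  have "(\<Sum>z\<in>P. real (pmult f z) * lweight r z) = (\<Sum>z\<in>P\<union>A. real (pmult f z) * lweight r z)"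
  proof (rule sum.mono_neutral_left)
    show "\<forall>z\<in>P \<union> A - P. real (pmult f z) * lweight r z = 0"
      using A(2) by (auto simp: P_def pmult_def)
  qed (use fin A(1) in auto)
  also have "\<dots> = (\<Sum>z\<in>A. real (pmult f z) * lweight r z)"
  proof (rule sum.mono_neutral_right)
    show "\<forall>z\<in>P \<union> A - A. real (pmult f z) * lweight r z = 0"
    proof
      fix z assume z: "z \<in> P \<union> A - A"
      hence "pmult f z = 0" using P[of z] by (auto simp: P_def)
      thus "real (pmult f z) * lweight r z = 0" by simp
    qed
  qed (use fin A(1) in auto)
  finally show ?thesis unfolding int_pole_count_eq[OF f r] P_def .
qed

lemma lweight_nonneg: "r \<ge> 1 \<Longrightarrow> norm z \<le> r \<Longrightarrow> lweight r z \<ge> 0"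
  by (auto simp: lweight_def intro!: ln_ge_zero)

lemma lweight_mono: "0 < r \<Longrightarrow> r \<le> R \<Longrightarrow> lweight r z \<le> lweight R z"
  by (auto simp: lweight_def divide_right_mono)

lemma finite_pmult_cball:
  assumes "f meromorphic_on UNIV" shows "finite {z \<in> cball 0 r. pmult f z \<noteq> 0}"
  by (rule finite_subset[OF _ finite_poles_cball[OF assms, of r]]) (auto simp: pmult_def)

lemma int_pole_count_nonneg:
  assumes "f meromorphic_on UNIV" "r \<ge> 1" shows "int_pole_count r f \<ge> 0"
  using assms by (subst int_pole_count_eq) (auto intro!: sum_nonneg mult_nonneg_nonneg lweight_nonneg)

lemma int_pole_count_mono:
  assumes f: "f meromorphic_on UNIV" and r: "0 < r" "r \<le> R"
  shows "int_pole_count r f \<le> int_pole_count R f"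
proof -
  define A where "A = {z \<in> cball 0 r. pmult f z \<noteq> 0}"
  define B where "B = {z \<in> cball 0 R. pmult f z \<noteq> 0}"
  have fin: "finite A" "finite B" unfolding A_def B_def by (rule finite_pmult_cball[OF f])+
  have "int_pole_count r f = (\<Sum>z\<in>A. real (pmult f z) * lweight r z)"
    using fin by (intro int_pole_count_eq_superset f r) (auto simp: A_def)
  also have "\<dots> \<le> (\<Sum>z\<in>A. real (pmult f z) * lweight R z)"
    by (intro sum_mono mult_left_mono lweight_mono r) auto
  also have "\<dots> \<le> (\<Sum>z\<in>B. real (pmult f z) * lweight R z)"
  proof (rule sum_mono2)
    show "A \<subseteq> B" using r by (auto simp: A_def B_def)
    \<comment> \<open>For R < 1 the origin has negative weight, but it is never among the added
      points: if it is a pole, it already lies in \<open>A\<close>.\<close>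
    show "real (pmult f z) * lweight R z \<ge> 0" if "z \<in> B - A" for z
    proof -
      have "z \<noteq> 0" "norm z \<le> R" using that r by (auto simp: A_def B_def)
      thus ?thesis by (auto simp: lweight_def intro!: mult_nonneg_nonneg ln_ge_zero)
    qed
  qed fact
  also have "\<dots> = int_pole_count R f"
    using fin r by (intro int_pole_count_eq_superset[symmetric] f) (auto simp: B_def)
  finally show ?thesis .
qed

text \<open>For r >= 1 all weights are nonnegative, so a pointwise inequality between multiplicities
  passes to the counting functions. For r < 1 the weight ln r of the origin has the wrong
  sign.\<close>

lemma int_pole_count_le_sum:
  fixes c :: "'i \<Rightarrow> nat" and g :: "'i \<Rightarrow> complex \<Rightarrow> complex"
  assumes f: "f meromorphic_on UNIV" and g: "\<And>i. i \<in> I \<Longrightarrow> g i meromorphic_on UNIV"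
    and I: "finite I" and r: "r \<ge> 1"
    and le: "\<And>z. pmult f z \<le> (\<Sum>i\<in>I. c i * pmult (g i) z)"
  shows "int_pole_count r f \<le> (\<Sum>i\<in>I. real (c i) * int_pole_count r (g i))"
proof -
  define A where "A = {z \<in> cball 0 r. pmult f z \<noteq> 0} \<union> (\<Union>i\<in>I. {z \<in> cball 0 r. pmult (g i) z \<noteq> 0})"
  have fin: "finite A" unfolding A_def
    by (intro finite_UnI finite_UN_I I finite_pmult_cball f g)
  have "int_pole_count r f = (\<Sum>z\<in>A. real (pmult f z) * lweight r z)"
    by (rule int_pole_count_eq_superset[OF f]) (use r fin in \<open>auto simp: A_def\<close>)
  also have "\<dots> \<le> (\<Sum>z\<in>A. real (\<Sum>i\<in>I. c i * pmult (g i) z) * lweight r z)"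
    by (intro sum_mono mult_right_mono lweight_nonneg r of_nat_mono le) (auto simp: A_def)
  also have "\<dots> = (\<Sum>i\<in>I. real (c i) * (\<Sum>z\<in>A. real (pmult (g i) z) * lweight r z))"
    by (simp add: sum_distrib_right sum_distrib_left mult_ac) (rule sum.swap)
  also have "\<dots> = (\<Sum>i\<in>I. real (c i) * int_pole_count r (g i))"
  proof (intro sum.cong refl arg_cong2[where f = "(*)"])
    fix i assume i: "i \<in> I"
    show "(\<Sum>z\<in>A. real (pmult (g i) z) * lweight r z) = int_pole_count r (g i)"
      by (rule int_pole_count_eq_superset[symmetric, OF g[OF i]]) (use r fin i in \<open>auto simp: A_def\<close>)
  qed
  finally show ?thesis .
qed

lemma int_pole_count_le:
  assumes f: "f meromorphic_on UNIV" and g: "g meromorphic_on UNIV" and r: "r \<ge> 1"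
    and le: "\<And>z. pmult f z \<le> m * pmult g z"
  shows "int_pole_count r f \<le> m * int_pole_count r g"
  using int_pole_count_le_sum[of f "{()}" "\<lambda>_. g" r "\<lambda>_. m"] assms by simp

lemma int_pole_count_cong:
  assumes f: "f meromorphic_on UNIV" and g: "g meromorphic_on UNIV" and r: "r \<ge> 1"
    and le: "\<And>z. pmult f z = pmult g z"
  shows "int_pole_count r f = int_pole_count r g"
  using int_pole_count_le[of f g r 1] int_pole_count_le[of g f r 1] assms by simp

section \<open>Dividing out the zeros and poles in a disc\<close>

lemma zorder_linear: "zorder (\<lambda>w. w - a) z = (if z = a then 1 else 0 :: int)"
proof (cases "z = a")
  case True
  have "zorder (\<lambda>w. w - a) z = int 1"
    by (rule zorder_eqI[where S = UNIV and g = "\<lambda>_. 1"]) (use True in auto)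
  thus ?thesis using True by simp
next
  case False
  have "(\<lambda>w. w - a) analytic_on {z}" by (intro analytic_intros)
  from zorder_eq_0I[OF this] show ?thesis using False by simp
qed

text \<open>The rational function \<open>Q\<close> has the divisor of \<open>f\<close> in the disc.
  The quotient has order 0 at every point there, so after removing singularities it is holomorphic
  without zeros, and on a disc such a function has a holomorphic logarithm. The divisor is collected
  in the closed disc, whose compactness makes \<open>S\<close> finite; the logarithm lives on the
  open one.\<close>

lemma local_factorization:
  assumes f: "nonzero_mero f" and R: "R > 0"
  defines "S \<equiv> {z \<in> cball 0 R. zorder f z \<noteq> 0}"
  obtains g where "finite S" "g holomorphic_on ball 0 R"
    "\<forall>\<^sub>\<approx>z. z \<in> ball 0 R \<longrightarrow> f z \<noteq> 0 \<and>
       ln (norm (f z)) = (\<Sum>a\<in>S. of_int (zorder f a) * ln (norm (z - a))) + Re (g z)"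
proof -
  note fm = nonzero_mero_D[OF f]
  note fim = nonzero_mero_D[OF nonzero_mero_inverse[OF f]]
  have finS: "finite S"
  proof (rule finite_subset)
    show "S \<subseteq> {z \<in> cball 0 R. pmult f z \<noteq> 0} \<union> {z \<in> cball 0 R. pmult (\<lambda>z. 1 / f z) z \<noteq> 0}"
      by (auto simp: S_def zorder_eq_pmult[OF f])
  qed (intro finite_UnI finite_pmult_cball fm(1) fim(1))
  define Q where "Q = (\<lambda>z. \<Prod>a\<in>S. (z - a) powi zorder f a)"
  have Qm: "Q meromorphic_on UNIV" unfolding Q_def by (intro meromorphic_intros)
  have Q0: "Q z \<noteq> 0" if "z \<notin> S" for z using that finS by (auto simp: Q_def)
  have evQ: "\<forall>\<^sub>\<approx>z. Q z \<noteq> 0"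
    using eventually_not_in_cosparse[OF finite_imp_sparse[OF finS], of UNIV]
    by eventually_elim (use Q0 in auto)
  have Qn: "nonzero_mero Q" using Qm evQ by (simp add: nonzero_mero_def)
  have zQ: "zorder Q z = zorder f z" if z: "z \<in> ball 0 R" for z
  proof -
    have fr: "\<exists>\<^sub>F w in at z. w - a \<noteq> 0" for a
    proof -
      have "\<forall>\<^sub>F w in at z. w - a \<noteq> 0"
        by (metis (mono_tags, lifting) eventually_mono eventually_neq_at_within right_minus_eq)
      thus ?thesis by (simp add: eventually_frequently)
    qed
    have "zorder Q z = (\<Sum>a\<in>S. zorder (\<lambda>z. (z - a) powi zorder f a) z)"
      unfolding Q_def
      by (rule zorder_prod) (use nonzero_mero_D(3)[OF Qn] in \<open>auto intro!: meromorphic_intros simp: Q_def\<close>)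
    also have "\<dots> = (\<Sum>a\<in>S. zorder f a * (if z = a then 1 else 0))"
      by (intro sum.cong refl, subst zorder_power_int)
         (use fr in \<open>auto intro!: meromorphic_intros simp: zorder_linear\<close>)
    also have "\<dots> = (if z \<in> S then zorder f z else 0)"
      using finS by (simp add: if_distrib cong: if_cong)
    also have "\<dots> = zorder f z" using z by (auto simp: S_def)
    finally show ?thesis .
  qed
  define q where "q = (\<lambda>z. f z / Q z)"
  have qm: "q meromorphic_on UNIV" unfolding q_def by (intro meromorphic_intros fm Qm)
  have qn: "nonzero_mero q"
    using f Qn by (auto simp: nonzero_mero_def q_def intro!: meromorphic_intros elim: eventually_elim2)
  note qm' = nonzero_mero_D[OF qn]
  define h where "h = remove_sings q"
  have hz: "h analytic_on {z}" "h z \<noteq> 0" if z: "z \<in> ball 0 R" for z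
  proof -
    have zq: "zorder q z = 0" unfolding q_def
      by (subst zorder_divide) (use zQ[OF z] fm nonzero_mero_D[OF Qn] in auto)
    have np: "\<not> is_pole q z"
      using isolated_pole_imp_neg_zorder[OF qm'(5), of z] zq by auto
    have nz: "\<not> isolated_zero q z"
      using zorder_isolated_zero_pos'[OF _ qm'(5), of z] zq by auto
    obtain c where c: "q \<midarrow>z\<rightarrow> c" using qm'(6)[of z] np by (auto simp: not_essential_def)
    show "h analytic_on {z}" unfolding h_def by (rule remove_sings_analytic_at[OF qm'(5) c])
    have "\<not> q \<midarrow>z\<rightarrow> 0" using nz qm'(3)[of z] by (auto simp: isolated_zero_def)
    thus "h z \<noteq> 0" unfolding h_def using remove_sings_eq_0_iff[OF qm'(6)] np by auto
  qed
  have hol: "h holomorphic_on ball 0 R"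
    by (rule analytic_imp_holomorphic, subst analytic_on_analytic_at) (use hz in auto)
  obtain g where g: "g holomorphic_on ball 0 R" "\<And>z. z \<in> ball 0 R \<Longrightarrow> h z = exp (g z)"
    using contractible_imp_holomorphic_log[OF hol] hz(2) convex_imp_contractible[of "ball 0 R"] by (metis convex_ball)
  have "\<forall>\<^sub>\<approx>z. h z = q z" unfolding h_def by (rule eventually_remove_sings_eq[OF qm])
  moreover have "\<forall>\<^sub>\<approx>z. f z \<noteq> 0" using f by (simp add: nonzero_mero_def)
  moreover have "\<forall>\<^sub>\<approx>z. z \<notin> S" using eventually_not_in_cosparse[OF finite_imp_sparse[OF finS], of UNIV] .
  ultimately have "\<forall>\<^sub>\<approx>z. z \<in> ball 0 R \<longrightarrow> f z \<noteq> 0 \<and>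
       ln (norm (f z)) = (\<Sum>a\<in>S. of_int (zorder f a) * ln (norm (z - a))) + Re (g z)"
  proof eventually_elim
    case (elim z)
    show ?case
    proof (intro impI conjI)
      assume z: "z \<in> ball 0 R"
      show "f z \<noteq> 0" by fact
      have "f z = Q z * exp (g z)" using elim Q0[of z] g(2)[OF z] by (simp add: q_def)
      hence "ln (norm (f z)) = ln (norm (Q z)) + Re (g z)"
        using Q0[of z] elim by (simp add: norm_mult ln_mult)
      also have "norm (Q z) = (\<Prod>a\<in>S. norm (z - a) powi zorder f a)"
        by (simp add: Q_def norm_power_int flip: prod_norm)
      also have "ln \<dots> = (\<Sum>a\<in>S. ln (norm (z - a) powi zorder f a))"
        by (rule ln_prod) (use elim finS in auto)
      also have "\<dots> = (\<Sum>a\<in>S. of_int (zorder f a) * ln (norm (z - a)))"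
      proof (intro sum.cong refl)
        fix a assume "a \<in> S"
        hence p: "norm (z - a) > 0" using elim by auto
        have "norm (z - a) powi zorder f a = norm (z - a) powr of_int (zorder f a)"
          using p by (simp add: powr_real_of_int')
        thus "ln (norm (z - a) powi zorder f a) = of_int (zorder f a) * ln (norm (z - a))"
          using p by (simp add: ln_powr)
      qed
      finally show "ln (norm (f z)) = (\<Sum>a\<in>S. of_int (zorder f a) * ln (norm (z - a))) + Re (g z)" .
    qed
  qed
  from that[OF finS g(1) this] show ?thesis .
qed

subsection \<open>Jensen's formula and the characteristic\<close>

lemma circ_integrable_cong_AE:
  fixes x y :: "real \<Rightarrow> real"
  assumes "integrable circ y" "x \<in> borel_measurable borel" "AE t in circ. x t = y t"
  shows "integrable circ x" "integral\<^sup>L circ x = integral\<^sup>L circ y"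
proof -
  have y: "y \<in> borel_measurable circ" using assms(1) by (rule borel_measurable_integrable)
  have x: "x \<in> borel_measurable circ" using assms(2) by simp
  show "integrable circ x" using integrable_cong_AE[OF x y assms(3)] assms(1) by simp
  show "integral\<^sup>L circ x = integral\<^sup>L circ y" by (rule integral_cong_AE[OF x y assms(3)])
qed

text \<open>Both positions of \<open>a\<close> lead to the kernel |1 - b e^(it)| with |b| <= 1: an
  outer point is factored out directly, while for an inner one r e^(it) is factored out and the
  remaining factor is conjugated, which preserves the modulus.\<close>

lemma norm_circle_diff:
  assumes "r > 0"
  obtains b where "norm b \<le> 1" "\<And>t. norm (of_real r * cis t - a) = max r (norm a) * norm (1 - b * cis t)"
proof (cases "norm a \<le> r")
  case True
  show ?thesis
  proof (rule that[of "cnj (a / of_real r)"])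
    show "norm (cnj (a / of_real r)) \<le> 1" using True assms by (simp add: norm_divide)
    fix t
    have "of_real r * cis t - a = of_real r * cis t * cnj (1 - cnj (a / of_real r) * cis t)"
      using assms by (simp add: algebra_simps cis_cnj cis_mult flip: cis_divide)
    thus "norm (of_real r * cis t - a) = max r (norm a) * norm (1 - cnj (a / of_real r) * cis t)"
      using True assms by (simp only: norm_mult complex_mod_cnj) simp
  qed
next
  case False
  show ?thesis
  proof (rule that[of "of_real r / a"])
    have a: "a \<noteq> 0" using False assms by auto
    show "norm (of_real r / a) \<le> 1" using False assms a by (simp add: norm_divide divide_le_eq)
    fix t
    have "of_real r * cis t - a = - a * (1 - of_real r / a * cis t)"
      using a by (simp add: algebra_simps)
    thus "norm (of_real r * cis t - a) = max r (norm a) * norm (1 - of_real r / a * cis t)"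
      using False by (simp add: norm_mult max_def)
  qed
qed

text \<open>The kernel has mean 0, so the cross term disappears when the square is expanded: the
  second moment about \<open>c\<close> is the squared offset plus the second moment of the kernel,
  which is at most \<open>pi\<^sup>2\<close>.\<close>

lemma log_circle_diff:
  assumes r: "r > 0"
  shows "integrable circ (\<lambda>t. ln (norm (of_real r * cis t - a)))"
    and "(\<integral>t. ln (norm (of_real r * cis t - a)) \<partial>circ) = ln (max r (norm a))"
    and "integrable circ (\<lambda>t. (ln (norm (of_real r * cis t - a)) - c)\<^sup>2)"
    and "(\<integral>t. (ln (norm (of_real r * cis t - a)) - c)\<^sup>2 \<partial>circ) \<le> (ln (max r (norm a)) - c)\<^sup>2 + pi\<^sup>2"
proof -
  obtain b where b: "norm b \<le> 1" "\<And>t. norm (of_real r * cis t - a) = max r (norm a) * norm (1 - b * cis t)"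
    using norm_circle_diff[OF r, of a] by blast
  note K = log_kernel[OF b(1)]
  define m where "m = max r (norm a)"
  have m: "m > 0" using r by (simp add: m_def)
  define y where "y = (\<lambda>t. ln (norm (1 - b * cis t)))"
  have ym: "y \<in> borel_measurable borel" unfolding y_def by measurable
  \<comment> \<open>This excludes the point of the circle where the kernel vanishes and the
    logarithm of the product does not split.\<close>
  have "AE t in circ. of_real 1 * cis t + 0 \<notin> {1 / b}" by (intro AE_circ_avoid) auto
  hence ae: "AE t in circ. ln (norm (of_real r * cis t - a)) = ln m + y t"
  proof eventually_elim
    case (elim t)
    have "1 - b * cis t \<noteq> 0"
    proof
      assume "1 - b * cis t = 0"
      moreover from this have "b \<noteq> 0" by auto
      ultimately have "cis t = 1 / b" by (simp add: field_simps)
      thus False using elim by simp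
    qed
    thus ?case using m unfolding b(2) y_def m_def[symmetric] by (simp add: ln_mult)
  qed
  have I: "integrable circ (\<lambda>t. ln m + y t)" using K(1) by (simp add: y_def)
  show "integrable circ (\<lambda>t. ln (norm (of_real r * cis t - a)))"
    by (rule circ_integrable_cong_AE(1)[OF I _ ae]) measurable
  have "(\<integral>t. ln (norm (of_real r * cis t - a)) \<partial>circ) = (\<integral>t. ln m + y t \<partial>circ)"
    by (rule circ_integrable_cong_AE(2)[OF I _ ae]) measurable
  also have "\<dots> = ln m" using K(1,2) by (simp add: y_def)
  finally show "(\<integral>t. ln (norm (of_real r * cis t - a)) \<partial>circ) = ln (max r (norm a))" by (simp add: m_def)
  have ae2: "AE t in circ. (ln (norm (of_real r * cis t - a)) - c)\<^sup>2 = (ln m - c)\<^sup>2 + 2 * (ln m - c) * y t + (y t)\<^sup>2"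
    using ae by eventually_elim (simp add: power2_eq_square algebra_simps)
  have I2: "integrable circ (\<lambda>t. (ln m - c)\<^sup>2 + 2 * (ln m - c) * y t + (y t)\<^sup>2)"
    using K(1,3) by (auto simp: y_def)
  show "integrable circ (\<lambda>t. (ln (norm (of_real r * cis t - a)) - c)\<^sup>2)"
    by (rule circ_integrable_cong_AE(1)[OF I2 _ ae2]) measurable
  have "(\<integral>t. (ln (norm (of_real r * cis t - a)) - c)\<^sup>2 \<partial>circ) =
        (\<integral>t. (ln m - c)\<^sup>2 + 2 * (ln m - c) * y t + (y t)\<^sup>2 \<partial>circ)"
    by (rule circ_integrable_cong_AE(2)[OF I2 _ ae2]) measurable
  also have "\<dots> = (ln m - c)\<^sup>2 + (\<integral>t. (y t)\<^sup>2 \<partial>circ)"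
    using K(1,2,3) by (simp add: y_def)
  finally show "(\<integral>t. (ln (norm (of_real r * cis t - a)) - c)\<^sup>2 \<partial>circ) \<le> (ln (max r (norm a)) - c)\<^sup>2 + pi\<^sup>2"
    using K(4) by (simp add: m_def y_def)
qed

lemma zorder_0_imp_pmult_0:
  assumes f: "nonzero_mero f" and z: "zorder f z = 0"
  shows "pmult f z = 0" "pmult (\<lambda>z. 1 / f z) z = 0"
proof -
  show *: "pmult f z = 0"
    using isolated_pole_imp_neg_zorder[OF nonzero_mero_D(5)[OF f], of z] z by (auto simp: pmult_def)
  show "pmult (\<lambda>z. 1 / f z) z = 0" using zorder_eq_pmult[OF f, of z] z * by simp
qed

lemma pmult_eq_nat_zorder: "nonzero_mero f \<Longrightarrow> pmult f z = nat (- zorder f z)"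
  using zorder_ge_pmult[of f z] by (auto simp: pmult_def)

text \<open>The mean is computed term by term from the factorization. The point is that
  \<open>c\<close> does not depend on \<open>r\<close>: it is the logarithm of the modulus of the
  leading Laurent coefficient of \<open>f\<close> at the origin.\<close>

lemma Jensen_disc:
  assumes f: "nonzero_mero f" and R: "R > 0"
  shows "\<exists>c. \<forall>r. 0 < r \<longrightarrow> r < R \<longrightarrow>
    integrable circ (\<lambda>t. ln (norm (f (of_real r * cis t)))) \<and>
    (\<integral>t. ln (norm (f (of_real r * cis t))) \<partial>circ) =
      c + int_pole_count r (\<lambda>z. 1 / f z) - int_pole_count r f"
proof -
  define S where "S = {z \<in> cball 0 R. zorder f z \<noteq> 0}"
  obtain g where S: "finite S" and g: "g holomorphic_on ball 0 R" and ev: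
    "\<forall>\<^sub>\<approx>z. z \<in> ball 0 R \<longrightarrow> f z \<noteq> 0 \<and>
       ln (norm (f z)) = (\<Sum>a\<in>S. of_int (zorder f a) * ln (norm (z - a))) + Re (g z)"
    using local_factorization[OF f R] unfolding S_def by blast
  note fm = nonzero_mero_D(1)[OF f] nonzero_mero_D(1)[OF nonzero_mero_inverse[OF f]]
  define l where "l = (\<lambda>a::complex. if a = 0 then 0 else ln (norm a))"
  show ?thesis
  proof (intro exI[of _ "(\<Sum>a\<in>S. of_int (zorder f a) * l a) + Re (g 0)"] allI impI)
    fix r :: real assume r: "0 < r" "r < R"
    have gr: "g holomorphic_on cball 0 r" by (rule holomorphic_on_subset[OF g]) (use r in auto)
    note G = circ_mean_value_Re[OF gr r(1)]
    define h where "h = (\<lambda>t. (\<Sum>a\<in>S. of_int (zorder f a) * ln (norm (of_real r * cis t - a))) +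
      Re (g (of_real r * cis t)))"
    have ae: "AE t in circ. ln (norm (f (of_real r * cis t))) = h t"
      using AE_circ_cosparse[OF ev, of r 0] r
      by (auto simp: h_def norm_mult)
    have Ih: "integrable circ h" unfolding h_def
      by (intro Bochner_Integration.integrable_add Bochner_Integration.integrable_sum
          integrable_mult_right log_circle_diff r G)
    have fmeas: "(\<lambda>t. ln (norm (f (of_real r * cis t)))) \<in> borel_measurable borel"
      using mero_circ_measurable[OF fm(1), of r 0] by simp
    have I1: "integrable circ (\<lambda>t. ln (norm (f (of_real r * cis t))))"
      by (rule circ_integrable_cong_AE(1)[OF Ih fmeas ae])
    have "(\<integral>t. ln (norm (f (of_real r * cis t))) \<partial>circ) = integral\<^sup>L circ h"
      by (rule circ_integrable_cong_AE(2)[OF Ih fmeas ae])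
    also have "\<dots> = (\<Sum>a\<in>S. of_int (zorder f a) * ln (max r (norm a))) + Re (g 0)"
      unfolding h_def
      by (subst Bochner_Integration.integral_add,
          intro Bochner_Integration.integrable_sum integrable_mult_right log_circle_diff r, rule G(2),
          subst Bochner_Integration.integral_sum,
          intro integrable_mult_right log_circle_diff r)
         (simp add: log_circle_diff[OF r(1)] G(1))
    also have "(\<Sum>a\<in>S. of_int (zorder f a) * ln (max r (norm a))) =
       (\<Sum>a\<in>S. of_int (zorder f a) * l a) + (\<Sum>a\<in>S. of_int (zorder f a) * (ln (max r (norm a)) - l a))"
      by (simp add: algebra_simps sum.distrib sum_subtractf)
    \<comment> \<open>For |a| > r the bracket is 0, and for |a| <= r it is the weight of
      \<open>a\<close>, including a = 0 because \<open>l 0 = 0\<close>.\<close>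
    also have "(\<Sum>a\<in>S. of_int (zorder f a) * (ln (max r (norm a)) - l a)) =
       (\<Sum>a\<in>S \<inter> cball 0 r. of_int (zorder f a) * lweight r a)"
      using S r by (intro sum.mono_neutral_cong_right)
        (auto simp: l_def lweight_def max_def ln_div)
    also have "\<dots> = (\<Sum>a\<in>S \<inter> cball 0 r. real (pmult (\<lambda>z. 1 / f z) a) * lweight r a) -
                    (\<Sum>a\<in>S \<inter> cball 0 r. real (pmult f a) * lweight r a)"
      by (simp add: zorder_eq_pmult[OF f] algebra_simps sum_subtractf)
    also have "(\<Sum>a\<in>S \<inter> cball 0 r. real (pmult (\<lambda>z. 1 / f z) a) * lweight r a) = int_pole_count r (\<lambda>z. 1 / f z)"
      by (rule int_pole_count_eq_superset[symmetric, OF fm(2) r(1)])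
         (use S r zorder_0_imp_pmult_0(2)[OF f] in \<open>auto simp: S_def\<close>)
    also have "(\<Sum>a\<in>S \<inter> cball 0 r. real (pmult f a) * lweight r a) = int_pole_count r f"
      by (rule int_pole_count_eq_superset[symmetric, OF fm(1) r(1)])
         (use S r zorder_0_imp_pmult_0(1)[OF f] in \<open>auto simp: S_def\<close>)
    finally show "integrable circ (\<lambda>t. ln (norm (f (of_real r * cis t)))) \<and>
      (\<integral>t. ln (norm (f (of_real r * cis t))) \<partial>circ) =
      (\<Sum>a\<in>S. of_int (zorder f a) * l a) + Re (g 0) + int_pole_count r (\<lambda>z. 1 / f z) - int_pole_count r f"
      using I1 by simp
  qed
qed

text \<open>The constant of Jensen's formula, read off at radius 1 so that it does not refer to any
  disc. For a function that does not vanish identically it is the logarithm of the modulus of its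
  leading Laurent coefficient at 0.\<close>

definition Jensen_const :: "(complex \<Rightarrow> complex) \<Rightarrow> real" where
  "Jensen_const f = (\<integral>t. ln (norm (f (of_real 1 * cis t))) \<partial>circ) -
     int_pole_count 1 (\<lambda>z. 1 / f z) + int_pole_count 1 f"

lemma Jensen:
  assumes f: "nonzero_mero f" and r: "r > 0"
  shows "integrable circ (\<lambda>t. ln (norm (f (of_real r * cis t))))"
    and "(\<integral>t. ln (norm (f (of_real r * cis t))) \<partial>circ) =
      Jensen_const f + int_pole_count r (\<lambda>z. 1 / f z) - int_pole_count r f"
proof -
  \<comment> \<open>This disc contains both the circle of radius \<open>r\<close> and the unit
    circle, so one constant serves both.\<close>
  have "max r 1 + 1 > 0" by simp
  from Jensen_disc[OF f this] obtain c where c: "\<forall>s. 0 < s \<longrightarrow> s < max r 1 + 1 \<longrightarrow>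
    integrable circ (\<lambda>t. ln (norm (f (of_real s * cis t)))) \<and>
    (\<integral>t. ln (norm (f (of_real s * cis t))) \<partial>circ) =
      c + int_pole_count s (\<lambda>z. 1 / f z) - int_pole_count s f"
    by blast
  have "Jensen_const f = c" using c[rule_format, of 1] by (simp add: Jensen_const_def)
  thus "integrable circ (\<lambda>t. ln (norm (f (of_real r * cis t))))"
    and "(\<integral>t. ln (norm (f (of_real r * cis t))) \<partial>circ) =
      Jensen_const f + int_pole_count r (\<lambda>z. 1 / f z) - int_pole_count r f"
    using c[rule_format, of r] r by auto
qed

section \<open>Positive logarithm, proximity function and characteristic\<close>

lemma log_plus_eq: "x \<ge> 0 \<Longrightarrow> log_plus x = max 0 (ln x)"
  by (cases "x = 0") (auto simp: log_plus_def max_def not_le ln_le_zero_iff dest: ln_gt_zero)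

lemma log_plus_nonneg [simp]: "log_plus x \<ge> 0"
  by (simp add: log_plus_def)

lemma log_plus_mono: "x \<le> y \<Longrightarrow> log_plus x \<le> log_plus y"
  by (simp add: log_plus_def)

lemma log_plus_mult: "log_plus (x * y) \<le> log_plus x + log_plus y" if "x \<ge> 0" "y \<ge> 0"
proof -
  have "max 1 (x * y) \<le> max 1 x * max 1 y"
    using that mult_mono[of x "max 1 x" y "max 1 y"] mult_mono[of 1 "max 1 x" 1 "max 1 y"] by simp
  hence "ln (max 1 (x * y)) \<le> ln (max 1 x * max 1 y)" by (subst ln_le_cancel_iff) auto
  thus ?thesis by (simp add: log_plus_def ln_mult_pos)
qed

lemma log_plus_power: "x \<ge> 0 \<Longrightarrow> log_plus (x ^ n) = real n * log_plus x"
proof (cases "x = 0")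
  case False
  assume "x \<ge> 0"
  with False have x: "x > 0" by simp
  thus ?thesis by (simp add: log_plus_eq ln_realpow max_mult_distrib_left)
qed (auto simp: log_plus_def power_0_left)

lemma log_plus_add: "log_plus (x + y) \<le> log_plus x + log_plus y + ln 2" if "x \<ge> 0" "y \<ge> 0"
proof -
  have "1 \<le> max 1 x * max 1 y" "x \<le> max 1 x * max 1 y" "y \<le> max 1 x * max 1 y"
    using mult_mono[of 1 "max 1 x" 1 "max 1 y"] mult_mono[of x "max 1 x" 1 "max 1 y"]
      mult_mono[of 1 "max 1 x" y "max 1 y"] that by auto
  hence "max 1 (x + y) \<le> 2 * (max 1 x * max 1 y)" by linarith
  hence "ln (max 1 (x + y)) \<le> ln (2 * (max 1 x * max 1 y))" by (subst ln_le_cancel_iff) auto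
  thus ?thesis by (simp add: log_plus_def ln_mult_pos)
qed

lemma borel_measurable_log_plus [measurable]: "log_plus \<in> borel_measurable borel"
  unfolding log_plus_def by measurable

lemma proximity_eq:
  assumes f: "f meromorphic_on UNIV" and r: "r > 0"
  shows "integrable circ (\<lambda>t. log_plus (norm (f (of_real r * cis t))))"
    and "proximity r f = (\<integral>t. log_plus (norm (f (of_real r * cis t))) \<partial>circ)"
proof -
  have m: "(\<lambda>t. log_plus (norm (f (of_real r * cis t)))) \<in> borel_measurable borel"
    using measurable_compose[OF mero_circ_measurable[OF f, of r 0], of "\<lambda>w. log_plus (norm w)"] by simp
  show *: "integrable circ (\<lambda>t. log_plus (norm (f (of_real r * cis t))))"
    using f
  proof (cases rule: mero_zero_cases)
    case 1
    have "integrable circ (\<lambda>t. max 0 (ln (norm (f (of_real r * cis t)))))"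
      using Jensen(1)[OF 1 r] by auto
    thus ?thesis by (simp add: log_plus_eq)
  next
    case 2
    have "AE t in circ. log_plus (norm (f (of_real r * cis t))) = 0"
      using AE_circ_cosparse[OF 2, of r 0] r by (auto simp: log_plus_def)
    from circ_integrable_cong_AE(1)[OF _ m this] show ?thesis by simp
  qed
  show "proximity r f = (\<integral>t. log_plus (norm (f (of_real r * cis t))) \<partial>circ)"
    unfolding proximity_def circ_integral_eq_integral[OF *] by simp
qed

lemma proximity_nonneg: "f meromorphic_on UNIV \<Longrightarrow> r > 0 \<Longrightarrow> proximity r f \<ge> 0"
  by (simp add: proximity_eq)

lemma proximity_le_characteristic: "f meromorphic_on UNIV \<Longrightarrow> r \<ge> 1 \<Longrightarrow> proximity r f \<le> characteristic r f"
  using int_pole_count_nonneg[of f r] by (simp add: characteristic_def)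

lemma int_pole_count_le_characteristic: "f meromorphic_on UNIV \<Longrightarrow> r \<ge> 1 \<Longrightarrow> int_pole_count r f \<le> characteristic r f"
  using proximity_nonneg[of f r] by (simp add: characteristic_def)

lemma characteristic_nonneg: "f meromorphic_on UNIV \<Longrightarrow> r \<ge> 1 \<Longrightarrow> characteristic r f \<ge> 0"
  using proximity_nonneg[of f r] proximity_le_characteristic[of f r] by auto

lemma mean_log_eq_proximity:
  assumes f: "nonzero_mero f" and r: "r > 0"
  shows "(\<integral>t. ln (norm (f (of_real r * cis t))) \<partial>circ) = proximity r f - proximity r (\<lambda>z. 1 / f z)"
    and "(\<integral>t. \<bar>ln (norm (f (of_real r * cis t)))\<bar> \<partial>circ) = proximity r f + proximity r (\<lambda>z. 1 / f z)"
proof -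
  note fm = nonzero_mero_D(1)[OF f] nonzero_mero_D(1)[OF nonzero_mero_inverse[OF f]]
  note P = proximity_eq[OF fm(1) r] proximity_eq[OF fm(2) r]
  have p: "log_plus (norm (1 / w)) = max 0 (- ln (norm w))" for w :: complex
    by (cases "w = 0") (auto simp: log_plus_eq norm_divide ln_div)
  have 1: "ln (norm w) = log_plus (norm w) - log_plus (norm (1 / w))" for w :: complex
    unfolding p by (simp add: log_plus_eq)
  have 2: "\<bar>ln (norm w)\<bar> = log_plus (norm w) + log_plus (norm (1 / w))" for w :: complex
    unfolding p by (simp add: log_plus_eq)
  show "(\<integral>t. ln (norm (f (of_real r * cis t))) \<partial>circ) = proximity r f - proximity r (\<lambda>z. 1 / f z)"
    unfolding P(2,4) by (subst Bochner_Integration.integral_diff[OF P(1,3), symmetric]) (simp only: 1[symmetric])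
  show "(\<integral>t. \<bar>ln (norm (f (of_real r * cis t)))\<bar> \<partial>circ) = proximity r f + proximity r (\<lambda>z. 1 / f z)"
    unfolding P(2,4) by (subst Bochner_Integration.integral_add[OF P(1,3), symmetric]) (simp only: 2[symmetric])
qed

text \<open>Writing ln |f| as the difference of the positive logarithms of |f| and |1/f| turns
  Jensen's formula into this exact identity; the usual O(1) is
  \<open>Jensen_const f\<close>.\<close>

lemma first_main_theorem:
  assumes f: "nonzero_mero f" and r: "r > 0"
  shows "characteristic r (\<lambda>z. 1 / f z) = characteristic r f - Jensen_const f"
  using mean_log_eq_proximity(1)[OF f r] Jensen(2)[OF f r] by (simp add: characteristic_def)

lemma mean_abs_log_le:
  assumes f: "nonzero_mero f" and r: "r \<ge> 1"
  shows "(\<integral>t. \<bar>ln (norm (f (of_real r * cis t)))\<bar> \<partial>circ) \<le> 2 * characteristic r f - Jensen_const f"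
proof -
  have "proximity r f \<le> characteristic r f" "proximity r (\<lambda>z. 1 / f z) \<le> characteristic r (\<lambda>z. 1 / f z)"
    using f r nonzero_mero_inverse nonzero_mero_D(1) by (auto intro!: proximity_le_characteristic)
  thus ?thesis using mean_log_eq_proximity(2)[OF f, of r] first_main_theorem[OF f, of r] r by simp
qed

lemma proximity_mono_bound:
  assumes f: "f meromorphic_on UNIV" and g: "g meromorphic_on UNIV" and h: "h meromorphic_on UNIV" and r: "r > 0"
    and le: "\<And>z. log_plus (norm (f z)) \<le> log_plus (norm (g z)) + log_plus (norm (h z)) + c"
  shows "proximity r f \<le> proximity r g + proximity r h + c"
proof -
  note P = proximity_eq[OF f r] proximity_eq[OF g r] proximity_eq[OF h r]
  have "proximity r f \<le> (\<integral>t. log_plus (norm (g (of_real r * cis t))) + log_plus (norm (h (of_real r * cis t))) + c \<partial>circ)"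
    unfolding P(2) using P(1,3,5) le by (intro integral_mono) auto
  also have "\<dots> = proximity r g + proximity r h + c" using P by simp
  finally show ?thesis .
qed

lemma characteristic_add:
  assumes f: "f meromorphic_on UNIV" and g: "g meromorphic_on UNIV" and r: "r \<ge> 1"
  shows "characteristic r (\<lambda>z. f z + g z) \<le> characteristic r f + characteristic r g + ln 2"
proof -
  have fg: "(\<lambda>z. f z + g z) meromorphic_on UNIV" by (intro meromorphic_intros f g)
  have "proximity r (\<lambda>z. f z + g z) \<le> proximity r f + proximity r g + ln 2"
  proof (rule proximity_mono_bound[OF fg f g])
    show "log_plus (norm (f z + g z)) \<le> log_plus (norm (f z)) + log_plus (norm (g z)) + ln 2" for z
      using log_plus_mono[OF norm_triangle_ineq[of "f z" "g z"]] log_plus_add[of "norm (f z)" "norm (g z)"] by simp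
  qed (use r in auto)
  moreover have "int_pole_count r (\<lambda>z. f z + g z) \<le> int_pole_count r f + int_pole_count r g"
    using int_pole_count_le_sum[of "\<lambda>z. f z + g z" "{True, False}" "\<lambda>b. if b then f else g" r "\<lambda>_. 1"]
      fg f g r pmult_add[OF f g] by (auto split: if_splits)
  ultimately show ?thesis by (simp add: characteristic_def)
qed

lemma characteristic_mult:
  assumes f: "f meromorphic_on UNIV" and g: "g meromorphic_on UNIV" and r: "r \<ge> 1"
  shows "characteristic r (\<lambda>z. f z * g z) \<le> characteristic r f + characteristic r g"
proof -
  have fg: "(\<lambda>z. f z * g z) meromorphic_on UNIV" by (intro meromorphic_intros f g)
  have "proximity r (\<lambda>z. f z * g z) \<le> proximity r f + proximity r g + 0"
    by (rule proximity_mono_bound[OF fg f g]) (use r in \<open>auto simp: norm_mult intro!: log_plus_mult\<close>)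
  moreover have "int_pole_count r (\<lambda>z. f z * g z) \<le> int_pole_count r f + int_pole_count r g"
    using int_pole_count_le_sum[of "\<lambda>z. f z * g z" "{True, False}" "\<lambda>b. if b then f else g" r "\<lambda>_. 1"]
      fg f g r pmult_mult[OF f g] by (auto split: if_splits)
  ultimately show ?thesis by (simp add: characteristic_def)
qed

lemma int_pole_count_const [simp]: "r > 0 \<Longrightarrow> int_pole_count r (\<lambda>_. c) = 0"
  by (subst int_pole_count_eq) auto

lemma characteristic_const: "r > 0 \<Longrightarrow> characteristic r (\<lambda>_. c) = log_plus (norm c)"
  by (simp add: characteristic_def proximity_eq(2)[OF meromorphic_on_const])

lemma characteristic_power:
  assumes f: "nonzero_mero f" and r: "r \<ge> 1"
  shows "characteristic r (\<lambda>z. f z ^ n) = n * characteristic r f"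
proof -
  note fm = nonzero_mero_D(1)[OF f] nonzero_mero_D(1)[OF nonzero_mero_power[OF f, of n]]
  have "proximity r (\<lambda>z. f z ^ n) = n * proximity r f"
    using proximity_eq[OF fm(1), of r] proximity_eq[OF fm(2), of r] r
    by (simp add: norm_power log_plus_power)
  moreover have "int_pole_count r (\<lambda>z. f z ^ n) = n * int_pole_count r f"
  proof -
    define A where "A = {z \<in> cball 0 r. pmult f z \<noteq> 0}"
    have A: "finite A" unfolding A_def by (rule finite_pmult_cball[OF fm(1)])
    have p: "pmult (\<lambda>z. f z ^ n) z = n * pmult f z" for z
      by (simp add: pmult_eq_nat_zorder[OF f] pmult_eq_nat_zorder[OF nonzero_mero_power[OF f]]
          zorder_power[OF nonzero_mero_D(2)[OF f] nonzero_mero_D(4)[OF f]] nat_mult_distrib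
          flip: mult_minus_right)
    have "int_pole_count r (\<lambda>z. f z ^ n) = (\<Sum>z\<in>A. real (pmult (\<lambda>z. f z ^ n) z) * lweight r z)"
      by (rule int_pole_count_eq_superset[OF fm(2)]) (use r A in \<open>auto simp: A_def p\<close>)
    also have "\<dots> = n * (\<Sum>z\<in>A. real (pmult f z) * lweight r z)"
      by (simp add: p sum_distrib_left mult_ac)
    also have "(\<Sum>z\<in>A. real (pmult f z) * lweight r z) = int_pole_count r f"
      by (rule int_pole_count_eq_superset[OF fm(1), symmetric]) (use r A in \<open>auto simp: A_def\<close>)
    finally show ?thesis .
  qed
  ultimately show ?thesis by (simp add: characteristic_def algebra_simps)
qed

lemma characteristic_cong:
  assumes f: "f meromorphic_on UNIV" and g: "g meromorphic_on UNIV" and eq: "\<forall>\<^sub>\<approx>z. f z = g z" and r: "r \<ge> 1"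
  shows "characteristic r f = characteristic r g"
proof -
  have "int_pole_count r f = int_pole_count r g"
    by (rule int_pole_count_cong[OF f g r]) (rule pmult_cong[OF eq])
  moreover have "proximity r f = proximity r g"
  proof -
    have r0: "r > 0" using r by simp
    have "AE t in circ. log_plus (norm (f (of_real r * cis t))) = log_plus (norm (g (of_real r * cis t)))"
      using AE_circ_cosparse[OF eq, of r 0] r by auto
    thus ?thesis unfolding proximity_eq(2)[OF f r0] proximity_eq(2)[OF g r0]
      by (intro integral_cong_AE)
         (use borel_measurable_integrable[OF proximity_eq(1)[OF f r0]]
              borel_measurable_integrable[OF proximity_eq(1)[OF g r0]] in auto)
  qed
  ultimately show ?thesis by (simp add: characteristic_def)
qed

section \<open>Cartan's identity and monotonicity of the characteristic\<close>

interpretation circ2: pair_sigma_finite circ circ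
  by (intro pair_sigma_finite.intro circ.sigma_finite_measure_axioms)

lemma pmult_add_const:
  assumes f: "f meromorphic_on UNIV"
  shows "pmult (\<lambda>z. f z + c) z = pmult f z"
proof (rule antisym)
  show "pmult (\<lambda>z. f z + c) z \<le> pmult f z"
    using pmult_add[OF f meromorphic_on_const, of c z] by simp
  have "(\<lambda>z. f z + c) meromorphic_on UNIV" by (intro meromorphic_intros f)
  from pmult_add[OF this meromorphic_on_const, of "-c" z]
  show "pmult f z \<le> pmult (\<lambda>z. f z + c) z" by simp
qed

text \<open>Cartan's identity: averaging Jensen's formula for \<open>f - cis \<phi>\<close> over \<open>\<phi>\<close> writes the
  characteristic as an average of the monotone functions \<open>N(r, 1 / (f - cis \<phi>))\<close>.\<close>

lemma Cartan_identity:
  assumes f: "f meromorphic_on UNIV" and r: "r > 0"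
  defines "J \<equiv> \<lambda>\<phi>. \<integral>t. ln (norm (f (of_real r * cis t) - cis \<phi>)) \<partial>circ"
  shows "integrable circ J" and "proximity r f = integral\<^sup>L circ J"
proof -
  define K where "K = (\<lambda>t \<phi>. ln (norm (f (of_real r * cis t) - cis \<phi>)))"
  have fm: "(\<lambda>t. f (of_real r * cis t)) \<in> borel_measurable borel"
    using mero_circ_measurable[OF f, of r 0] by simp
  have Km: "case_prod K \<in> borel_measurable (circ \<Otimes>\<^sub>M circ)"
    unfolding K_def using fm by measurable
  have k: "integrable circ (\<lambda>\<phi>. ln (norm (w - cis \<phi>)))"
     "(\<integral>\<phi>. ln (norm (w - cis \<phi>)) \<partial>circ) = log_plus (norm w)"
     "(\<integral>\<phi>. \<bar>ln (norm (w - cis \<phi>))\<bar> \<partial>circ) \<le> 1 + log_plus (norm w) + pi\<^sup>2" for w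
  proof -
    have e: "norm (w - cis \<phi>) = norm (of_real 1 * cis \<phi> - w)" for \<phi> by (simp add: norm_minus_commute)
    note L = log_circle_diff(1,2)[of 1 w] log_circle_diff(3,4)[of 1 w "log_plus (norm w)"]
    show I: "integrable circ (\<lambda>\<phi>. ln (norm (w - cis \<phi>)))" unfolding e using L(1) by simp
    show "(\<integral>\<phi>. ln (norm (w - cis \<phi>)) \<partial>circ) = log_plus (norm w)" unfolding e using L(2) by (simp add: log_plus_def)
    \<comment> \<open>The second moment about log+ |w|, combined with |y| <= 1 + y^2, bounds the
      inner integral by an affine function of log+ |w|. With w = f(r e^(it)) that bound is
      integrable in \<open>t\<close>, as Fubini's theorem requires.\<close>
    have "(\<integral>\<phi>. \<bar>ln (norm (w - cis \<phi>))\<bar> \<partial>circ) \<le>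
      (\<integral>\<phi>. (1 + log_plus (norm w)) + (ln (norm (w - cis \<phi>)) - log_plus (norm w))\<^sup>2 \<partial>circ)"
    proof (rule integral_mono)
      show "integrable circ (\<lambda>\<phi>. (1 + log_plus (norm w)) + (ln (norm (w - cis \<phi>)) - log_plus (norm w))\<^sup>2)"
        unfolding e using L(3) by simp
      fix \<phi>
      define y where "y = ln (norm (w - cis \<phi>)) - log_plus (norm w)"
      have "\<bar>y\<bar> \<le> 1 + y\<^sup>2" by (rule abs_le_1_plus_square)
      thus "\<bar>ln (norm (w - cis \<phi>))\<bar> \<le> (1 + log_plus (norm w)) + (ln (norm (w - cis \<phi>)) - log_plus (norm w))\<^sup>2"
        unfolding y_def using log_plus_nonneg[of "norm w"] by linarith
    qed (use I in auto)
    also have "\<dots> = 1 + log_plus (norm w) + (\<integral>\<phi>. (ln (norm (w - cis \<phi>)) - log_plus (norm w))\<^sup>2 \<partial>circ)"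
      unfolding e using L(3) by simp
    finally show "(\<integral>\<phi>. \<bar>ln (norm (w - cis \<phi>))\<bar> \<partial>circ) \<le> 1 + log_plus (norm w) + pi\<^sup>2"
      using L(4) unfolding e by (simp add: log_plus_def)
  qed
  have IK: "integrable (circ \<Otimes>\<^sub>M circ) (case_prod K)"
  proof (rule circ2.Fubini_integrable[OF Km])
    show "AE t in circ. integrable circ (\<lambda>\<phi>. case (t, \<phi>) of (x, xa) \<Rightarrow> K x xa)"
      using k(1) by (simp add: K_def)
    have m: "(\<lambda>t. \<integral>\<phi>. norm (case (t, \<phi>) of (x, xa) \<Rightarrow> K x xa) \<partial>circ) \<in> borel_measurable circ"
      by (rule circ.borel_measurable_lebesgue_integral) (use Km in \<open>auto simp: case_prod_beta'\<close>)
    show "integrable circ (\<lambda>t. \<integral>\<phi>. norm (case (t, \<phi>) of (x, xa) \<Rightarrow> K x xa) \<partial>circ)"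
    proof (rule Bochner_Integration.integrable_bound[OF _ m])
      show "integrable circ (\<lambda>t. 1 + log_plus (norm (f (of_real r * cis t))) + pi\<^sup>2)"
        using proximity_eq(1)[OF f r] by simp
      show "AE t in circ. norm (\<integral>\<phi>. norm (case (t, \<phi>) of (x, xa) \<Rightarrow> K x xa) \<partial>circ)
         \<le> norm (1 + log_plus (norm (f (of_real r * cis t))) + pi\<^sup>2)"
        using k(3) by (intro AE_I2) (simp add: K_def abs_of_nonneg add_nonneg_nonneg)
    qed
  qed
  have "(\<integral>\<phi>. (\<integral>t. K t \<phi> \<partial>circ) \<partial>circ) = (\<integral>t. (\<integral>\<phi>. K t \<phi> \<partial>circ) \<partial>circ)"
    by (rule circ2.Fubini_integral[OF IK])
  thus "proximity r f = integral\<^sup>L circ J"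
    unfolding proximity_eq(2)[OF f r] J_def K_def k(2) by simp
  show "integrable circ J" using circ2.integrable_snd[OF IK] by (simp add: J_def K_def)
qed

text \<open>The proximity function alone need not increase. For fixed \<phi>, Jensen's formula shows
  that \<open>J r \<phi>\<close> plus N(r, f) is a constant plus N(r, 1 / (f - cis \<phi>)), which
  increases with \<open>r\<close>; averaging over \<phi> preserves this.\<close>

lemma characteristic_mono:
  assumes f: "f meromorphic_on UNIV" and r: "0 < r" "r \<le> R"
  shows "characteristic r f \<le> characteristic R f"
proof -
  have R: "R > 0" using r by simp
  define J where "J = (\<lambda>r \<phi>. \<integral>t. ln (norm (f (of_real r * cis t) - cis \<phi>)) \<partial>circ)"
  have ae: "AE \<phi> in circ. nonzero_mero (\<lambda>z. f z - cis \<phi>)"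
  proof -
    \<comment> \<open>If \<open>f\<close> is a unimodular constant, Jensen's formula fails for the
      angles \<phi> representing it; these are only countably many.\<close>
    have sub: "countable {\<phi>. \<forall>\<^sub>\<approx>z. f z = cis \<phi>}"
    proof (cases "\<exists>\<phi>0. \<forall>\<^sub>\<approx>z. f z = cis \<phi>0")
      case True
      then obtain \<phi>0 where 0: "\<forall>\<^sub>\<approx>z. f z = cis \<phi>0" ..
      have "{\<phi>. \<forall>\<^sub>\<approx>z. f z = cis \<phi>} \<subseteq> {\<phi>. of_real 1 * cis \<phi> + 0 \<in> {cis \<phi>0}}"
      proof
        fix \<phi> assume "\<phi> \<in> {\<phi>. \<forall>\<^sub>\<approx>z. f z = cis \<phi>}"
        hence "\<forall>\<^sub>\<approx>z. f z = cis \<phi>" by simp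
        with 0 have "\<forall>\<^sub>\<approx>z::complex. cis \<phi> = cis \<phi>0" by eventually_elim simp
        thus "\<phi> \<in> {\<phi>. of_real 1 * cis \<phi> + 0 \<in> {cis \<phi>0}}" by simp
      qed
      thus ?thesis by (rule countable_subset) (intro countable_vimage_circle, auto)
    next
      case False
      hence "{\<phi>. \<forall>\<^sub>\<approx>z. f z = cis \<phi>} = {}" by blast
      thus ?thesis by (metis countable_empty)
    qed
    show ?thesis using AE_circ_countable[OF sub]
      by eventually_elim (auto intro!: nonzero_meroI meromorphic_intros f)
  qed
  have J: "AE \<phi> in circ. J s \<phi> = Jensen_const (\<lambda>z. f z - cis \<phi>) +
      int_pole_count s (\<lambda>z. 1 / (f z - cis \<phi>)) - int_pole_count s f" if s: "s > 0" for s
    using ae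
  proof eventually_elim
    case (elim \<phi>)
    have "int_pole_count s (\<lambda>z. f z - cis \<phi>) = int_pole_count s f"
    proof -
      have m: "(\<lambda>z. f z - cis \<phi>) meromorphic_on UNIV" by (intro meromorphic_intros f)
      have e: "pmult (\<lambda>z. f z - cis \<phi>) z = pmult f z" for z
        using pmult_add_const[OF f, of "- cis \<phi>" z] by simp
      define A where "A = {z \<in> cball 0 s. pmult f z \<noteq> 0}"
      have A: "finite A" unfolding A_def by (rule finite_pmult_cball[OF f])
      have "int_pole_count s (\<lambda>z. f z - cis \<phi>) = (\<Sum>z\<in>A. real (pmult (\<lambda>z. f z - cis \<phi>) z) * lweight s z)"
        by (rule int_pole_count_eq_superset[OF m s A]) (auto simp: A_def e)
      also have "\<dots> = int_pole_count s f" unfolding e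
        by (rule int_pole_count_eq_superset[OF f s A, symmetric]) (auto simp: A_def)
      finally show ?thesis .
    qed
    thus ?case using Jensen(2)[OF elim s] by (simp add: J_def)
  qed
  have le: "AE \<phi> in circ. J r \<phi> + int_pole_count r f \<le> J R \<phi> + int_pole_count R f"
    using J[OF r(1)] J[OF R] ae
  proof eventually_elim
    case (elim \<phi>)
    thus ?case using int_pole_count_mono[OF nonzero_mero_D(1)[OF nonzero_mero_inverse[OF elim(3)]] r] by simp
  qed
  have I: "integrable circ (J s)" "proximity s f = integral\<^sup>L circ (J s)" if "s > 0" for s
    using Cartan_identity[OF f that] unfolding J_def by auto
  have "(\<integral>\<phi>. J r \<phi> + int_pole_count r f \<partial>circ) \<le> (\<integral>\<phi>. J R \<phi> + int_pole_count R f \<partial>circ)"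
    by (rule integral_mono_AE[OF _ _ le]) (use I(1)[OF r(1)] I(1)[OF R] in auto)
  thus ?thesis using I[OF r(1)] I[OF R] by (simp add: characteristic_def)
qed

subsection \<open>Logarithms of meromorphic functions on circles\<close>

text \<open>At radius 2r every point of modulus at most \<open>r\<close> has weight at least ln 2 >
  1/2, so the integrated count controls the plain one.\<close>

lemma sum_pmult_le:
  assumes f: "f meromorphic_on UNIV" and r: "r \<ge> 1" and A: "finite A" "A \<subseteq> cball 0 r"
  shows "(\<Sum>z\<in>A. real (pmult f z)) \<le> 2 * int_pole_count (2 * r) f"
proof -
  define B where "B = A \<union> {z \<in> cball 0 (2 * r). pmult f z \<noteq> 0}"
  have B: "finite B" "B \<subseteq> cball 0 (2 * r)" unfolding B_def using A r finite_pmult_cball[OF f, of "2 * r"] by auto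
  have ln2: "1/2 \<le> ln (2::real)" using ln2_ge_two_thirds by linarith
  have "(\<Sum>z\<in>A. real (pmult f z)) * (1/2) = (\<Sum>z\<in>A. real (pmult f z) * (1/2))"
    by (simp only: sum_distrib_right)
  also have "\<dots> \<le> (\<Sum>z\<in>A. real (pmult f z) * lweight (2 * r) z)"
  proof (intro sum_mono mult_left_mono)
    fix z assume "z \<in> A"
    hence z: "norm z \<le> r" using A by auto
    have "ln 2 \<le> lweight (2 * r) z"
      using z r by (auto simp: lweight_def le_divide_eq)
    thus "1/2 \<le> lweight (2 * r) z" using ln2 by linarith
  qed auto
  also have "\<dots> \<le> (\<Sum>z\<in>B. real (pmult f z) * lweight (2 * r) z)"
    by (rule sum_mono2[OF B(1)])
       (use B r in \<open>auto simp: B_def intro!: mult_nonneg_nonneg lweight_nonneg\<close>)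
  also have "\<dots> = int_pole_count (2 * r) f"
    by (rule int_pole_count_eq_superset[symmetric, OF f _ B]) (use r in \<open>auto simp: B_def\<close>)
  finally show ?thesis by simp
qed

text \<open>For each \<open>a\<close> the number max(\<rho>, |a - \<eta>|) lies between r and 10 r.
  Hence the logarithms centred at ln (10 r) have mean offset at most ln 10 <= 3, which is the source
  of 9 = 3^2, and of 10 after |y| <= 1 + y^2. The bounds depend on the total multiplicity
  \<open>n\<close> and on nothing else about \<open>S\<close>.\<close>

lemma sum_log_circle_bounds:
  fixes m :: "complex \<Rightarrow> real"
  assumes r: "r \<ge> 1" and S: "finite S" "S \<subseteq> cball 0 (5 * r)" and \<eta>: "norm \<eta> \<le> r"
    and \<rho>: "r \<le> \<rho>" "\<rho> \<le> 4 * r"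
  defines "E \<equiv> \<lambda>t. \<Sum>a\<in>S. m a * (ln (norm (of_real \<rho> * cis t + \<eta> - a)) - ln (10 * r))"
    and "n \<equiv> \<Sum>a\<in>S. \<bar>m a\<bar>"
  shows "integrable circ E" "integrable circ (\<lambda>t. (E t)\<^sup>2)"
    "(\<integral>t. \<bar>E t\<bar> \<partial>circ) \<le> n * (10 + pi\<^sup>2)" "(\<integral>t. (E t)\<^sup>2 \<partial>circ) \<le> n\<^sup>2 * (9 + pi\<^sup>2)"
proof -
  define y where "y = (\<lambda>a t. ln (norm (of_real \<rho> * cis t - (a - \<eta>))) - ln (10 * r))"
  have \<rho>0: "\<rho> > 0" using r \<rho> by linarith
  have E: "E = (\<lambda>t. \<Sum>a\<in>S. m a * y a t)" by (simp add: E_def y_def algebra_simps)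
  have Iy: "integrable circ (y a)" for a unfolding y_def using log_circle_diff(1)[OF \<rho>0] by simp
  have Iy2: "integrable circ (\<lambda>t. (y a t)\<^sup>2)" for a
    unfolding y_def by (rule log_circle_diff(3)[OF \<rho>0])
  have y2: "(\<integral>t. (y a t)\<^sup>2 \<partial>circ) \<le> 9 + pi\<^sup>2" if a: "a \<in> S" for a
  proof -
    define x where "x = max \<rho> (norm (a - \<eta>))"
    have "norm (a - \<eta>) \<le> norm a + norm \<eta>" by (rule norm_triangle_ineq4)
    hence x: "r \<le> x" "x \<le> 10 * r" using S(2) a \<eta> \<rho> r by (auto simp: x_def)
    have x0: "x > 0" using x r by linarith
    have "ln x \<le> ln (10 * r)" using x x0 by simp
    moreover have "ln (10 * r) - ln x = ln (10 * r / x)" using x0 r by (simp add: ln_div)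
    moreover have "\<dots> \<le> ln 10"
      using x x0 r by (subst ln_le_cancel_iff) (auto simp: divide_le_eq)
    moreover have "ln (10::real) \<le> 3"
    proof -
      have "(10::real) \<le> (1 + 3/2 + (3/2)\<^sup>2/2)^2" by (simp add: power2_eq_square field_simps)
      also have "\<dots> \<le> (exp (3/2))^2" using exp_lower_Taylor_quadratic[of "3/2::real"] by (intro power_mono) auto
      also have "\<dots> = exp 3" by (simp flip: exp_double)
      finally have "ln (10::real) \<le> ln (exp 3)" by (subst ln_le_cancel_iff) auto
      thus ?thesis by simp
    qed
    ultimately have "\<bar>ln x - ln (10 * r)\<bar> \<le> 3" by linarith
    hence "(ln x - ln (10 * r))\<^sup>2 \<le> 3\<^sup>2" using abs_le_square_iff[of "ln x - ln (10 * r)" 3] by simp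
    thus ?thesis using log_circle_diff(4)[OF \<rho>0, of "a - \<eta>" "ln (10 * r)"]
      unfolding y_def x_def by simp
  qed
  show IE: "integrable circ E" unfolding E using Iy by auto
  have n0: "n \<ge> 0" unfolding n_def by (intro sum_nonneg) auto
  have abs1: "(\<integral>t. \<bar>y a t\<bar> \<partial>circ) \<le> 10 + pi\<^sup>2" if a: "a \<in> S" for a
  proof -
    have "(\<integral>t. \<bar>y a t\<bar> \<partial>circ) \<le> (\<integral>t. 1 + (y a t)\<^sup>2 \<partial>circ)"
      using Iy Iy2 by (intro integral_mono abs_le_1_plus_square) auto
    also have "\<dots> \<le> 1 + (9 + pi\<^sup>2)" using Iy2 y2[OF a] by simp
    finally show ?thesis by simp
  qed
  have "(\<integral>t. \<bar>E t\<bar> \<partial>circ) \<le> (\<integral>t. (\<Sum>a\<in>S. \<bar>m a\<bar> * \<bar>y a t\<bar>) \<partial>circ)"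
  proof (rule integral_mono)
    show "\<bar>E t\<bar> \<le> (\<Sum>a\<in>S. \<bar>m a\<bar> * \<bar>y a t\<bar>)" for t
      unfolding E abs_mult[symmetric] by (rule sum_abs)
  qed (use IE Iy in auto)
  also have "\<dots> = (\<Sum>a\<in>S. \<bar>m a\<bar> * (\<integral>t. \<bar>y a t\<bar> \<partial>circ))" using Iy by simp
  also have "\<dots> \<le> (\<Sum>a\<in>S. \<bar>m a\<bar> * (10 + pi\<^sup>2))" by (intro sum_mono mult_left_mono abs1) auto
  finally show "(\<integral>t. \<bar>E t\<bar> \<partial>circ) \<le> n * (10 + pi\<^sup>2)" by (simp add: n_def sum_distrib_right)
  \<comment> \<open>Cauchy-Schwarz with the weight |m a| split into two square roots, so that
    \<open>n\<close> appears instead of the number of points.\<close>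
  have sq: "(E t)\<^sup>2 \<le> n * (\<Sum>a\<in>S. \<bar>m a\<bar> * (y a t)\<^sup>2)" for t
  proof -
    have "\<bar>E t\<bar> \<le> (\<Sum>a\<in>S. sqrt \<bar>m a\<bar> * (sqrt \<bar>m a\<bar> * \<bar>y a t\<bar>))"
    proof -
      have "\<bar>E t\<bar> \<le> (\<Sum>a\<in>S. \<bar>m a\<bar> * \<bar>y a t\<bar>)" unfolding E abs_mult[symmetric] by (rule sum_abs)
      also have "\<dots> = (\<Sum>a\<in>S. sqrt \<bar>m a\<bar> * (sqrt \<bar>m a\<bar> * \<bar>y a t\<bar>))"
        by (simp add: mult.assoc[symmetric])
      finally show ?thesis .
    qed
    hence "\<bar>E t\<bar>\<^sup>2 \<le> (\<Sum>a\<in>S. sqrt \<bar>m a\<bar> * (sqrt \<bar>m a\<bar> * \<bar>y a t\<bar>))\<^sup>2" by (intro power_mono) auto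
    also have "\<dots> \<le> (\<Sum>a\<in>S. (sqrt \<bar>m a\<bar>)\<^sup>2) * (\<Sum>a\<in>S. (sqrt \<bar>m a\<bar> * \<bar>y a t\<bar>)\<^sup>2)"
      by (rule Cauchy_Schwarz_ineq_sum)
    also have "\<dots> = n * (\<Sum>a\<in>S. \<bar>m a\<bar> * (y a t)\<^sup>2)" by (simp add: n_def power_mult_distrib)
    finally show ?thesis by simp
  qed
  have I2: "integrable circ (\<lambda>t. n * (\<Sum>a\<in>S. \<bar>m a\<bar> * (y a t)\<^sup>2))" using Iy2 by auto
  show IE2: "integrable circ (\<lambda>t. (E t)\<^sup>2)"
  proof (rule Bochner_Integration.integrable_bound[OF I2])
    show "(\<lambda>t. (E t)\<^sup>2) \<in> borel_measurable circ" using borel_measurable_integrable[OF IE] by measurable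
    show "AE t in circ. norm ((E t)\<^sup>2) \<le> norm (n * (\<Sum>a\<in>S. \<bar>m a\<bar> * (y a t)\<^sup>2))"
      using order_trans[OF sq abs_ge_self] by (intro AE_I2) simp
  qed
  have "(\<integral>t. (E t)\<^sup>2 \<partial>circ) \<le> (\<integral>t. n * (\<Sum>a\<in>S. \<bar>m a\<bar> * (y a t)\<^sup>2) \<partial>circ)"
    by (rule integral_mono[OF IE2 I2]) (rule sq)
  also have "\<dots> = n * (\<Sum>a\<in>S. \<bar>m a\<bar> * (\<integral>t. (y a t)\<^sup>2 \<partial>circ))" using Iy2 by simp
  also have "\<dots> \<le> n * (\<Sum>a\<in>S. \<bar>m a\<bar> * (9 + pi\<^sup>2))"
    using y2 n0 by (intro mult_left_mono sum_mono) auto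
  finally show "(\<integral>t. (E t)\<^sup>2 \<partial>circ) \<le> n\<^sup>2 * (9 + pi\<^sup>2)"
    by (simp add: n_def power2_eq_square sum_distrib_right mult.assoc)
qed

text \<open>By the first main theorem this is \<open>T(r, f) + T(r, 1/f)\<close>.\<close>

definition two_sided :: "real \<Rightarrow> (complex \<Rightarrow> complex) \<Rightarrow> real" where
  "two_sided r f = 2 * characteristic r f - Jensen_const f"

lemma two_sided_bounds:
  assumes f: "nonzero_mero f" and r: "r \<ge> 1"
  shows "int_pole_count r f + int_pole_count r (\<lambda>z. 1 / f z) \<le> two_sided r f"
    and "0 \<le> two_sided r f"
    and "r \<le> R \<Longrightarrow> two_sided r f \<le> two_sided R f"
proof -
  note fm = nonzero_mero_D(1)[OF f] nonzero_mero_D(1)[OF nonzero_mero_inverse[OF f]]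
  show "int_pole_count r f + int_pole_count r (\<lambda>z. 1 / f z) \<le> two_sided r f"
    using int_pole_count_le_characteristic[OF fm(1) r] int_pole_count_le_characteristic[OF fm(2) r]
      first_main_theorem[OF f, of r] r by (simp add: two_sided_def)
  thus "0 \<le> two_sided r f" using int_pole_count_nonneg[OF fm(1) r] int_pole_count_nonneg[OF fm(2) r] by linarith
  show "r \<le> R \<Longrightarrow> two_sided r f \<le> two_sided R f"
    using characteristic_mono[OF fm(1), of r R] r by (simp add: two_sided_def)
qed

text \<open>The radii are nested: zeros and poles are divided out in the disc of radius 5r and
  counted through N at radius 10r; the harmonic remainder is bounded in mean on radius 4r, and the
  Poisson bound makes this pointwise on radius 2r. That last disc contains the circle of radius r
  together with its translates by at most r.\<close>

lemma local_log_representation: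
  assumes f: "nonzero_mero f" and r: "r \<ge> 1"
  obtains S m g where "finite S" "S \<subseteq> cball 0 (5 * r)"
    "(\<Sum>a\<in>S. \<bar>m a\<bar>) \<le> 2 * (int_pole_count (10 * r) f + int_pole_count (10 * r) (\<lambda>z. 1 / f z))"
    "g holomorphic_on cball 0 (2 * r)"
    "\<And>z. norm z \<le> 2 * r \<Longrightarrow> \<bar>Re (g z)\<bar> \<le> 3 * (21 + 2 * pi\<^sup>2) * two_sided (10 * r) f"
    "\<forall>\<^sub>\<approx>z. norm z \<le> 2 * r \<longrightarrow> f z \<noteq> 0 \<and>
       ln (norm (f z)) = (\<Sum>a\<in>S. m a * (ln (norm (z - a)) - ln (10 * r))) + Re (g z)"
proof -
  define S where "S = {z \<in> cball 0 (5 * r). zorder f z \<noteq> 0}"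
  have r5: "5 * r > 0" using r by simp
  obtain g where S: "finite S" and g: "g holomorphic_on ball 0 (5 * r)" and ev:
    "\<forall>\<^sub>\<approx>z. z \<in> ball 0 (5 * r) \<longrightarrow> f z \<noteq> 0 \<and>
       ln (norm (f z)) = (\<Sum>a\<in>S. of_int (zorder f a) * ln (norm (z - a))) + Re (g z)"
    using local_factorization[OF f r5] unfolding S_def by blast
  note fm = nonzero_mero_D(1)[OF f] nonzero_mero_D(1)[OF nonzero_mero_inverse[OF f]]
  define m where "m = (\<lambda>a. real_of_int (zorder f a))"
  define n where "n = (\<Sum>a\<in>S. \<bar>m a\<bar>)"
  define M where "M = int_pole_count (10 * r) f + int_pole_count (10 * r) (\<lambda>z. 1 / f z)"
  define Q where "Q = two_sided (10 * r) f"
  \<comment> \<open>The normalization ln (10 r) subtracted from each logarithm is moved into the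
    harmonic part.\<close>
  define g' where "g' = (\<lambda>z. g z + of_real (\<Sum>a\<in>S. m a * ln (10 * r)))"
  have Ssub: "S \<subseteq> cball 0 (5 * r)" by (auto simp: S_def)
  have MQ: "M \<le> Q" unfolding M_def Q_def by (rule two_sided_bounds(1)[OF f]) (use r in simp)
  have nM: "n \<le> 2 * M"
  proof -
    have "n \<le> (\<Sum>a\<in>S. real (pmult f a) + real (pmult (\<lambda>z. 1 / f z) a))"
      unfolding n_def m_def by (intro sum_mono) (simp add: zorder_eq_pmult[OF f] abs_le_iff)
    also have "\<dots> \<le> 2 * int_pole_count (2 * (5 * r)) f + 2 * int_pole_count (2 * (5 * r)) (\<lambda>z. 1 / f z)"
      unfolding sum.distrib by (intro add_mono sum_pmult_le fm S Ssub) (use r in auto)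
    finally show ?thesis by (simp add: M_def)
  qed
  have ev': "\<forall>\<^sub>\<approx>z. z \<in> ball 0 (5 * r) \<longrightarrow> f z \<noteq> 0 \<and>
       ln (norm (f z)) = (\<Sum>a\<in>S. m a * (ln (norm (z - a)) - ln (10 * r))) + Re (g' z)"
    using ev by eventually_elim (auto simp: m_def g'_def algebra_simps sum_subtractf)
  have g': "g' holomorphic_on ball 0 (5 * r)" unfolding g'_def by (intro holomorphic_intros g)
  define E where "E = (\<lambda>t. \<Sum>a\<in>S. m a * (ln (norm (of_real (4 * r) * cis t + 0 - a)) - ln (10 * r)))"
  have E: "integrable circ E" "(\<integral>t. \<bar>E t\<bar> \<partial>circ) \<le> n * (10 + pi\<^sup>2)"
    using sum_log_circle_bounds[OF r S Ssub, of 0 "4 * r" m] r unfolding E_def n_def by auto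
  have g4: "g' holomorphic_on cball 0 (4 * r)" by (rule holomorphic_on_subset[OF g']) (use r in auto)
  have r4: "4 * r > 0" "4 * r \<ge> 1" using r by auto
  note G = circ_mean_value_Re[OF g4 r4(1)]
  note F = Jensen(1)[OF f r4(1)]
  have ae: "AE t in circ. \<bar>Re (g' (of_real (4 * r) * cis t))\<bar> \<le>
     \<bar>ln (norm (f (of_real (4 * r) * cis t)))\<bar> + \<bar>E t\<bar>"
  proof -
    have "AE t in circ. of_real (4 * r) * cis t + 0 \<in> ball 0 (5 * r) \<longrightarrow> f (of_real (4 * r) * cis t + 0) \<noteq> 0 \<and>
       ln (norm (f (of_real (4 * r) * cis t + 0))) =
        (\<Sum>a\<in>S. m a * (ln (norm (of_real (4 * r) * cis t + 0 - a)) - ln (10 * r))) + Re (g' (of_real (4 * r) * cis t + 0))"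
      by (rule AE_circ_cosparse[OF ev']) (use r in auto)
    thus ?thesis
    proof eventually_elim
      case (elim t)
      have "of_real (4 * r) * cis t + 0 \<in> ball 0 (5 * r)" using r by (simp add: norm_mult)
      hence "ln (norm (f (of_real (4 * r) * cis t + 0))) = E t + Re (g' (of_real (4 * r) * cis t + 0))"
        using elim unfolding E_def by blast
      thus ?case by simp
    qed
  qed
  have "(\<integral>t. \<bar>Re (g' (of_real (4 * r) * cis t))\<bar> \<partial>circ) \<le>
     (\<integral>t. \<bar>ln (norm (f (of_real (4 * r) * cis t)))\<bar> + \<bar>E t\<bar> \<partial>circ)"
    by (rule integral_mono_AE[OF _ _ ae]) (use G F E in auto)
  also have "\<dots> = (\<integral>t. \<bar>ln (norm (f (of_real (4 * r) * cis t)))\<bar> \<partial>circ) + (\<integral>t. \<bar>E t\<bar> \<partial>circ)"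
    using F E by auto
  \<comment> \<open>The first \<open>Q\<close> bounds the mean of |ln |f||; the second term comes
    from the divided factors, whose total multiplicity is at most 2Q. Together they give the factor
    \<open>21 + 2 * pi\<^sup>2\<close>.\<close>
  also have "\<dots> \<le> Q + (2 * Q) * (10 + pi\<^sup>2)"
  proof (intro add_mono)
    have "(\<integral>t. \<bar>ln (norm (f (of_real (4 * r) * cis t)))\<bar> \<partial>circ) \<le> two_sided (4 * r) f"
      unfolding two_sided_def by (rule mean_abs_log_le[OF f r4(2)])
    also have "\<dots> \<le> Q" unfolding Q_def by (rule two_sided_bounds(3)[OF f r4(2)]) (use r in auto)
    finally show "(\<integral>t. \<bar>ln (norm (f (of_real (4 * r) * cis t)))\<bar> \<partial>circ) \<le> Q" .
    have "n * (10 + pi\<^sup>2) \<le> (2 * Q) * (10 + pi\<^sup>2)"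
      using nM MQ by (intro mult_right_mono) auto
    thus "(\<integral>t. \<bar>E t\<bar> \<partial>circ) \<le> (2 * Q) * (10 + pi\<^sup>2)" using E(2) by linarith
  qed
  finally have mean: "(\<integral>t. \<bar>Re (g' (of_real (4 * r) * cis t))\<bar> \<partial>circ) \<le> (21 + 2 * pi\<^sup>2) * Q"
    by (simp add: algebra_simps)
  show ?thesis
  proof (rule that[of S m g'])
    show "finite S" "S \<subseteq> cball 0 (5 * r)" by fact+
    show "(\<Sum>a\<in>S. \<bar>m a\<bar>) \<le> 2 * (int_pole_count (10 * r) f + int_pole_count (10 * r) (\<lambda>z. 1 / f z))"
      using nM unfolding n_def M_def .
    show "g' holomorphic_on cball 0 (2 * r)" by (rule holomorphic_on_subset[OF g']) (use r in auto)
    show "\<bar>Re (g' z)\<bar> \<le> 3 * (21 + 2 * pi\<^sup>2) * two_sided (10 * r) f" if "norm z \<le> 2 * r" for z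
    proof -
      have "\<bar>Re (g' z)\<bar> \<le> 3 * (\<integral>t. \<bar>Re (g' (of_real (4 * r) * cis t))\<bar> \<partial>circ)"
        by (rule circ_Poisson_bound[OF g4]) (use that r in auto)
      also have "\<dots> \<le> 3 * ((21 + 2 * pi\<^sup>2) * Q)" using mean by (rule mult_left_mono) simp
      finally show ?thesis by (simp only: Q_def mult.assoc)
    qed
    show "\<forall>\<^sub>\<approx>z. norm z \<le> 2 * r \<longrightarrow> f z \<noteq> 0 \<and>
       ln (norm (f z)) = (\<Sum>a\<in>S. m a * (ln (norm (z - a)) - ln (10 * r))) + Re (g' z)"
      using ev' by eventually_elim (use r in auto)
  qed
qed

text \<open>\<open>K\<close> is universal. At radii where the characteristic grows regularly, the
  functions ln |f| divided by it are therefore bounded in mean square, and this uniform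
  integrability is what lets almost everywhere limits pass to means.\<close>

lemma log_square_bound:
  "\<exists>K>0. \<forall>f r \<eta>. nonzero_mero f \<longrightarrow> r \<ge> 1 \<longrightarrow> norm \<eta> \<le> r \<longrightarrow>
     integrable circ (\<lambda>t. ln (norm (f (of_real r * cis t + \<eta>)))) \<and>
     integrable circ (\<lambda>t. (ln (norm (f (of_real r * cis t + \<eta>))))\<^sup>2) \<and>
     (\<integral>t. (ln (norm (f (of_real r * cis t + \<eta>))))\<^sup>2 \<partial>circ) \<le> K * (two_sided (10 * r) f)\<^sup>2 \<and>
     (\<integral>t. \<bar>ln (norm (f (of_real r * cis t + \<eta>)))\<bar> \<partial>circ) \<le> K * two_sided (10 * r) f"
proof -
  define K1 where "K1 = 3 * (21 + 2 * pi\<^sup>2)"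
  \<comment> \<open>The second moment needs the first two summands, the first moment needs
    \<open>2 * (10 + pi\<^sup>2) + K1\<close>; this \<open>K\<close> dominates both.\<close>
  define K where "K = 8 * (10 + pi\<^sup>2) + 2 * K1\<^sup>2 + K1"
  have K1: "K1 > 0" by (simp add: K1_def add_pos_nonneg)
  have K0: "K > 0" unfolding K_def using K1 by (simp add: add_pos_pos add_pos_nonneg)
  show ?thesis
  proof (intro exI[of _ K] conjI K0 allI impI)
    fix f r \<eta> assume f: "nonzero_mero f" and r: "r \<ge> (1::real)" and \<eta>: "norm (\<eta>::complex) \<le> r"
    define Q where "Q = two_sided (10 * r) f"
    define x where "x = (\<lambda>t. ln (norm (f (of_real r * cis t + \<eta>))))"
    obtain S m g where S: "finite S" "S \<subseteq> cball 0 (5 * r)"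
      and n: "(\<Sum>a\<in>S. \<bar>m a\<bar>) \<le> 2 * (int_pole_count (10 * r) f + int_pole_count (10 * r) (\<lambda>z. 1 / f z))"
      and g: "g holomorphic_on cball 0 (2 * r)" "\<And>z. norm z \<le> 2 * r \<Longrightarrow> \<bar>Re (g z)\<bar> \<le> K1 * Q"
      and ev: "\<forall>\<^sub>\<approx>z. norm z \<le> 2 * r \<longrightarrow> f z \<noteq> 0 \<and>
       ln (norm (f z)) = (\<Sum>a\<in>S. m a * (ln (norm (z - a)) - ln (10 * r))) + Re (g z)"
      using local_log_representation[OF f r] unfolding K1_def Q_def by blast
    define n where "n = (\<Sum>a\<in>S. \<bar>m a\<bar>)"
    have r10: "10 * r \<ge> 1" using r by simp
    have Q0: "Q \<ge> 0" unfolding Q_def by (rule two_sided_bounds(2)[OF f r10])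
    have "n \<le> 2 * (int_pole_count (10 * r) f + int_pole_count (10 * r) (\<lambda>z. 1 / f z))"
      using n unfolding n_def .
    also have "\<dots> \<le> 2 * Q" unfolding Q_def by (intro mult_left_mono two_sided_bounds(1)[OF f r10]) simp
    finally have nQ: "n \<le> 2 * Q" .
    have n0: "n \<ge> 0" unfolding n_def by (intro sum_nonneg) auto
    define E where "E = (\<lambda>t. \<Sum>a\<in>S. m a * (ln (norm (of_real r * cis t + \<eta> - a)) - ln (10 * r)))"
    have E: "integrable circ E" "integrable circ (\<lambda>t. (E t)\<^sup>2)"
      "(\<integral>t. \<bar>E t\<bar> \<partial>circ) \<le> n * (10 + pi\<^sup>2)" "(\<integral>t. (E t)\<^sup>2 \<partial>circ) \<le> n\<^sup>2 * (9 + pi\<^sup>2)"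
      using sum_log_circle_bounds[OF r S \<eta>, of r m] r unfolding E_def n_def by auto
    have ae: "AE t in circ. \<bar>x t\<bar> \<le> \<bar>E t\<bar> + K1 * Q"
    proof -
      have "AE t in circ. norm (of_real r * cis t + \<eta>) \<le> 2 * r \<longrightarrow> f (of_real r * cis t + \<eta>) \<noteq> 0 \<and>
       ln (norm (f (of_real r * cis t + \<eta>))) = (\<Sum>a\<in>S. m a * (ln (norm (of_real r * cis t + \<eta> - a)) - ln (10 * r))) + Re (g (of_real r * cis t + \<eta>))"
        by (rule AE_circ_cosparse[OF ev]) (use r in auto)
      thus ?thesis
      proof eventually_elim
        case (elim t)
        have le: "norm (of_real r * cis t + \<eta>) \<le> 2 * r"
          using norm_triangle_ineq[of "of_real r * cis t" \<eta>] \<eta> r by (simp add: norm_mult)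
        hence "x t = E t + Re (g (of_real r * cis t + \<eta>))"
          using elim unfolding x_def E_def by blast
        thus ?case using g(2)[OF le] by linarith
      qed
    qed
    have ae2: "AE t in circ. (x t)\<^sup>2 \<le> 2 * (E t)\<^sup>2 + 2 * (K1 * Q)\<^sup>2"
      using ae
    proof eventually_elim
      case (elim t)
      have "(x t)\<^sup>2 \<le> (\<bar>E t\<bar> + K1 * Q)\<^sup>2" using power_mono[OF elim, of 2] by simp
      also have "\<dots> \<le> 2 * (E t)\<^sup>2 + 2 * (K1 * Q)\<^sup>2"
        using zero_le_power2[of "\<bar>E t\<bar> - K1 * Q"] by (simp add: power2_eq_square algebra_simps)
      finally show ?case .
    qed
    have xm: "x \<in> borel_measurable borel"
      unfolding x_def using mero_circ_measurable[OF nonzero_mero_D(1)[OF f], of r \<eta>] by simp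
    have I2: "integrable circ (\<lambda>t. (x t)\<^sup>2)"
      by (rule Bochner_Integration.integrable_bound[where f = "\<lambda>t. 2 * (E t)\<^sup>2 + 2 * (K1 * Q)\<^sup>2"])
         (use E xm ae2 in auto)
    have I: "integrable circ x" by (rule circ_integrable_if_square[OF xm I2])
    have "(\<integral>t. (x t)\<^sup>2 \<partial>circ) \<le> (\<integral>t. 2 * (E t)\<^sup>2 + 2 * (K1 * Q)\<^sup>2 \<partial>circ)"
      by (rule integral_mono_AE[OF I2 _ ae2]) (use E in auto)
    also have "\<dots> = 2 * (\<integral>t. (E t)\<^sup>2 \<partial>circ) + 2 * (K1 * Q)\<^sup>2" using E by simp
    also have "\<dots> \<le> 2 * ((2 * Q)\<^sup>2 * (10 + pi\<^sup>2)) + 2 * (K1 * Q)\<^sup>2"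
    proof -
      have "n\<^sup>2 * (9 + pi\<^sup>2) \<le> (2 * Q)\<^sup>2 * (10 + pi\<^sup>2)"
        using nQ n0 by (intro mult_mono power_mono) auto
      thus ?thesis using E(4) by linarith
    qed
    also have "\<dots> = (8 * (10 + pi\<^sup>2) + 2 * K1\<^sup>2) * Q\<^sup>2" by (simp add: power_mult_distrib algebra_simps)
    also have "\<dots> \<le> K * Q\<^sup>2" unfolding K_def using K1 by (intro mult_right_mono) auto
    finally have s: "(\<integral>t. (x t)\<^sup>2 \<partial>circ) \<le> K * Q\<^sup>2" .
    have "(\<integral>t. \<bar>x t\<bar> \<partial>circ) \<le> (\<integral>t. \<bar>E t\<bar> + K1 * Q \<partial>circ)"
      by (rule integral_mono_AE[OF _ _ ae]) (use E I in auto)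
    also have "\<dots> = (\<integral>t. \<bar>E t\<bar> \<partial>circ) + K1 * Q" using E by simp
    also have "\<dots> \<le> 2 * Q * (10 + pi\<^sup>2) + K1 * Q"
    proof -
      have "n * (10 + pi\<^sup>2) \<le> 2 * Q * (10 + pi\<^sup>2)" using nQ by (intro mult_right_mono) auto
      thus ?thesis using E(3) by linarith
    qed
    also have "\<dots> = (2 * (10 + pi\<^sup>2) + K1) * Q" by (simp add: algebra_simps)
    also have "\<dots> \<le> K * Q" unfolding K_def using K1 Q0 by (intro mult_right_mono) auto
    finally have a: "(\<integral>t. \<bar>x t\<bar> \<partial>circ) \<le> K * Q" .
    show "integrable circ (\<lambda>t. ln (norm (f (of_real r * cis t + \<eta>))))"
      "integrable circ (\<lambda>t. (ln (norm (f (of_real r * cis t + \<eta>))))\<^sup>2)"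
      "(\<integral>t. (ln (norm (f (of_real r * cis t + \<eta>))))\<^sup>2 \<partial>circ) \<le> K * (two_sided (10 * r) f)\<^sup>2"
      "(\<integral>t. \<bar>ln (norm (f (of_real r * cis t + \<eta>)))\<bar> \<partial>circ) \<le> K * two_sided (10 * r) f"
      using I I2 s a unfolding x_def Q_def by auto
  qed
qed

section \<open>Counting functions with finitely many poles and counting functions of shifts\<close>

lemma finite_sum_lweight_bound:
  fixes c :: "complex \<Rightarrow> nat"
  obtains C where "C \<ge> 0" "\<And>r. r \<ge> 1 \<Longrightarrow> (\<Sum>z\<in>B. real (c z) * \<bar>lweight r z\<bar>) \<le> C * (1 + ln r)"
proof
  define C where "C = (\<Sum>z\<in>B. real (c z) * (1 + \<bar>ln (norm z)\<bar>))"
  show "C \<ge> 0" unfolding C_def by (intro sum_nonneg) auto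
  show "(\<Sum>z\<in>B. real (c z) * \<bar>lweight r z\<bar>) \<le> C * (1 + ln r)" if r: "r \<ge> 1" for r
    unfolding C_def sum_distrib_right
  proof (rule sum_mono)
    fix z
    have l: "0 \<le> ln r" using r by simp
    have "\<bar>lweight r z\<bar> \<le> ln r + \<bar>ln (norm z)\<bar>"
    proof (cases "z = 0")
      case False
      hence "lweight r z = ln r - ln (norm z)" using r by (simp add: lweight_def ln_div)
      thus ?thesis using l by linarith
    qed (use l in \<open>simp add: lweight_def\<close>)
    also have "\<dots> \<le> (1 + \<bar>ln (norm z)\<bar>) * (1 + ln r)"
      using l by (simp add: algebra_simps mult_nonneg_nonneg)
    finally show "real (c z) * \<bar>lweight r z\<bar> \<le> real (c z) * (1 + \<bar>ln (norm z)\<bar>) * (1 + ln r)"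
      by (simp add: mult.assoc mult_left_mono)
  qed
qed

lemma int_pole_count_finite_poles:
  assumes f: "f meromorphic_on UNIV" and fin: "finite {z. is_pole f z}"
  obtains C where "C \<ge> 0" "\<And>r. r \<ge> 1 \<Longrightarrow> int_pole_count r f \<le> C * (1 + ln r)"
proof -
  define B where "B = {z. is_pole f z}"
  obtain C where C: "C \<ge> 0" "\<And>r. r \<ge> 1 \<Longrightarrow> (\<Sum>z\<in>B. real (pmult f z) * \<bar>lweight r z\<bar>) \<le> C * (1 + ln r)"
    using finite_sum_lweight_bound[where B = B and c = "pmult f"] by blast
  show ?thesis
  proof (rule that[OF C(1)])
    fix r :: real assume r: "r \<ge> 1"
    have "int_pole_count r f = (\<Sum>z\<in>B \<inter> cball 0 r. real (pmult f z) * lweight r z)"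
      by (rule int_pole_count_eq_superset[OF f])
         (use r fin in \<open>auto simp: B_def pmult_def split: if_splits\<close>)
    also have "\<dots> \<le> (\<Sum>z\<in>B \<inter> cball 0 r. real (pmult f z) * \<bar>lweight r z\<bar>)"
      by (intro sum_mono mult_left_mono) auto
    also have "\<dots> \<le> (\<Sum>z\<in>B. real (pmult f z) * \<bar>lweight r z\<bar>)"
      using fin by (intro sum_mono2) (auto simp: B_def)
    also have "\<dots> \<le> C * (1 + ln r)" by (rule C(2)[OF r])
    finally show "int_pole_count r f \<le> C * (1 + ln r)" .
  qed
qed

text \<open>If |z| > |\<eta>|, then |z + \<eta>| <= 2 |z|, so the weight of \<open>z\<close> at
  radius r is at most the weight of z + \<eta> at radius 2r. The finitely many remaining poles, with
  |z| <= |\<eta>|, are paid for by the logarithmic term.\<close>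

lemma int_pole_count_shift:
  assumes f: "f meromorphic_on UNIV"
  obtains C where "C \<ge> 0" "\<And>r. r \<ge> 1 \<Longrightarrow> r \<ge> norm \<eta> \<Longrightarrow>
    int_pole_count r (\<lambda>z. f (z + \<eta>)) \<le> int_pole_count (2 * r) f + C * (1 + ln r)"
proof -
  define g where "g = (\<lambda>z. f (z + \<eta>))"
  have g: "g meromorphic_on UNIV" unfolding g_def by (rule mero_shift[OF f])
  have pg: "pmult g z = pmult f (z + \<eta>)" for z unfolding g_def by (rule pmult_shift)
  define B where "B = {z \<in> cball 0 (norm \<eta>). pmult g z \<noteq> 0}"
  have B: "finite B" unfolding B_def by (rule finite_pmult_cball[OF g])
  obtain C where C: "C \<ge> 0" "\<And>r. r \<ge> 1 \<Longrightarrow> (\<Sum>z\<in>B. real (pmult g z) * \<bar>lweight r z\<bar>) \<le> C * (1 + ln r)"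
    using finite_sum_lweight_bound[where B = B and c = "pmult g"] by blast
  show ?thesis
  proof (rule that[OF C(1)])
    fix r :: real assume r: "r \<ge> 1" "r \<ge> norm \<eta>"
    define A where "A = {z \<in> cball 0 r. pmult g z \<noteq> 0}"
    have A: "finite A" unfolding A_def by (rule finite_pmult_cball[OF g])
    define D where "D = {z \<in> cball 0 (2 * r). pmult f z \<noteq> 0}"
    have D: "finite D" unfolding D_def by (rule finite_pmult_cball[OF f])
    have BA: "B \<subseteq> A" using r by (auto simp: A_def B_def)
    have "int_pole_count r g = (\<Sum>z\<in>A. real (pmult g z) * lweight r z)"
      by (rule int_pole_count_eq_superset[OF g]) (use r A in \<open>auto simp: A_def\<close>)
    also have "\<dots> = (\<Sum>z\<in>A - B. real (pmult g z) * lweight r z) + (\<Sum>z\<in>B. real (pmult g z) * lweight r z)"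
      by (rule sum.subset_diff[OF BA A])
    finally have eq: "int_pole_count r g = (\<Sum>z\<in>A - B. real (pmult g z) * lweight r z) +
      (\<Sum>z\<in>B. real (pmult g z) * lweight r z)" .
    have "(\<Sum>z\<in>A - B. real (pmult g z) * lweight r z) \<le>
        (\<Sum>z\<in>A - B. real (pmult f (z + \<eta>)) * lweight (2 * r) (z + \<eta>))"
    proof (rule sum_mono)
      fix z assume z: "z \<in> A - B"
      hence zn: "norm z \<le> r" "norm z > norm \<eta>" by (auto simp: A_def B_def)
      have z0: "z \<noteq> 0" "z + \<eta> \<noteq> 0" using zn norm_ge_zero[of \<eta>] by (auto simp: add_eq_0_iff2)
      have "norm (z + \<eta>) \<le> 2 * norm z" using norm_triangle_ineq[of z \<eta>] zn by linarith
      hence "r / norm z \<le> 2 * r / norm (z + \<eta>)" using z0 r by (simp add: field_simps)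
      hence "lweight r z \<le> lweight (2 * r) (z + \<eta>)"
        using z0 r unfolding lweight_def by simp
      thus "real (pmult g z) * lweight r z \<le> real (pmult f (z + \<eta>)) * lweight (2 * r) (z + \<eta>)"
        unfolding pg by (intro mult_left_mono) auto
    qed
    also have "\<dots> = (\<Sum>z\<in>(\<lambda>z. z + \<eta>) ` (A - B). real (pmult f z) * lweight (2 * r) z)"
      by (subst sum.reindex) (auto simp: inj_on_def)
    also have "\<dots> \<le> (\<Sum>z\<in>D. real (pmult f z) * lweight (2 * r) z)"
    proof (rule sum_mono2[OF D])
      show "(\<lambda>z. z + \<eta>) ` (A - B) \<subseteq> D"
      proof
        fix w assume "w \<in> (\<lambda>z. z + \<eta>) ` (A - B)"
        then obtain z where z: "w = z + \<eta>" "norm z \<le> r" "pmult g z \<noteq> 0" by (auto simp: A_def)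
        thus "w \<in> D" using norm_triangle_ineq[of z \<eta>] r by (auto simp: D_def pg)
      qed
    qed (use r in \<open>auto simp: D_def intro!: mult_nonneg_nonneg lweight_nonneg\<close>)
    also have "\<dots> = int_pole_count (2 * r) f"
      by (rule int_pole_count_eq_superset[OF f, symmetric]) (use r D in \<open>auto simp: D_def\<close>)
    finally have le: "(\<Sum>z\<in>A - B. real (pmult g z) * lweight r z) \<le> int_pole_count (2 * r) f" .
    show "int_pole_count r (\<lambda>z. f (z + \<eta>)) \<le> int_pole_count (2 * r) f + C * (1 + ln r)"
    proof -
      have "(\<Sum>z\<in>B. real (pmult g z) * lweight r z) \<le> (\<Sum>z\<in>B. real (pmult g z) * \<bar>lweight r z\<bar>)"
        by (intro sum_mono mult_left_mono) auto
      also have "\<dots> \<le> C * (1 + ln r)" by (rule C(2)[OF r(1)])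
      finally have "int_pole_count r g \<le> int_pole_count (2 * r) f + C * (1 + ln r)"
        unfolding eq using le by (rule add_mono[rotated])
      thus ?thesis by (simp only: g_def)
    qed
  qed
qed

text \<open>An interval [r, 2r] has logarithmic measure at least r * 1/(2r) = 1/2, whereas the
  logarithmic measure of the tail of \<open>E\<close> tends to 0; so \<open>E\<close> cannot contain
  such intervals far out.\<close>

lemma finite_log_measure_avoid:
  assumes "finite_log_measure E"
  shows "\<exists>R. \<forall>r\<ge>R. \<exists>r'\<in>{r..2*r}. r' \<notin> E"
proof -
  define h where "h = (\<lambda>r. ennreal (1 / r) * indicator (E \<inter> {1..}) r)"
  have E: "E \<in> sets lebesgue" and fin: "(\<integral>\<^sup>+ r. h r \<partial>lebesgue) < \<infinity>"
    using assms unfolding finite_log_measure_def h_def by auto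
  have hm: "h \<in> borel_measurable lebesgue"
  proof -
    have "(\<lambda>r::real. ennreal (1 / r)) \<in> borel_measurable lebesgue"
      by (rule measurable_completion) measurable
    moreover have "E \<inter> {1..} \<in> sets lebesgue" using E by auto
    ultimately show ?thesis unfolding h_def
      by (intro borel_measurable_times_ennreal borel_measurable_indicator)
  qed
  have "(\<lambda>n. \<integral>\<^sup>+ r. h r * indicator {real n..} r \<partial>lebesgue) \<longlonglongrightarrow> (\<integral>\<^sup>+ (r::real). 0 \<partial>lebesgue)"
  proof (rule nn_integral_dominated_convergence[where w = h])
    show "(\<lambda>r. h r * indicator {real n..} r) \<in> borel_measurable lebesgue" for n
      by (intro borel_measurable_times_ennreal borel_measurable_indicator hm) auto
    show "AE r in lebesgue. (\<lambda>n. h r * indicator {real n..} r) \<longlonglongrightarrow> 0"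
    proof (rule AE_I2)
      fix r :: real
      have "eventually (\<lambda>n. real n > r) sequentially" by real_asymp
      hence "eventually (\<lambda>n. h r * indicator {real n..} r = 0) sequentially"
        by eventually_elim (auto simp: indicator_def)
      thus "(\<lambda>n. h r * indicator {real n..} r) \<longlonglongrightarrow> 0" by (rule tendsto_eventually)
    qed
    show "AE r in lebesgue. h r * indicator {real n..} r \<le> h r" for n
      by (intro AE_I2) (simp add: indicator_def)
  qed (use hm fin in auto)
  hence "(\<lambda>n. \<integral>\<^sup>+ r. h r * indicator {real n..} r \<partial>lebesgue) \<longlonglongrightarrow> 0" by simp
  hence "eventually (\<lambda>n. (\<integral>\<^sup>+ r. h r * indicator {real n..} r \<partial>lebesgue) < ennreal (1/2)) sequentially"
    by (rule order_tendstoD) (subst ennreal_less_zero_iff, simp)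
  then obtain n where n: "n \<ge> 1" "(\<integral>\<^sup>+ r. h r * indicator {real n..} r \<partial>lebesgue) < ennreal (1/2)"
    using eventually_ge_at_top[of 1] by (metis (mono_tags, lifting) eventually_conj eventually_happens trivial_limit_sequentially)
  show ?thesis
  proof (intro exI[of _ "real n"] allI impI, rule ccontr)
    fix r assume r: "r \<ge> real n" and "\<not> (\<exists>r'\<in>{r..2*r}. r' \<notin> E)"
    hence sub: "{r..2*r} \<subseteq> E" by auto
    have r1: "r \<ge> 1" using r n by linarith
    have "ennreal (1/2) = ennreal (1 / (2 * r)) * ennreal (2 * r - r)"
      using r1 by (simp add: ennreal_mult[symmetric])
    also have "\<dots> = (\<integral>\<^sup>+ x. ennreal (1 / (2 * r)) * indicator {r..2*r} x \<partial>lebesgue)"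
      using r1 by (subst nn_integral_cmult_indicator) auto
    also have "\<dots> \<le> (\<integral>\<^sup>+ x. h x * indicator {real n..} x \<partial>lebesgue)"
    proof (rule nn_integral_mono)
      fix x :: real
      show "ennreal (1 / (2 * r)) * indicator {r..2*r} x \<le> h x * indicator {real n..} x"
      proof (cases "x \<in> {r..2*r}")
        case True
        hence "1 / (2 * r) \<le> 1 / x" using r1 by (intro divide_left_mono) auto
        moreover have "x \<in> E \<inter> {1..}" "x \<in> {real n..}" using True sub r r1 by auto
        ultimately show ?thesis using True by (simp add: h_def ennreal_leI)
      qed auto
    qed
    finally show False using n(2) by simp
  qed
qed

text \<open>Monotonicity removes the exceptional set: some radius in [r, 2r] lies outside it, and
  both characteristics increase. The price is the radius 2r on the right, which is harmless where
  the characteristic grows regularly.\<close>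

lemma small_function_characteristic:
  assumes s: "small_function s f" and f: "f meromorphic_on UNIV" and \<epsilon>: "\<epsilon> > 0"
  shows "eventually (\<lambda>r. characteristic r s \<le> \<epsilon> * characteristic (2 * r) f) at_top"
proof -
  have sm: "s meromorphic_on UNIV" using s by (simp add: small_function_def)
  obtain E where E: "finite_log_measure E"
    and o: "(\<lambda>r. characteristic r s) \<in> o[inf at_top (principal (- E))](\<lambda>r. characteristic r f)"
    using s unfolding small_function_def is_S_def by blast
  have "eventually (\<lambda>r. norm (characteristic r s) \<le> \<epsilon> * norm (characteristic r f)) (inf at_top (principal (- E)))"
    by (rule landau_o.smallD[OF o \<epsilon>])
  hence "eventually (\<lambda>r. r \<in> - E \<longrightarrow> norm (characteristic r s) \<le> \<epsilon> * norm (characteristic r f)) at_top"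
    by (simp add: eventually_inf_principal)
  then obtain R1 where R1: "\<And>r. r \<ge> R1 \<Longrightarrow> r \<notin> E \<Longrightarrow> norm (characteristic r s) \<le> \<epsilon> * norm (characteristic r f)"
    unfolding eventually_at_top_linorder by auto
  obtain R2 where R2: "\<And>r. r \<ge> R2 \<Longrightarrow> \<exists>r'\<in>{r..2*r}. r' \<notin> E"
    using finite_log_measure_avoid[OF E] by auto
  show ?thesis
    using eventually_ge_at_top[of "max 1 (max R1 R2)"]
  proof eventually_elim
    case (elim r)
    then obtain r' where r': "r \<le> r'" "r' \<le> 2 * r" "r' \<notin> E" using R2[of r] by auto
    have "characteristic r s \<le> characteristic r' s"
      using elim r' by (intro characteristic_mono[OF sm]) auto
    also have "\<dots> \<le> \<epsilon> * norm (characteristic r' f)" using R1[of r'] r' elim by auto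
    also have "norm (characteristic r' f) = characteristic r' f"
      using characteristic_nonneg[OF f, of r'] elim r' by simp
    also have "\<epsilon> * characteristic r' f \<le> \<epsilon> * characteristic (2 * r) f"
      using \<epsilon> elim r' by (intro mult_left_mono characteristic_mono[OF f]) auto
    finally show ?case .
  qed
qed

section \<open>Growth exponents and radii of regular growth\<close>

lemma growth_exponent_less_imp:
  assumes "growth_exponent g < ereal \<rho>"
  shows "eventually (\<lambda>r. g r \<le> r powr \<rho>) at_top"
proof -
  have "eventually (\<lambda>r. ereal (log_plus (g r) / ln r) < ereal \<rho>) at_top"
    using assms unfolding growth_exponent_def by (rule Limsup_lessD)
  thus ?thesis using eventually_gt_at_top[of 1]
  proof eventually_elim
    case (elim r)
    have "log_plus (g r) < \<rho> * ln r" using elim by (simp add: divide_less_eq)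
    hence "exp (log_plus (g r)) < exp (\<rho> * ln r)" by simp
    hence "max 1 (g r) < r powr \<rho>" using elim by (simp add: log_plus_def powr_def)
    thus ?case by simp
  qed
qed

lemma growth_exponent_nonneg: "growth_exponent g \<ge> 0"
proof -
  have "eventually (\<lambda>r. 0 \<le> ereal (log_plus (g r) / ln r)) at_top"
    using eventually_gt_at_top[of 1] by eventually_elim auto
  thus ?thesis unfolding growth_exponent_def by (intro le_Limsup) auto
qed

text \<open>Nonnegativity of \<rho> makes r^\<rho> at least 1 for r > 1, the range in which
  \<open>log_plus\<close> is a genuine logarithm.\<close>

lemma growth_exponent_greater_imp:
  assumes "ereal \<rho> < growth_exponent g" "\<rho> \<ge> 0"
  shows "frequently (\<lambda>r. g r \<ge> r powr \<rho>) at_top"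
proof (rule ccontr)
  assume "\<not> frequently (\<lambda>r. g r \<ge> r powr \<rho>) at_top"
  hence "eventually (\<lambda>r. g r < r powr \<rho>) at_top" by (simp add: not_frequently not_le)
  hence "eventually (\<lambda>r. ereal (log_plus (g r) / ln r) \<le> ereal \<rho>) at_top"
    using eventually_gt_at_top[of 1]
  proof eventually_elim
    case (elim r)
    have "1 \<le> r powr \<rho>" using elim assms(2) by (simp add: ge_one_powr_ge_zero)
    hence "max 1 (g r) \<le> r powr \<rho>" using elim by simp
    hence "log_plus (g r) \<le> ln (r powr \<rho>)" unfolding log_plus_def using elim by (subst ln_le_cancel_iff) auto
    also have "\<dots> = \<rho> * ln r" using elim by (simp add: ln_powr)
    finally show ?case using elim by (simp add: divide_le_eq)
  qed
  hence "growth_exponent g \<le> ereal \<rho>" unfolding growth_exponent_def by (rule Limsup_bounded)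
  thus False using assms(1) by simp
qed

text \<open>Suppose T(A r) > C T(r) at all far radii with T(r) >= r^\<rho>. As C >= A^\<rho>, the
  lower bound persists from \<open>r\<close> to \<open>A r\<close>, so iteration from one such
  radius gives T(A^j r0) >= C^j T(r0). With C = A^(\<sigma> + 1) this exceeds (A^j r0)^\<sigma> for
  large j, although \<sigma> was chosen above the growth exponent.\<close>

lemma regular_scales:
  fixes T :: "real \<Rightarrow> real"
  assumes A: "A > 1" and \<rho>: "\<rho> \<ge> 0" "ereal \<rho> < growth_exponent T" and fin: "growth_exponent T < \<infinity>"
  obtains C where "\<And>R. \<exists>r\<ge>R. r powr \<rho> \<le> T r \<and> T (A * r) \<le> C * T r"
proof -
  obtain \<sigma> where \<sigma>: "growth_exponent T < ereal \<sigma>"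
    using ereal_dense2[OF fin] by auto
  have \<rho>\<sigma>: "\<rho> < \<sigma>" using less_trans[OF \<rho>(2) \<sigma>] by simp
  have ev: "eventually (\<lambda>r. T r \<le> r powr \<sigma>) at_top" by (rule growth_exponent_less_imp[OF \<sigma>])
  then obtain R1 where R1: "\<And>r. r \<ge> R1 \<Longrightarrow> T r \<le> r powr \<sigma>"
    unfolding eventually_at_top_linorder by auto
  define C where "C = A powr (\<sigma> + 1)"
  have C: "C > 0" "C \<ge> A powr \<rho>" using A \<rho>\<sigma> by (auto simp: C_def)
  have "\<exists>r\<ge>R. r powr \<rho> \<le> T r \<and> T (A * r) \<le> C * T r" for R
  proof (rule ccontr)
    assume "\<not> (\<exists>r\<ge>R. r powr \<rho> \<le> T r \<and> T (A * r) \<le> C * T r)"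
    hence neg: "T (A * r) > C * T r" if "r \<ge> R" "r powr \<rho> \<le> T r" for r using that by force
    have "frequently (\<lambda>r. T r \<ge> r powr \<rho>) at_top" by (rule growth_exponent_greater_imp[OF \<rho>(2,1)])
    hence "\<exists>r\<ge>max 1 (max R R1). T r \<ge> r powr \<rho>"
      unfolding frequently_def eventually_at_top_linorder by (metis (no_types, lifting))
    then obtain r0 where r0: "r0 \<ge> 1" "r0 \<ge> R" "r0 \<ge> R1" "T r0 \<ge> r0 powr \<rho>" by auto
    have ge: "A ^ j * r0 \<ge> r0" for j using A r0(1) by (simp add: mult_le_cancel_right1 one_le_power)
    have ind: "(A ^ j * r0) powr \<rho> \<le> T (A ^ j * r0) \<and> C ^ j * T r0 \<le> T (A ^ j * r0)" for j
    proof (induction j)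
      case (Suc j)
      have n: "C * T (A ^ j * r0) \<le> T (A ^ Suc j * r0)"
        using neg[of "A ^ j * r0"] Suc order_trans[OF r0(2) ge[of j]] by (simp add: mult_ac)
      have T0: "T (A ^ j * r0) \<ge> 0" using Suc powr_ge_zero[of "A ^ j * r0" \<rho>] by linarith
      have "(A ^ Suc j * r0) powr \<rho> = A powr \<rho> * (A ^ j * r0) powr \<rho>"
        using A r0 by (simp add: powr_mult mult.assoc)
      also have "\<dots> \<le> C * T (A ^ j * r0)" using Suc C by (intro mult_mono) auto
      finally have "(A ^ Suc j * r0) powr \<rho> \<le> T (A ^ Suc j * r0)" using n by linarith
      moreover have "C ^ Suc j * T r0 \<le> C * T (A ^ j * r0)" using Suc C by simp
      ultimately show ?case using n by linarith
    qed (use r0 in auto)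
    have "A ^ j \<le> r0 powr \<sigma> / T r0" for j
    proof -
      have T0: "T r0 > 0" using r0 powr_gt_zero[of r0 \<rho>] by linarith
      have "C ^ j * T r0 \<le> (A ^ j * r0) powr \<sigma>"
        using ind[of j] R1[of "A ^ j * r0"] ge[of j] r0 by linarith
      also have "\<dots> = (A powr \<sigma>) ^ j * r0 powr \<sigma>"
        using A r0 by (simp add: powr_mult powr_power powr_realpow[symmetric] powr_powr mult.commute)
      finally have "(A powr \<sigma> * A) ^ j * T r0 \<le> (A powr \<sigma>) ^ j * r0 powr \<sigma>"
        using A by (simp add: C_def powr_add)
      hence "(A powr \<sigma>) ^ j * (A ^ j * T r0) \<le> (A powr \<sigma>) ^ j * r0 powr \<sigma>"
        by (simp add: power_mult_distrib mult_ac)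
      hence "A ^ j * T r0 \<le> r0 powr \<sigma>" using A by (subst (asm) mult_le_cancel_left_pos) auto
      thus ?thesis using T0 by (simp add: field_simps)
    qed
    moreover obtain j where "A ^ j > r0 powr \<sigma> / T r0" using real_arch_pow[OF A] by blast
    ultimately show False by (metis not_le)
  qed
  thus ?thesis by (rule that)
qed

subsection \<open>Scaling limits\<close>

text \<open>For D = |x_k - h| and M >= 1 one has D <= D^2 / M + M min(1, D). The mean of the first
  term is O(1/M) by the mean square bound, uniformly in \<open>k\<close>; the second tends to 0 for
  fixed \<open>M\<close> by dominated convergence.\<close>

lemma L1_limit_of_L2_bounded:
  fixes x :: "nat \<Rightarrow> real \<Rightarrow> real"
  assumes xm: "\<And>k. x k \<in> borel_measurable borel" and hm: "h \<in> borel_measurable borel"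
    and hb: "\<And>t. \<bar>h t\<bar> \<le> b"
    and I2: "\<And>k. integrable circ (\<lambda>t. (x k t)\<^sup>2)" and B: "\<And>k. (\<integral>t. (x k t)\<^sup>2 \<partial>circ) \<le> B"
    and lim: "AE t in circ. (\<lambda>k. x k t) \<longlonglongrightarrow> h t"
  shows "(\<lambda>k. \<integral>t. \<bar>x k t - h t\<bar> \<partial>circ) \<longlonglongrightarrow> 0"
proof -
  define D where "D = (\<lambda>k t. \<bar>x k t - h t\<bar>)"
  define q where "q = (\<lambda>k. \<integral>t. min 1 (D k t) \<partial>circ)"
  define B' where "B' = 2 * B + 2 * b\<^sup>2"
  have I: "integrable circ (x k)" for k by (rule circ_integrable_if_square[OF xm I2])
  have Ih: "integrable circ h" by (rule circ_integrable_bounded[OF hm]) (use hb in auto)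
  have Dm: "D k \<in> borel_measurable borel" for k unfolding D_def using xm hm by measurable
  have ID: "integrable circ (D k)" for k unfolding D_def using I Ih by auto
  have Im: "integrable circ (\<lambda>t. min 1 (D k t))" for k
    by (rule circ_integrable_bounded[where B = 1]) (use Dm in \<open>auto simp: D_def\<close>)
  have q: "q \<longlonglongrightarrow> (\<integral>t. 0 \<partial>circ)"
    unfolding q_def
  proof (rule integral_dominated_convergence[where w = "\<lambda>_. 1"])
    show "AE t in circ. (\<lambda>k. min 1 (D k t)) \<longlonglongrightarrow> 0"
      using lim
    proof eventually_elim
      case (elim t)
      have "(\<lambda>k. min 1 \<bar>x k t - h t\<bar>) \<longlonglongrightarrow> min 1 \<bar>h t - h t\<bar>"
        by (intro tendsto_intros elim)
      thus ?case by (simp add: D_def)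
    qed
  qed (use Dm in \<open>auto simp: D_def\<close>)
  have B'0: "B' \<ge> 0"
  proof -
    have "0 \<le> (\<integral>t. (x 0 t)\<^sup>2 \<partial>circ)" by (rule integral_nonneg_AE) auto
    thus ?thesis using B[of 0] zero_le_power2[of b] unfolding B'_def by linarith
  qed
  have key: "(\<integral>t. D k t \<partial>circ) \<le> B' / M + M * q k" if M: "M \<ge> 1" for k M
  proof -
    have "(\<integral>t. D k t \<partial>circ) \<le> (\<integral>t. (2 * (x k t)\<^sup>2 + 2 * b\<^sup>2) / M + M * min 1 (D k t) \<partial>circ)"
    proof (rule integral_mono[OF ID])
      show "integrable circ (\<lambda>t. (2 * (x k t)\<^sup>2 + 2 * b\<^sup>2) / M + M * min 1 (D k t))"
        using I2 Im by auto
      fix t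
      have "(D k t)\<^sup>2 \<le> 2 * (x k t)\<^sup>2 + 2 * (h t)\<^sup>2"
        using zero_le_power2[of "x k t + h t"] by (simp add: D_def power2_eq_square algebra_simps)
      moreover have "(h t)\<^sup>2 \<le> b\<^sup>2" using power_mono[OF hb[of t], of 2] by simp
      ultimately have d2: "(D k t)\<^sup>2 / M \<le> (2 * (x k t)\<^sup>2 + 2 * b\<^sup>2) / M"
        using M by (intro divide_right_mono) auto
      have "D k t \<le> (D k t)\<^sup>2 / M + M * min 1 (D k t)"
      proof -
        have D0: "D k t \<ge> 0" by (simp add: D_def)
        have s0: "(D k t)\<^sup>2 / M \<ge> 0" using M by simp
        consider "D k t \<le> 1" | "1 < D k t" "D k t \<le> M" | "D k t > M" by linarith
        thus ?thesis
        proof cases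
          case 1
          hence "min 1 (D k t) = D k t" by simp
          moreover have "D k t \<le> M * D k t" using M D0 mult_right_mono[of 1 M "D k t"] by simp
          ultimately show ?thesis using s0 by simp
        next
          case 2
          hence "min 1 (D k t) = 1" by simp
          thus ?thesis using s0 2 by linarith
        next
          case 3
          hence "M * D k t \<le> D k t * D k t" using D0 by (intro mult_right_mono) auto
          hence "D k t \<le> (D k t)\<^sup>2 / M" using M by (simp add: le_divide_eq power2_eq_square mult.commute)
          thus ?thesis using M D0 by (simp add: add_increasing2)
        qed
      qed
      thus "D k t \<le> (2 * (x k t)\<^sup>2 + 2 * b\<^sup>2) / M + M * min 1 (D k t)" using d2 by linarith
    qed
    also have "\<dots> = (2 * (\<integral>t. (x k t)\<^sup>2 \<partial>circ) + 2 * b\<^sup>2) / M + M * q k"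
      using I2 Im by (simp add: q_def)
    also have "\<dots> \<le> B' / M + M * q k"
      using B[of k] M by (intro add_right_mono divide_right_mono) (auto simp: B'_def)
    finally show ?thesis .
  qed
  show ?thesis
  proof (rule LIMSEQ_I)
    fix e :: real assume e: "e > 0"
    define M where "M = max 1 (2 * B' / e + 1)"
    have M: "M \<ge> 1" "M > 2 * B' / e" by (auto simp: M_def)
    have "B' / M < e / 2"
    proof -
      have "2 * B' < M * e" using M(2) e by (simp add: divide_less_eq)
      thus ?thesis using M(1) by (simp add: divide_less_eq algebra_simps)
    qed
    have "eventually (\<lambda>k. q k < e / (2 * M)) sequentially"
      using q by (rule order_tendstoD) (use e M in auto)
    then obtain k0 where k0: "\<And>k. k \<ge> k0 \<Longrightarrow> q k < e / (2 * M)"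
      unfolding eventually_sequentially by blast
    show "\<exists>no. \<forall>n\<ge>no. norm ((\<integral>t. \<bar>x n t - h t\<bar> \<partial>circ) - 0) < e"
    proof (intro exI allI impI)
      fix k assume "k \<ge> k0"
      hence "M * q k < M * (e / (2 * M))" using k0[of k] M by (intro mult_strict_left_mono) auto
      also have "\<dots> = e / 2" using M by simp
      finally have "M * q k < e / 2" .
      hence "(\<integral>t. D k t \<partial>circ) < e" using key[OF M(1), of k] \<open>B' / M < e / 2\<close> by linarith
      moreover have "(\<integral>t. D k t \<partial>circ) \<ge> 0" by (rule integral_nonneg_AE) (auto simp: D_def)
      ultimately show "norm ((\<integral>t. \<bar>x k t - h t\<bar> \<partial>circ) - 0) < e" by (simp add: D_def)
    qed
  qed
qed

text \<open>Applied with \<psi> the identity, for the means in Jensen's formula, and with \<psi> the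
  positive part, for proximity functions.\<close>

lemma L1_limit_imp:
  fixes x :: "nat \<Rightarrow> real \<Rightarrow> real"
  assumes I: "\<And>k. integrable circ (x k)" and Ih: "integrable circ h"
    and lim: "(\<lambda>k. \<integral>t. \<bar>x k t - h t\<bar> \<partial>circ) \<longlonglongrightarrow> 0"
    and \<psi>: "\<And>u v. \<bar>\<psi> u - \<psi> v\<bar> \<le> \<bar>u - v\<bar>" "\<psi> \<in> borel_measurable borel"
  shows "(\<lambda>k. \<integral>t. \<psi> (x k t) \<partial>circ) \<longlonglongrightarrow> (\<integral>t. \<psi> (h t) \<partial>circ)"
proof -
  have I\<psi>: "integrable circ (\<lambda>t. \<psi> (y t))" if "integrable circ y" for y
  proof (rule Bochner_Integration.integrable_bound)
    show "integrable circ (\<lambda>t. \<bar>y t\<bar> + \<bar>\<psi> 0\<bar>)" using that by auto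
    show "(\<lambda>t. \<psi> (y t)) \<in> borel_measurable circ"
      using measurable_compose[OF borel_measurable_integrable[OF that] \<psi>(2)] .
    have "\<bar>\<psi> u\<bar> \<le> \<bar>u\<bar> + \<bar>\<psi> 0\<bar>" for u using \<psi>(1)[of u 0] by linarith
    thus "AE t in circ. norm (\<psi> (y t)) \<le> norm (\<bar>y t\<bar> + \<bar>\<psi> 0\<bar>)"
      by (intro AE_I2) auto
  qed
  have "(\<lambda>k. (\<integral>t. \<psi> (x k t) \<partial>circ) - (\<integral>t. \<psi> (h t) \<partial>circ)) \<longlonglongrightarrow> 0"
  proof (rule Lim_null_comparison[OF _ lim], rule always_eventually, rule allI)
    fix k
    have "(\<integral>t. \<psi> (x k t) \<partial>circ) - (\<integral>t. \<psi> (h t) \<partial>circ) = (\<integral>t. \<psi> (x k t) - \<psi> (h t) \<partial>circ)"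
      by (rule Bochner_Integration.integral_diff[symmetric]) (intro I\<psi> I Ih)+
    also have "\<bar>\<dots>\<bar> \<le> (\<integral>t. \<bar>\<psi> (x k t) - \<psi> (h t)\<bar> \<partial>circ)" by (rule integral_abs_bound)
    also have "\<dots> \<le> (\<integral>t. \<bar>x k t - h t\<bar> \<partial>circ)"
      by (rule integral_mono) (use \<psi>(1) I\<psi> I Ih in auto)
    finally show "norm ((\<integral>t. \<psi> (x k t) \<partial>circ) - (\<integral>t. \<psi> (h t) \<partial>circ)) \<le> (\<integral>t. \<bar>x k t - h t\<bar> \<partial>circ)"
      by simp
  qed
  thus ?thesis by (rule LIM_zero_cancel)
qed

text \<open>On the unit circle \<open>|E z|\<^sup>2\<close> coincides with the holomorphic function \<open>E z * cnj (E (1 / cnj z))\<close>,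
  so its level set is finite or everything.\<close>

lemma unimodular_on_circle_finite:
  assumes E: "E holomorphic_on ball 0 2" and w: "norm w = 1" "norm (E w) \<noteq> 1"
  shows "finite {z. norm z = 1 \<and> norm (E z) = 1}"
proof (rule ccontr)
  define Z where "Z = {z. norm z = 1 \<and> norm (E z) = 1}"
  assume "infinite {z. norm z = 1 \<and> norm (E z) = 1}"
  hence inf: "infinite Z" by (simp add: Z_def)
  have Zs: "Z \<subseteq> sphere 0 1" by (auto simp: Z_def)
  obtain \<xi> where \<xi>: "\<xi> \<in> sphere 0 1" "\<xi> islimpt Z"
    using Heine_Borel_imp_Bolzano_Weierstrass[OF _ inf Zs] by auto
  \<comment> \<open>On this annulus both \<open>z\<close> and \<open>1 / z\<close> lie in the disc
    of radius 2, so the product with the reflected function is holomorphic. It is connected, so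
    vanishing near an accumulation point on the circle spreads to all of it.\<close>
  define A where "A = {z::complex. 1/2 < norm (z - 0) \<and> norm (z - 0) < 2}"
  have A: "open A" "connected A"
  proof -
    have "A = ball 0 2 - cball 0 (1/2)" by (auto simp: A_def)
    thus "open A" by (simp add: open_Diff)
    show "connected A" unfolding A_def by (rule connected_annulus) simp
  qed
  define E' where "E' = cnj \<circ> E \<circ> cnj"
  have E': "E' holomorphic_on ball 0 2" unfolding E'_def
  proof (rule holomorphic_on_compose_cnj_cnj)
    have "cnj ` ball 0 2 \<subseteq> ball 0 2" by auto
    thus "E holomorphic_on cnj ` ball 0 2" by (rule holomorphic_on_subset[OF E])
  qed auto
  define F where "F = (\<lambda>z. E z * E' (1 / z) - 1)"
  have F: "F holomorphic_on A"
  proof -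
    have "(\<lambda>z. 1 / z) ` A \<subseteq> ball 0 2" by (auto simp: A_def norm_divide divide_less_eq)
    moreover have "(\<lambda>z. 1 / z) holomorphic_on A" by (intro holomorphic_intros) (auto simp: A_def)
    ultimately have "(E' \<circ> (\<lambda>z. 1 / z)) holomorphic_on A"
      using holomorphic_on_compose[of "\<lambda>z. 1 / z" A E'] E' holomorphic_on_subset by blast
    hence "(\<lambda>z. E' (1 / z)) holomorphic_on A" by (simp add: o_def)
    moreover have "E holomorphic_on A" by (rule holomorphic_on_subset[OF E]) (auto simp: A_def)
    ultimately show ?thesis unfolding F_def by (intro holomorphic_intros)
  qed
  have Fs: "F z = of_real ((norm (E z))\<^sup>2 - 1)" if "norm z = 1" for z
  proof -
    have "z * cnj z = 1" using that complex_norm_square[of z] by simp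
    hence "1 / z = cnj z" using that by (metis nonzero_mult_div_cancel_left norm_zero zero_neq_one)
    hence "cnj (1 / z) = z" by simp
    hence "F z = E z * cnj (E z) - 1" unfolding F_def E'_def o_def by (simp only:)
    thus ?thesis using complex_norm_square[of "E z"] by simp
  qed
  have "F w = 0"
  proof (rule analytic_continuation[OF F A _ _ \<xi>(2)])
    show "Z \<subseteq> A" "\<xi> \<in> A" "w \<in> A" using Zs \<xi> w by (auto simp: A_def)
    show "F z = 0" if "z \<in> Z" for z using that Fs[of z] by (auto simp: Z_def)
  qed
  hence "(norm (E w))\<^sup>2 = 1" using Fs[OF w(1)] by (metis eq_iff_diff_eq_0 of_real_eq_0_iff)
  moreover have "norm (E w) \<noteq> - 1" using norm_ge_zero[of "E w"] by linarith
  ultimately show False using w(2) by (simp add: power2_eq_1_iff)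
qed

text \<open>On |\<zeta>| <= 2 the function ln |v(r_k \<zeta>)| / T_k is a sum of normalized
  logarithms of the zeros and poles plus the real part of g_k(r_k \<zeta>) / T_k. The first part
  tends to 0 in mean on both circles because N(10 r_k) / T_k does, hence almost everywhere along a
  subsequence. The second is bounded, but only its real part is; therefore Montel's theorem is
  applied to the exponentials \<open>G\<close>, and H is recovered as ln |E|.\<close>

lemma log_limit:
  fixes r T :: "nat \<Rightarrow> real"
  assumes v: "nonzero_mero v"
    and r: "\<And>k. r k \<ge> 1" "\<And>k. norm \<eta> \<le> r k" "filterlim r at_top sequentially"
    and T: "\<And>k. T k = characteristic (r k) v" "\<And>k. T k > 0" "filterlim T at_top sequentially"
    and two: "\<And>k. two_sided (10 * r k) v \<le> C * T k"
    and N: "(\<lambda>k. (int_pole_count (10 * r k) v + int_pole_count (10 * r k) (\<lambda>z. 1 / v z)) / T k) \<longlonglongrightarrow> 0"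
  obtains \<phi> H b where "strict_mono \<phi>" "H \<in> borel_measurable borel" "\<And>t. \<bar>H t\<bar> \<le> b"
    "AE t in circ. (\<lambda>k. ln (norm (v (of_real (r (\<phi> k)) * cis t))) / T (\<phi> k)) \<longlonglongrightarrow> H t"
    "AE t in circ. (\<lambda>k. ln (norm (v (of_real (r (\<phi> k)) * cis t + \<eta>))) / T (\<phi> k)) \<longlonglongrightarrow> H t"
    "AE t in circ. H t \<noteq> 0" "(\<integral>t. max 0 (H t) \<partial>circ) = 1" "(\<integral>t. H t \<partial>circ) = 0"
    "(\<lambda>k. proximity (r (\<phi> k)) (\<lambda>z. v (z + \<eta>)) / T (\<phi> k)) \<longlonglongrightarrow> 1"
proof -
  define Kc where "Kc = 3 * (21 + 2 * pi\<^sup>2)"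
  have Kc: "Kc > 0" by (simp add: Kc_def add_pos_nonneg)
  have C0: "C \<ge> 0"
  proof -
    have "0 \<le> C * T 0" using two[of 0] two_sided_bounds(2)[OF v, of "10 * r 0"] r(1)[of 0] by linarith
    thus ?thesis using T(2)[of 0] by (simp add: zero_le_mult_iff)
  qed
  define M where "M = (\<lambda>k. int_pole_count (10 * r k) v + int_pole_count (10 * r k) (\<lambda>z. 1 / v z))"
  define P where "P = (\<lambda>k S m g. finite S \<and> S \<subseteq> cball 0 (5 * r k) \<and> (\<Sum>a\<in>S. \<bar>m a\<bar>) \<le> 2 * M k \<and>
    g holomorphic_on cball 0 (2 * r k) \<and>
    (\<forall>z. norm z \<le> 2 * r k \<longrightarrow> \<bar>Re (g z)\<bar> \<le> Kc * two_sided (10 * r k) v) \<and>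
    (\<forall>\<^sub>\<approx>z. norm z \<le> 2 * r k \<longrightarrow> v z \<noteq> 0 \<and>
       ln (norm (v z)) = (\<Sum>a\<in>S. m a * (ln (norm (z - a)) - ln (10 * r k))) + Re (g z)))"
  have "\<exists>S m g. P k S m g" for k
  proof (rule local_log_representation[OF v r(1)[of k]])
    fix S m g
    assume "finite S" "S \<subseteq> cball 0 (5 * r k)"
      "(\<Sum>a\<in>S. \<bar>m a\<bar>) \<le> 2 * (int_pole_count (10 * r k) v + int_pole_count (10 * r k) (\<lambda>z. 1 / v z))"
      "g holomorphic_on cball 0 (2 * r k)"
      "\<And>z. norm z \<le> 2 * r k \<Longrightarrow> \<bar>Re (g z)\<bar> \<le> 3 * (21 + 2 * pi\<^sup>2) * two_sided (10 * r k) v"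
      "\<forall>\<^sub>\<approx>z. norm z \<le> 2 * r k \<longrightarrow> v z \<noteq> 0 \<and>
         ln (norm (v z)) = (\<Sum>a\<in>S. m a * (ln (norm (z - a)) - ln (10 * r k))) + Re (g z)"
    hence "P k S m g" unfolding P_def M_def Kc_def by blast
    thus ?thesis by blast
  qed
  then obtain S m g where P: "\<And>k. P k (S k) (m k) (g k)" by metis
  note P' = P[unfolded P_def]
  have S: "\<And>k. finite (S k)" "\<And>k. S k \<subseteq> cball 0 (5 * r k)"
    and n: "\<And>k. (\<Sum>a\<in>S k. \<bar>m k a\<bar>) \<le> 2 * M k"
    and g: "\<And>k. g k holomorphic_on cball 0 (2 * r k)"
    and gb: "\<And>k z. norm z \<le> 2 * r k \<Longrightarrow> \<bar>Re (g k z)\<bar> \<le> Kc * two_sided (10 * r k) v"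
    and ev: "\<And>k. \<forall>\<^sub>\<approx>z. norm z \<le> 2 * r k \<longrightarrow> v z \<noteq> 0 \<and>
       ln (norm (v z)) = (\<Sum>a\<in>S k. m k a * (ln (norm (z - a)) - ln (10 * r k))) + Re (g k z)"
    using P' by blast+
  have r0: "r k > 0" for k using r(1)[of k] by linarith
  define b where "b = Kc * C"
  have b0: "b \<ge> 0" using Kc C0 by (simp add: b_def)
  have gb': "\<bar>Re (g k z) / T k\<bar> \<le> b" if "norm z \<le> 2 * r k" for k z
  proof -
    have "\<bar>Re (g k z)\<bar> \<le> Kc * (C * T k)"
      using gb[OF that] mult_left_mono[OF two[of k], of Kc] Kc by linarith
    thus ?thesis using T(2)[of k] by (simp add: b_def divide_le_eq mult.assoc)
  qed
  define G where "G = (\<lambda>k \<zeta>. exp (g k (of_real (r k) * \<zeta>) / of_real (T k)))"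
  have Gn: "norm (G k \<zeta>) = exp (Re (g k (of_real (r k) * \<zeta>)) / T k)" for k \<zeta>
    by (simp add: G_def)
  have Gb: "exp (- b) \<le> norm (G k \<zeta>)" "norm (G k \<zeta>) \<le> exp b" if "norm \<zeta> \<le> 2" for k \<zeta>
  proof -
    have "norm (of_real (r k) * \<zeta>) \<le> 2 * r k" using that r0[of k] by (simp add: norm_mult)
    from gb'[OF this] have "\<bar>Re (g k (of_real (r k) * \<zeta>)) / T k\<bar> \<le> b" .
    thus "exp (- b) \<le> norm (G k \<zeta>)" "norm (G k \<zeta>) \<le> exp b" unfolding Gn exp_le_cancel_iff by linarith+
  qed
  have Gh: "G k holomorphic_on ball 0 2" for k
  proof -
    have "(\<lambda>\<zeta>. of_real (r k) * \<zeta>) ` ball 0 2 \<subseteq> cball (0::complex) (2 * r k)"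
      using r0[of k] by (auto simp: norm_mult dist_norm)
    hence "(g k \<circ> (\<lambda>\<zeta>. of_real (r k) * \<zeta>)) holomorphic_on ball 0 2"
      by (intro holomorphic_on_compose holomorphic_on_subset[OF g[of k]] holomorphic_intros)
    thus ?thesis unfolding G_def o_def using T(2)[of k] by (intro holomorphic_intros) auto
  qed
  obtain E \<psi> where E: "E holomorphic_on ball 0 2" and \<psi>: "strict_mono \<psi>"
    and ptw: "\<And>z. z \<in> ball 0 2 \<Longrightarrow> (\<lambda>k. G (\<psi> k) z) \<longlonglongrightarrow> E z"
    and unif: "\<And>K. compact K \<Longrightarrow> K \<subseteq> ball 0 2 \<Longrightarrow> uniform_limit K (G \<circ> \<psi>) E sequentially"
  proof (rule Montel[of "ball 0 2" "range G" G])
    show "\<exists>B. \<forall>h\<in>range G. \<forall>z\<in>K. norm (h z) \<le> B" if "compact K" "K \<subseteq> ball 0 2" for K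
      using that Gb(2) by (intro exI[of _ "exp b"]) (fastforce simp: subset_iff)
  qed (use Gh in auto)
  \<comment> \<open>The lower bound survives in the limit, so \<open>E\<close> has no zeros and ln
    |E| is continuous and bounded.\<close>
  have Eb: "exp (- b) \<le> norm (E z)" "norm (E z) \<le> exp b" if z: "z \<in> ball 0 2" for z
  proof -
    have nz: "norm z \<le> 2" using z by simp
    show "exp (- b) \<le> norm (E z)"
      by (rule LIMSEQ_le_const[OF tendsto_norm[OF ptw[OF z]]]) (use Gb(1)[OF nz] in auto)
    show "norm (E z) \<le> exp b"
      by (rule LIMSEQ_le_const2[OF tendsto_norm[OF ptw[OF z]]]) (use Gb(2)[OF nz] in auto)
  qed
  define H where "H = (\<lambda>t. ln (norm (E (cis t))))"
  have cis2: "cis t \<in> ball 0 2" for t by simp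
  have E0: "E (cis t) \<noteq> 0" for t using Eb(1)[OF cis2[of t]] exp_gt_zero[of "-b"] by force
  have Hb: "\<bar>H t\<bar> \<le> b" for t
  proof -
    have p: "norm (E (cis t)) > 0" using E0 by simp
    have "ln (exp (- b)) \<le> ln (norm (E (cis t)))" using Eb(1)[OF cis2] p by (subst ln_le_cancel_iff) auto
    moreover have "ln (norm (E (cis t))) \<le> ln (exp b)" using Eb(2)[OF cis2] p by (subst ln_le_cancel_iff) auto
    ultimately show ?thesis by (simp add: H_def abs_le_iff)
  qed
  have Ec: "continuous_on (ball 0 2) E" by (rule holomorphic_on_imp_continuous_on[OF E])
  have Hm: "H \<in> borel_measurable borel"
  proof (rule borel_measurable_continuous_onI)
    have "continuous_on UNIV (\<lambda>t. E (cis t))"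
      by (rule continuous_on_compose2[OF Ec]) (auto intro!: continuous_intros)
    thus "continuous_on UNIV H" unfolding H_def using E0 by (intro continuous_intros) auto
  qed
  \<comment> \<open>Uniform convergence on the disc of radius 3/2 allows the evaluation point to
    move. This is where the shift becomes invisible.\<close>
  have limG: "(\<lambda>k. ln (norm (G (\<psi> k) (cis t + \<eta>' / of_real (r (\<psi> k)))))) \<longlonglongrightarrow> H t" for t \<eta>'
  proof -
    define \<zeta> where "\<zeta> = (\<lambda>k. cis t + \<eta>' / of_real (r (\<psi> k)))"
    have rinf: "filterlim (\<lambda>k. r (\<psi> k)) at_top sequentially"
      using filterlim_compose[OF r(3) filterlim_subseq[OF \<psi>]] .
    have "(\<lambda>k. complex_of_real (inverse (r (\<psi> k)))) \<longlonglongrightarrow> of_real 0"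
      by (intro tendsto_of_real tendsto_inverse_0_at_top rinf)
    hence "(\<lambda>k. cis t + \<eta>' * complex_of_real (inverse (r (\<psi> k)))) \<longlonglongrightarrow> cis t + \<eta>' * of_real 0"
      by (rule tendsto_add[OF tendsto_const tendsto_mult[OF tendsto_const]])
    hence \<zeta>: "\<zeta> \<longlonglongrightarrow> cis t" by (simp add: \<zeta>_def field_simps)
    define K where "K = cball (0::complex) (3/2)"
    have K: "compact K" "K \<subseteq> ball 0 2" by (auto simp: K_def)
    have evK: "eventually (\<lambda>k. \<zeta> k \<in> K) sequentially"
    proof -
      have "eventually (\<lambda>k. \<zeta> k \<in> ball 0 (3/2)) sequentially"
        by (rule topological_tendstoD[OF \<zeta>]) auto
      thus ?thesis by eventually_elim (auto simp: K_def)
    qed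
    have c1: "(\<lambda>k. G (\<psi> k) (\<zeta> k) - E (\<zeta> k)) \<longlonglongrightarrow> 0"
    proof (rule tendstoI)
      fix e :: real assume "e > 0"
      from uniform_limitD[OF unif[OF K] this] evK
      show "eventually (\<lambda>k. dist (G (\<psi> k) (\<zeta> k) - E (\<zeta> k)) 0 < e) sequentially"
        by eventually_elim (auto simp: dist_norm)
    qed
    have "isCont E (cis t)" using Ec cis2[of t] by (auto simp: continuous_on_eq_continuous_at)
    hence "(\<lambda>k. E (\<zeta> k)) \<longlonglongrightarrow> E (cis t)" by (rule isCont_tendsto_compose[OF _ \<zeta>])
    from tendsto_add[OF c1 this] have "(\<lambda>k. G (\<psi> k) (\<zeta> k)) \<longlonglongrightarrow> E (cis t)" by simp
    hence "(\<lambda>k. ln (norm (G (\<psi> k) (\<zeta> k)))) \<longlonglongrightarrow> ln (norm (E (cis t)))"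
      using E0[of t] by (intro tendsto_ln tendsto_norm) auto
    thus ?thesis unfolding H_def \<zeta>_def .
  qed
  define e where "e = (\<lambda>\<eta>' k t. (\<Sum>a\<in>S k. m k a * (ln (norm (of_real (r k) * cis t + \<eta>' - a)) - ln (10 * r k))))"
  have e: "integrable circ (e \<eta>' k)" "(\<integral>t. \<bar>e \<eta>' k t\<bar> \<partial>circ) \<le> 2 * M k * (10 + pi\<^sup>2)" if "norm \<eta>' \<le> r k" for \<eta>' k
  proof -
    note * = sum_log_circle_bounds[OF r(1) S that, of "r k" "m k"]
    show "integrable circ (e \<eta>' k)" unfolding e_def using *(1) r0[of k] by simp
    have "(\<integral>t. \<bar>e \<eta>' k t\<bar> \<partial>circ) \<le> (\<Sum>a\<in>S k. \<bar>m k a\<bar>) * (10 + pi\<^sup>2)" unfolding e_def using *(3) r0[of k] by simp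
    also have "\<dots> \<le> 2 * M k * (10 + pi\<^sup>2)" by (intro mult_right_mono n) auto
    finally show "(\<integral>t. \<bar>e \<eta>' k t\<bar> \<partial>circ) \<le> 2 * M k * (10 + pi\<^sup>2)" .
  qed
  have z0: "norm (0::complex) \<le> r k" for k using r0[of k] by simp
  \<comment> \<open>One majorant for the errors on both the circle and its translate, so that a
    single subsequence serves both.\<close>
  define d where "d = (\<lambda>k t. (\<bar>e 0 k t\<bar> + \<bar>e \<eta> k t\<bar>) / T k)"
  have dI: "integrable circ (d k)" for k unfolding d_def using e(1)[OF z0] e(1)[OF r(2)] by auto
  have dle: "(\<integral>t. norm (d k t) \<partial>circ) \<le> 4 * (10 + pi\<^sup>2) * (M k / T k)" for k
  proof -
    have "(\<integral>t. norm (d k t) \<partial>circ) = ((\<integral>t. \<bar>e 0 k t\<bar> \<partial>circ) + (\<integral>t. \<bar>e \<eta> k t\<bar> \<partial>circ)) / T k"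
      using e(1)[OF z0] e(1)[OF r(2)] T(2)[of k] by (simp add: d_def)
    also have "\<dots> \<le> (2 * M k * (10 + pi\<^sup>2) + 2 * M k * (10 + pi\<^sup>2)) / T k"
      using T(2)[of k] by (intro divide_right_mono add_mono e(2) z0 r(2)) auto
    finally show ?thesis by (simp add: algebra_simps add_divide_distrib)
  qed
  have "(\<lambda>k. \<integral>t. norm (d k t) \<partial>circ) \<longlonglongrightarrow> 0"
  proof (rule Lim_null_comparison)
    show "(\<lambda>k. 4 * (10 + pi\<^sup>2) * (M k / T k)) \<longlonglongrightarrow> 0"
    proof (rule tendsto_mult_right_zero)
      show "(\<lambda>k. M k / T k) \<longlonglongrightarrow> 0" using N by (simp add: M_def)
    qed
    show "eventually (\<lambda>k. norm (\<integral>t. norm (d k t) \<partial>circ) \<le> 4 * (10 + pi\<^sup>2) * (M k / T k)) sequentially"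
      using dle by (intro always_eventually allI) (simp add: abs_of_nonneg)
  qed
  hence "(\<lambda>k. \<integral>t. norm (d (\<psi> k) t) \<partial>circ) \<longlonglongrightarrow> 0"
    using LIMSEQ_subseq_LIMSEQ[OF _ \<psi>] by (simp add: o_def)
  then obtain \<psi>' where \<psi>': "strict_mono \<psi>'" and aed: "AE t in circ. (\<lambda>k. d (\<psi> (\<psi>' k)) t) \<longlonglongrightarrow> 0"
    using tendsto_L1_AE_subseq[of circ "\<lambda>k. d (\<psi> k)"] dI by auto
  define \<phi> where "\<phi> = (\<lambda>k. \<psi> (\<psi>' k))"
  have \<phi>: "strict_mono \<phi>" using strict_mono_o[OF \<psi> \<psi>'] by (simp add: \<phi>_def o_def)
  define x where "x = (\<lambda>\<eta>' k t. ln (norm (v (of_real (r k) * cis t + \<eta>'))) / T k)"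
  have xlim: "AE t in circ. (\<lambda>k. x \<eta>' (\<phi> k) t) \<longlonglongrightarrow> H t"
    if \<eta>': "\<And>k. norm \<eta>' \<le> r k" and ed: "\<And>k t. \<bar>e \<eta>' k t\<bar> / T k \<le> d k t" for \<eta>'
  proof -
    have "AE t in circ. norm (of_real (r k) * cis t + \<eta>') \<le> 2 * r k \<longrightarrow> v (of_real (r k) * cis t + \<eta>') \<noteq> 0 \<and>
       ln (norm (v (of_real (r k) * cis t + \<eta>'))) =
       (\<Sum>a\<in>S k. m k a * (ln (norm (of_real (r k) * cis t + \<eta>' - a)) - ln (10 * r k))) + Re (g k (of_real (r k) * cis t + \<eta>'))" for k
      by (rule AE_circ_cosparse[OF ev]) (use r0[of k] in auto)
    hence "AE t in circ. \<forall>k. x \<eta>' k t = e \<eta>' k t / T k + ln (norm (G k (cis t + \<eta>' / of_real (r k))))"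
      unfolding AE_all_countable
    proof (intro allI)
      fix k
      assume "\<And>k. AE t in circ. norm (of_real (r k) * cis t + \<eta>') \<le> 2 * r k \<longrightarrow> v (of_real (r k) * cis t + \<eta>') \<noteq> 0 \<and>
       ln (norm (v (of_real (r k) * cis t + \<eta>'))) =
       (\<Sum>a\<in>S k. m k a * (ln (norm (of_real (r k) * cis t + \<eta>' - a)) - ln (10 * r k))) + Re (g k (of_real (r k) * cis t + \<eta>'))"
      from this[of k] show "AE t in circ. x \<eta>' k t = e \<eta>' k t / T k + ln (norm (G k (cis t + \<eta>' / of_real (r k))))"
      proof eventually_elim
        case (elim t)
        have "norm (of_real (r k) * cis t + \<eta>') \<le> 2 * r k"
          using norm_triangle_ineq[of "of_real (r k) * cis t" \<eta>'] \<eta>'[of k] r0[of k] by (simp add: norm_mult)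
        hence "ln (norm (v (of_real (r k) * cis t + \<eta>'))) = e \<eta>' k t + Re (g k (of_real (r k) * cis t + \<eta>'))"
          using elim unfolding e_def by blast
        moreover have "of_real (r k) * (cis t + \<eta>' / of_real (r k)) = of_real (r k) * cis t + \<eta>'"
          using r0[of k] by (simp add: algebra_simps)
        ultimately show ?case unfolding x_def Gn by (simp add: add_divide_distrib)
      qed
    qed
    thus ?thesis using aed
    proof eventually_elim
      case (elim t)
      have "(\<lambda>k. e \<eta>' (\<phi> k) t / T (\<phi> k)) \<longlonglongrightarrow> 0"
      proof (rule Lim_null_comparison)
        show "(\<lambda>k. d (\<phi> k) t) \<longlonglongrightarrow> 0" using elim(2) by (simp add: \<phi>_def)
        show "eventually (\<lambda>k. norm (e \<eta>' (\<phi> k) t / T (\<phi> k)) \<le> d (\<phi> k) t) sequentially"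
        proof (intro always_eventually allI)
          fix k show "norm (e \<eta>' (\<phi> k) t / T (\<phi> k)) \<le> d (\<phi> k) t"
            using ed[of "\<phi> k" t] T(2)[of "\<phi> k"] by simp
        qed
      qed
      moreover have "(\<lambda>k. ln (norm (G (\<phi> k) (cis t + \<eta>' / of_real (r (\<phi> k)))))) \<longlonglongrightarrow> H t"
        using LIMSEQ_subseq_LIMSEQ[OF limG[where \<eta>' = \<eta>' and t = t] \<psi>'] by (simp add: o_def \<phi>_def)
      ultimately have "(\<lambda>k. e \<eta>' (\<phi> k) t / T (\<phi> k) + ln (norm (G (\<phi> k) (cis t + \<eta>' / of_real (r (\<phi> k)))))) \<longlonglongrightarrow> 0 + H t"
        by (rule tendsto_add)
      thus ?case using elim(1) by simp
    qed
  qed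
  have xl0: "AE t in circ. (\<lambda>k. x 0 (\<phi> k) t) \<longlonglongrightarrow> H t"
    by (rule xlim[OF z0]) (auto simp: d_def intro!: divide_right_mono less_imp_le[OF T(2)])
  have xl\<eta>: "AE t in circ. (\<lambda>k. x \<eta> (\<phi> k) t) \<longlonglongrightarrow> H t"
    by (rule xlim[OF r(2)]) (auto simp: d_def intro!: divide_right_mono less_imp_le[OF T(2)])
  obtain K where K: "K > 0" and L2: "\<And>f r \<eta>. nonzero_mero f \<Longrightarrow> r \<ge> 1 \<Longrightarrow> norm \<eta> \<le> r \<Longrightarrow>
     integrable circ (\<lambda>t. ln (norm (f (of_real r * cis t + \<eta>)))) \<and>
     integrable circ (\<lambda>t. (ln (norm (f (of_real r * cis t + \<eta>))))\<^sup>2) \<and>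
     (\<integral>t. (ln (norm (f (of_real r * cis t + \<eta>))))\<^sup>2 \<partial>circ) \<le> K * (two_sided (10 * r) f)\<^sup>2"
    using log_square_bound by blast
  have Ix: "integrable circ (x \<eta>' k)" "integrable circ (\<lambda>t. (x \<eta>' k t)\<^sup>2)"
    "(\<integral>t. (x \<eta>' k t)\<^sup>2 \<partial>circ) \<le> K * C\<^sup>2" if "norm \<eta>' \<le> r k" for \<eta>' k
  proof -
    note * = L2[OF v r(1) that]
    show "integrable circ (x \<eta>' k)" unfolding x_def using * by auto
    show "integrable circ (\<lambda>t. (x \<eta>' k t)\<^sup>2)" unfolding x_def power_divide using * by auto
    have ts: "0 \<le> two_sided (10 * r k) v" by (rule two_sided_bounds(2)[OF v]) (use r(1)[of k] in linarith)
    have "(\<integral>t. (x \<eta>' k t)\<^sup>2 \<partial>circ) = (\<integral>t. (ln (norm (v (of_real (r k) * cis t + \<eta>'))))\<^sup>2 \<partial>circ) / (T k)\<^sup>2"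
      unfolding x_def power_divide by simp
    also have "\<dots> \<le> K * (two_sided (10 * r k) v)\<^sup>2 / (T k)\<^sup>2"
      using * by (intro divide_right_mono) auto
    also have "\<dots> \<le> K * (C * T k)\<^sup>2 / (T k)\<^sup>2"
      using K two[of k] ts by (intro divide_right_mono mult_left_mono power_mono) auto
    also have "\<dots> = K * C\<^sup>2" using T(2)[of k] by (simp add: power_mult_distrib)
    finally show "(\<integral>t. (x \<eta>' k t)\<^sup>2 \<partial>circ) \<le> K * C\<^sup>2" .
  qed
  have IH: "integrable circ H" by (rule circ_integrable_bounded[OF Hm, of b]) (use Hb in auto)
  have xm: "x \<eta>' k \<in> borel_measurable borel" for \<eta>' k
    unfolding x_def using mero_circ_measurable[OF nonzero_mero_D(1)[OF v], of "r k" \<eta>'] by simp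
  have conv: "(\<lambda>k. \<integral>t. \<psi> (x \<eta>' (\<phi> k) t) \<partial>circ) \<longlonglongrightarrow> (\<integral>t. \<psi> (H t) \<partial>circ)"
    if "\<And>k. norm \<eta>' \<le> r k" "AE t in circ. (\<lambda>k. x \<eta>' (\<phi> k) t) \<longlonglongrightarrow> H t"
      "\<And>u v. \<bar>\<psi> u - \<psi> v\<bar> \<le> \<bar>u - v\<bar>" "\<psi> \<in> borel_measurable borel" for \<psi> \<eta>'
    by (rule L1_limit_imp[OF Ix(1)[OF that(1)] IH
          L1_limit_of_L2_bounded[OF xm Hm Hb Ix(2)[OF that(1)] Ix(3)[OF that(1)] that(2)] that(3,4)])
  have max_lip: "\<bar>max 0 u - max 0 w\<bar> \<le> \<bar>u - w\<bar>" for u w :: real by auto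
  have xpos: "(\<integral>t. max 0 (x \<eta>' k t) \<partial>circ) = proximity (r k) (\<lambda>z. v (z + \<eta>')) / T k" for \<eta>' k
  proof -
    have "max 0 (x \<eta>' k t) = log_plus (norm (v (of_real (r k) * cis t + \<eta>'))) / T k" for t
      using T(2)[of k] by (simp add: x_def log_plus_eq max_def divide_nonneg_pos zero_le_divide_iff)
    thus ?thesis using proximity_eq(2)[OF mero_shift[OF nonzero_mero_D(1)[OF v]] r0[of k], of \<eta>'] by simp
  qed
  have N0: "(\<lambda>k. int_pole_count (r k) v / T k) \<longlonglongrightarrow> 0" "(\<lambda>k. int_pole_count (r k) (\<lambda>z. 1 / v z) / T k) \<longlonglongrightarrow> 0"
  proof -
    note vm = nonzero_mero_D(1)[OF v] nonzero_mero_D(1)[OF nonzero_mero_inverse[OF v]]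
    have nn: "0 \<le> int_pole_count (r k) u" "0 \<le> int_pole_count (10 * r k) u"
      "int_pole_count (r k) u \<le> int_pole_count (10 * r k) u" if "u meromorphic_on UNIV" for u k
      using int_pole_count_nonneg[OF that] int_pole_count_mono[OF that, of "r k" "10 * r k"] r(1)[of k] r0[of k] by auto
    show "(\<lambda>k. int_pole_count (r k) v / T k) \<longlonglongrightarrow> 0"
    proof (rule Lim_null_comparison[OF _ N], intro always_eventually allI)
      fix k show "norm (int_pole_count (r k) v / T k) \<le> (int_pole_count (10 * r k) v + int_pole_count (10 * r k) (\<lambda>z. 1 / v z)) / T k"
        using nn[OF vm(1), of k] nn[OF vm(2), of k] T(2)[of k] by (simp add: divide_right_mono)
    qed
    show "(\<lambda>k. int_pole_count (r k) (\<lambda>z. 1 / v z) / T k) \<longlonglongrightarrow> 0"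
    proof (rule Lim_null_comparison[OF _ N], intro always_eventually allI)
      fix k show "norm (int_pole_count (r k) (\<lambda>z. 1 / v z) / T k) \<le> (int_pole_count (10 * r k) v + int_pole_count (10 * r k) (\<lambda>z. 1 / v z)) / T k"
        using nn[OF vm(1), of k] nn[OF vm(2), of k] T(2)[of k] by (simp add: divide_right_mono)
    qed
  qed
  \<comment> \<open>The positive part of ln |v| / T_k has mean m(r_k, v) / T_k = 1 - N(r_k, v) /
    T_k, and the last quotient tends to 0. The mean of H itself is then found in the same way from
    Jensen's formula.\<close>
  have Hplus: "(\<integral>t. max 0 (H t) \<partial>circ) = 1"
  proof (rule LIMSEQ_unique)
    show "(\<lambda>k. \<integral>t. max 0 (x 0 (\<phi> k) t) \<partial>circ) \<longlonglongrightarrow> (\<integral>t. max 0 (H t) \<partial>circ)"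
      by (rule conv[OF z0 xl0 max_lip]) measurable
    have "(\<lambda>k. 1 - int_pole_count (r k) v / T k) \<longlonglongrightarrow> 1 - 0" by (intro tendsto_intros N0)
    moreover have "1 - int_pole_count (r k) v / T k = proximity (r k) v / T k" for k
    proof -
      have "T k = proximity (r k) v + int_pole_count (r k) v" by (simp add: T(1) characteristic_def)
      thus ?thesis using T(2)[of k] by (simp add: field_simps)
    qed
    ultimately have "(\<lambda>k. proximity (r k) v / T k) \<longlonglongrightarrow> 1" by simp
    from LIMSEQ_subseq_LIMSEQ[OF this \<phi>] show "(\<lambda>k. \<integral>t. max 0 (x 0 (\<phi> k) t) \<partial>circ) \<longlonglongrightarrow> 1"
      by (simp add: xpos o_def)
  qed
  have Hmean: "(\<integral>t. H t \<partial>circ) = 0"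
  proof (rule LIMSEQ_unique)
    show "(\<lambda>k. \<integral>t. x 0 (\<phi> k) t \<partial>circ) \<longlonglongrightarrow> (\<integral>t. H t \<partial>circ)"
      by (rule conv[OF z0 xl0, where \<psi> = "\<lambda>u. u"]) auto
    have "(\<integral>t. x 0 k t \<partial>circ) = Jensen_const v / T k + int_pole_count (r k) (\<lambda>z. 1 / v z) / T k - int_pole_count (r k) v / T k" for k
      using Jensen(2)[OF v r0[of k]] by (simp add: x_def add_divide_distrib diff_divide_distrib)
    moreover have "(\<lambda>k. Jensen_const v / T k + int_pole_count (r k) (\<lambda>z. 1 / v z) / T k - int_pole_count (r k) v / T k) \<longlonglongrightarrow> 0 + 0 - 0"
      by (intro tendsto_intros N0 tendsto_divide_0[OF tendsto_const] filterlim_at_top_imp_at_infinity T(3))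
    ultimately have "(\<lambda>k. \<integral>t. x 0 k t \<partial>circ) \<longlonglongrightarrow> 0" by simp
    from LIMSEQ_subseq_LIMSEQ[OF this \<phi>] show "(\<lambda>k. \<integral>t. x 0 (\<phi> k) t \<partial>circ) \<longlonglongrightarrow> 0"
      by (simp add: o_def)
  qed
  \<comment> \<open>This supplies the point with |E| different from 1 that excludes the alternative
    of a constant modulus on the circle.\<close>
  have "\<exists>t. H t \<noteq> 0" using Hplus by (rule contrapos_pp) simp
  then obtain t0 where t0: "H t0 \<noteq> 0" ..
  have "finite {z. norm z = 1 \<and> norm (E z) = 1}"
    by (rule unimodular_on_circle_finite[OF E, of "cis t0"]) (use t0 in \<open>auto simp: H_def\<close>)
  hence "AE t in circ. of_real 1 * cis t + 0 \<notin> {z. norm z = 1 \<and> norm (E z) = 1}"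
    by (intro AE_circ_avoid countable_finite) auto
  hence Hnz: "AE t in circ. H t \<noteq> 0"
  proof eventually_elim
    case (elim t)
    thus ?case using E0[of t] by (simp add: H_def)
  qed
  show ?thesis
  proof (rule that[OF \<phi> Hm Hb])
    show "AE t in circ. (\<lambda>k. ln (norm (v (of_real (r (\<phi> k)) * cis t))) / T (\<phi> k)) \<longlonglongrightarrow> H t"
      using xl0 by (simp add: x_def)
    show "AE t in circ. (\<lambda>k. ln (norm (v (of_real (r (\<phi> k)) * cis t + \<eta>))) / T (\<phi> k)) \<longlonglongrightarrow> H t"
      using xl\<eta> by (simp add: x_def)
    have "(\<lambda>k. \<integral>t. max 0 (x \<eta> (\<phi> k) t) \<partial>circ) \<longlonglongrightarrow> (\<integral>t. max 0 (H t) \<partial>circ)"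
      by (rule conv[OF r(2) xl\<eta> max_lip]) measurable
    thus "(\<lambda>k. proximity (r (\<phi> k)) (\<lambda>z. v (z + \<eta>)) / T (\<phi> k)) \<longlonglongrightarrow> 1"
      by (simp add: xpos Hplus)
  qed (use Hnz Hplus Hmean in auto)
qed

subsection \<open>Dominant terms and Moebius images\<close>

context
  fixes T :: "nat \<Rightarrow> real"
  assumes T: "filterlim T at_top sequentially"
begin

lemma T_ev_pos: "eventually (\<lambda>k. T k > c) sequentially"
  using T by (simp add: filterlim_at_top_dense)

lemma const_over_T: "(\<lambda>k. c / T k) \<longlonglongrightarrow> (0::real)"
  by (intro tendsto_divide_0[OF tendsto_const] filterlim_at_top_imp_at_infinity T)

lemma ev_le_exp:
  fixes x :: "nat \<Rightarrow> complex"
  assumes "(\<lambda>k. ln (norm (x k)) / T k) \<longlonglongrightarrow> h" "h < q"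
  shows "eventually (\<lambda>k. norm (x k) \<le> exp (q * T k)) sequentially"
  using order_tendstoD(2)[OF assms] T_ev_pos[of 0]
proof eventually_elim
  case (elim k)
  show ?case
  proof (cases "x k = 0")
    case False
    have "ln (norm (x k)) \<le> q * T k" using elim by (simp add: divide_less_eq)
    hence "exp (ln (norm (x k))) \<le> exp (q * T k)" by simp
    thus ?thesis using False by simp
  qed simp
qed

text \<open>As \<open>ln 0 = 0\<close>, a vanishing sequence would have limit 0 in this
  normalization, so a lower bound requires nonvanishing explicitly. For a limit other than 0 it is
  automatic, see \<open>ev_nonzero\<close>.\<close>

lemma ev_ge_exp:
  fixes x :: "nat \<Rightarrow> complex"
  assumes "(\<lambda>k. ln (norm (x k)) / T k) \<longlonglongrightarrow> h" "q < h" "eventually (\<lambda>k. x k \<noteq> 0) sequentially"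
  shows "eventually (\<lambda>k. norm (x k) \<ge> exp (q * T k)) sequentially"
  using order_tendstoD(1)[OF assms(1,2)] T_ev_pos[of 0] assms(3)
proof eventually_elim
  case (elim k)
  have "ln (norm (x k)) \<ge> q * T k" using elim by (simp add: less_divide_eq)
  hence "exp (ln (norm (x k))) \<ge> exp (q * T k)" by simp
  thus ?case using elim by simp
qed

lemma ev_nonzero:
  fixes x :: "nat \<Rightarrow> complex"
  assumes "(\<lambda>k. ln (norm (x k)) / T k) \<longlonglongrightarrow> h" "h \<noteq> 0"
  shows "eventually (\<lambda>k. x k \<noteq> 0) sequentially"
proof -
  have "eventually (\<lambda>k. ln (norm (x k)) / T k \<noteq> 0) sequentially"
    using tendsto_imp_eventually_ne[OF assms] .
  thus ?thesis by eventually_elim auto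
qed

text \<open>An exponentially smaller summand is eventually at most half of the dominant one, so it
  changes the logarithm by at most ln 2, which disappears after division by T.\<close>

lemma log_dominant:
  fixes y z :: "nat \<Rightarrow> complex"
  assumes y: "(\<lambda>k. ln (norm (y k)) / T k) \<longlonglongrightarrow> p" "eventually (\<lambda>k. y k \<noteq> 0) sequentially"
    and z: "eventually (\<lambda>k. norm (z k) \<le> exp (q * T k)) sequentially" and qp: "q < p"
  shows "(\<lambda>k. ln (norm (y k + z k)) / T k) \<longlonglongrightarrow> p" "eventually (\<lambda>k. y k + z k \<noteq> 0) sequentially"
proof -
  define q' where "q' = (p + q) / 2"
  have q': "q < q'" "q' < p" using qp by (auto simp: q'_def)
  have ev: "eventually (\<lambda>k. norm (z k) \<le> norm (y k) / 2) sequentially"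
    using ev_ge_exp[OF y(1) q'(2) y(2)] z T_ev_pos[of "ln 2 / (q' - q)"]
  proof eventually_elim
    case (elim k)
    have "ln 2 \<le> (q' - q) * T k" using elim(3) q' by (simp add: divide_less_eq mult.commute)
    hence "exp (ln 2) \<le> exp ((q' - q) * T k)" by (subst exp_le_cancel_iff)
    hence "2 \<le> exp ((q' - q) * T k)" by simp
    also have "\<dots> = exp (q' * T k) / exp (q * T k)" by (simp add: left_diff_distrib exp_diff)
    finally have "2 * exp (q * T k) \<le> exp (q' * T k)" by (simp add: le_divide_eq)
    thus ?case using elim(1,2) by linarith
  qed
  have bd: "eventually (\<lambda>k. norm (y k) / 2 \<le> norm (y k + z k) \<and> norm (y k + z k) \<le> 2 * norm (y k)) sequentially"
    using ev
  proof eventually_elim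
    case (elim k)
    have "norm (y k) - norm (z k) \<le> norm (y k + z k)" by (rule norm_diff_ineq)
    moreover have "norm (y k + z k) \<le> norm (y k) + norm (z k)" by (rule norm_triangle_ineq)
    ultimately show ?case using elim norm_ge_zero[of "y k"] by linarith
  qed
  show "eventually (\<lambda>k. y k + z k \<noteq> 0) sequentially"
    using bd y(2) by eventually_elim auto
  have est: "eventually (\<lambda>k. ln (norm (y k)) / T k - ln 2 / T k \<le> ln (norm (y k + z k)) / T k \<and>
     ln (norm (y k + z k)) / T k \<le> ln (norm (y k)) / T k + ln 2 / T k) sequentially"
    using bd y(2) T_ev_pos[of 0]
  proof eventually_elim
    case (elim k)
    have p: "norm (y k) > 0" using elim by simp
    have p': "norm (y k + z k) > 0" using elim p by linarith
    have "ln (norm (y k) / 2) \<le> ln (norm (y k + z k))" using elim p p' by (subst ln_le_cancel_iff) auto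
    hence 1: "ln (norm (y k)) - ln 2 \<le> ln (norm (y k + z k))" using p by (simp add: ln_div)
    have "ln (norm (y k + z k)) \<le> ln (norm (y k) * 2)" using elim p p' by (subst ln_le_cancel_iff) auto
    hence 2: "ln (norm (y k + z k)) \<le> ln (norm (y k)) + ln 2" using p by (simp add: ln_mult_pos)
    show ?case using 1 2 elim(3)
      by (simp add: divide_right_mono flip: diff_divide_distrib add_divide_distrib)
  qed
  have "(\<lambda>k. ln (norm (y k)) / T k - ln 2 / T k) \<longlonglongrightarrow> p - 0"
    "(\<lambda>k. ln (norm (y k)) / T k + ln 2 / T k) \<longlonglongrightarrow> p + 0"
    by (intro tendsto_intros y const_over_T)+
  hence L: "(\<lambda>k. ln (norm (y k)) / T k - ln 2 / T k) \<longlonglongrightarrow> p"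
    "(\<lambda>k. ln (norm (y k)) / T k + ln 2 / T k) \<longlonglongrightarrow> p" by simp_all
  show "(\<lambda>k. ln (norm (y k + z k)) / T k) \<longlonglongrightarrow> p"
    by (rule tendsto_sandwich[OF _ _ L]; rule eventually_mono[OF est]; blast)
qed

text \<open>The map taking (u, u') to u^n u' satisfies a Lipschitz bound at (c, c) as long as |u -
  c| <= 1, by induction on \<open>n\<close>. Half of the exponential rate is given up to absorb the
  Lipschitz constant.\<close>

lemma log_near_power:
  fixes x x' w :: "nat \<Rightarrow> complex"
  assumes x: "eventually (\<lambda>k. norm (x k - c) \<le> exp (- \<delta> * T k)) sequentially"
    and x': "eventually (\<lambda>k. norm (x' k - c) \<le> exp (- \<delta> * T k)) sequentially" and \<delta>: "\<delta> > 0"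
  shows "eventually (\<lambda>k. norm (x k ^ n * x' k - c ^ (n + 1)) \<le> exp (- (\<delta> / 2) * T k)) sequentially"
proof -
  have "\<exists>K\<ge>0. \<forall>u u'. norm (u - c) \<le> 1 \<longrightarrow> norm (u ^ n * u' - c ^ (n + 1)) \<le> K * (norm (u - c) + norm (u' - c))"
  proof (induction n)
    case 0
    show ?case by (rule exI[of _ 1]) auto
  next
    case (Suc n)
    then obtain K where K: "K \<ge> 0"
      "\<And>u u'. norm (u - c) \<le> 1 \<Longrightarrow> norm (u ^ n * u' - c ^ (n + 1)) \<le> K * (norm (u - c) + norm (u' - c))"
      by blast
    show ?case
    proof (intro exI[of _ "(norm c + 1) * K + norm c ^ (n + 1)"] conjI allI impI)
      show "(norm c + 1) * K + norm c ^ (n + 1) \<ge> 0" using K(1) by simp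
      fix u u' assume u: "norm (u - c) \<le> 1"
      have un: "norm u \<le> norm c + 1" using norm_triangle_ineq2[of u c] u by linarith
      have "u ^ Suc n * u' - c ^ (Suc n + 1) = u * (u ^ n * u' - c ^ (n + 1)) + (u - c) * c ^ (n + 1)"
        by (simp add: algebra_simps)
      also have "norm \<dots> \<le> norm u * norm (u ^ n * u' - c ^ (n + 1)) + norm (u - c) * norm c ^ (n + 1)"
        using norm_triangle_ineq[of "u * (u ^ n * u' - c ^ (n + 1))" "(u - c) * c ^ (n + 1)"]
        by (simp only: norm_mult norm_power)
      also have "\<dots> \<le> (norm c + 1) * (K * (norm (u - c) + norm (u' - c))) + (norm (u - c) + norm (u' - c)) * norm c ^ (n + 1)"
        using un K(2)[OF u] by (intro add_mono mult_mono) auto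
      finally show "norm (u ^ Suc n * u' - c ^ (Suc n + 1)) \<le>
          ((norm c + 1) * K + norm c ^ (n + 1)) * (norm (u - c) + norm (u' - c))"
        by (simp add: algebra_simps)
    qed
  qed
  then obtain K where K: "K \<ge> 0"
    "\<And>u u'. norm (u - c) \<le> 1 \<Longrightarrow> norm (u ^ n * u' - c ^ (n + 1)) \<le> K * (norm (u - c) + norm (u' - c))" by blast
  show ?thesis using x x' T_ev_pos[of 0] T_ev_pos[of "2 / \<delta> * ln (2 * K + 1)"]
  proof eventually_elim
    case (elim k)
    have "- \<delta> * T k \<le> 0" using elim \<delta> by simp
    hence "exp (- \<delta> * T k) \<le> 1" by simp
    hence 1: "norm (x k - c) \<le> 1" using elim by linarith
    have "norm (x k ^ n * x' k - c ^ (n + 1)) \<le> K * (norm (x k - c) + norm (x' k - c))" by (rule K(2)[OF 1])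
    also have "\<dots> \<le> K * (exp (- \<delta> * T k) + exp (- \<delta> * T k))"
      using elim K(1) by (intro mult_left_mono add_mono) auto
    also have "\<dots> \<le> (2 * K + 1) * exp (- \<delta> * T k)" by (simp add: algebra_simps)
    also have "2 * K + 1 \<le> exp (\<delta> / 2 * T k)"
    proof -
      have "ln (2 * K + 1) \<le> \<delta> / 2 * T k" using elim(4) \<delta> by (simp add: field_simps)
      hence "exp (ln (2 * K + 1)) \<le> exp (\<delta> / 2 * T k)" by simp
      thus ?thesis using K(1) by simp
    qed
    hence "(2 * K + 1) * exp (- \<delta> * T k) \<le> exp (\<delta> / 2 * T k) * exp (- \<delta> * T k)"
      by (intro mult_right_mono) auto
    also have "\<dots> = exp (- (\<delta> / 2) * T k)" by (simp flip: exp_add)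
    finally show ?case .
  qed
qed

text \<open>The product is exponentially close to c^(n+1), so its difference from \<open>w\<close>
  is dominated by c^(n+1) - w, which is neither large nor small on the exponential scale. This is
  where the condition that c^(n+1) - s does not vanish identically enters.\<close>

lemma log_limit_near:
  fixes x x' w :: "nat \<Rightarrow> complex"
  assumes x: "(\<lambda>k. ln (norm (x k - c)) / T k) \<longlonglongrightarrow> h" and x': "(\<lambda>k. ln (norm (x' k - c)) / T k) \<longlonglongrightarrow> h"
    and h: "h < 0" and w: "(\<lambda>k. ln (norm (c ^ (n + 1) - w k)) / T k) \<longlonglongrightarrow> 0" and w0: "\<And>k. c ^ (n + 1) - w k \<noteq> 0"
  shows "(\<lambda>k. ln (norm (x k ^ n * x' k - w k)) / T k) \<longlonglongrightarrow> 0"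
    "eventually (\<lambda>k. x k ^ n * x' k - w k \<noteq> 0) sequentially"
    "\<exists>\<delta>>0. eventually (\<lambda>k. norm (x k ^ n * x' k - c ^ (n + 1)) \<le> exp (- \<delta> * T k)) sequentially"
proof -
  define \<delta> where "\<delta> = - h / 2"
  have \<delta>: "\<delta> > 0" "h < - \<delta>" using h by (auto simp: \<delta>_def)
  have ev: "eventually (\<lambda>k. norm (x k ^ n * x' k - c ^ (n + 1)) \<le> exp (- (\<delta> / 2) * T k)) sequentially"
    by (rule log_near_power[OF ev_le_exp[OF x \<delta>(2)] ev_le_exp[OF x' \<delta>(2)] \<delta>(1)])
  thus "\<exists>\<delta>>0. eventually (\<lambda>k. norm (x k ^ n * x' k - c ^ (n + 1)) \<le> exp (- \<delta> * T k)) sequentially"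
    using \<delta>(1) by (intro exI[of _ "\<delta> / 2"]) auto
  have w0': "eventually (\<lambda>k. c ^ (n + 1) - w k \<noteq> 0) sequentially" using w0 by (intro always_eventually) auto
  have q: "- (\<delta> / 2) < 0" using \<delta> by simp
  have e: "c ^ (n + 1) - w k + (x k ^ n * x' k - c ^ (n + 1)) = x k ^ n * x' k - w k" for k by simp
  show "(\<lambda>k. ln (norm (x k ^ n * x' k - w k)) / T k) \<longlonglongrightarrow> 0"
    "eventually (\<lambda>k. x k ^ n * x' k - w k \<noteq> 0) sequentially"
    using log_dominant[OF w w0' ev q] unfolding e by auto
qed

text \<open>Exponential growth of x - c makes \<open>c\<close> negligible, so n + 1 factors of size
  exp(h T) are multiplied, and \<open>w\<close> is negligible against the product.\<close>

lemma log_limit_far: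
  fixes x x' w :: "nat \<Rightarrow> complex"
  assumes x: "(\<lambda>k. ln (norm (x k - c)) / T k) \<longlonglongrightarrow> h" and x': "(\<lambda>k. ln (norm (x' k - c)) / T k) \<longlonglongrightarrow> h"
    and h: "h > 0" and w: "(\<lambda>k. ln (norm (w k)) / T k) \<longlonglongrightarrow> 0"
  shows "(\<lambda>k. ln (norm (x k ^ n * x' k - w k)) / T k) \<longlonglongrightarrow> real (n + 1) * h"
    "eventually (\<lambda>k. x k ^ n * x' k - w k \<noteq> 0) sequentially"
proof -
  have "(\<lambda>k. ln (norm c) / T k) \<longlonglongrightarrow> 0" by (rule const_over_T)
  hence c: "eventually (\<lambda>k. norm c \<le> exp (h / 2 * T k)) sequentially"
    by (rule ev_le_exp) (use h in auto)
  have h2: "h / 2 < h" using h by simp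
  have h0: "h \<noteq> 0" using h by simp
  have X: "(\<lambda>k. ln (norm (x k)) / T k) \<longlonglongrightarrow> h" "eventually (\<lambda>k. x k \<noteq> 0) sequentially"
    using log_dominant[OF x ev_nonzero[OF x h0] c h2] by auto
  have X': "(\<lambda>k. ln (norm (x' k)) / T k) \<longlonglongrightarrow> h" "eventually (\<lambda>k. x' k \<noteq> 0) sequentially"
    using log_dominant[OF x' ev_nonzero[OF x' h0] c h2] by auto
  have "(\<lambda>k. real n * (ln (norm (x k)) / T k) + ln (norm (x' k)) / T k) \<longlonglongrightarrow> real n * h + h"
    by (intro tendsto_intros X X')
  moreover have "eventually (\<lambda>k. real n * (ln (norm (x k)) / T k) + ln (norm (x' k)) / T k =
      ln (norm (x k ^ n * x' k)) / T k) sequentially"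
    using X(2) X'(2)
    by eventually_elim (simp add: norm_mult norm_power ln_mult_pos ln_realpow add_divide_distrib)
  ultimately have Y: "(\<lambda>k. ln (norm (x k ^ n * x' k)) / T k) \<longlonglongrightarrow> real (n + 1) * h"
    by (auto simp: algebra_simps elim: Lim_transform_eventually)
  have Y0: "eventually (\<lambda>k. x k ^ n * x' k \<noteq> 0) sequentially" using X(2) X'(2) by eventually_elim auto
  have "eventually (\<lambda>k. norm (w k) \<le> exp (h / 2 * T k)) sequentially"
    by (rule ev_le_exp[OF w]) (use h in auto)
  hence W: "eventually (\<lambda>k. norm (- w k) \<le> exp (h / 2 * T k)) sequentially" by simp
  have q: "h / 2 < real (n + 1) * h"
  proof -
    have "h * 1 \<le> h * real (n + 1)" using h by (intro mult_left_mono) auto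
    thus ?thesis using h2 by (simp add: mult.commute)
  qed
  show "(\<lambda>k. ln (norm (x k ^ n * x' k - w k)) / T k) \<longlonglongrightarrow> real (n + 1) * h"
    "eventually (\<lambda>k. x k ^ n * x' k - w k \<noteq> 0) sequentially"
    using log_dominant[OF Y Y0 W q] by auto
qed

text \<open>Since v - 1 = (b - a) / (x - b), an exponentially large \<open>v\<close> forces
  \<open>x\<close> exponentially close to \<open>b\<close>. If \<open>v\<close> is exponentially
  small, x - b is of order 1 on this scale, and x - a = v (x - b) inherits the rate of
  \<open>v\<close>.\<close>

lemma log_limit_Moebius:
  fixes x v :: "nat \<Rightarrow> complex"
  assumes v: "(\<lambda>k. ln (norm (v k)) / T k) \<longlonglongrightarrow> h" and h: "h \<noteq> 0"
    and x: "\<And>k. x k \<noteq> b" "\<And>k. v k = (x k - a) / (x k - b)" and ab: "a \<noteq> b"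
  shows "h > 0 \<Longrightarrow> (\<lambda>k. ln (norm (x k - b)) / T k) \<longlonglongrightarrow> - h"
    "h < 0 \<Longrightarrow> (\<lambda>k. ln (norm (x k - a)) / T k) \<longlonglongrightarrow> h"
proof -
  have v1: "v k - 1 = (b - a) / (x k - b)" for k
    using x(1)[of k] unfolding x(2) by (simp add: field_simps)
  have one: "(\<lambda>k. ln (norm (- 1 :: complex)) / T k) \<longlonglongrightarrow> 0" by simp
  have xb: "ln (norm (x k - b)) / T k = ln (norm (b - a)) / T k - ln (norm (v k + - 1)) / T k" for k
  proof -
    have p: "norm (b - a) > 0" "norm (x k - b) > 0" using ab x(1)[of k] by auto
    have "norm (v k + - 1) = norm (b - a) / norm (x k - b)"
      using v1[of k] by (simp only: norm_divide[symmetric] add_uminus_conv_diff)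
    hence "ln (norm (v k + - 1)) = ln (norm (b - a)) - ln (norm (x k - b))" using p by (simp only: ln_div) auto
    thus ?thesis by (simp add: diff_divide_distrib)
  qed
  show "(\<lambda>k. ln (norm (x k - b)) / T k) \<longlonglongrightarrow> - h" if h0: "h > 0"
  proof -
    have "eventually (\<lambda>k. norm (- 1 :: complex) \<le> exp (h / 2 * T k)) sequentially"
      by (rule ev_le_exp[OF one]) (use h0 in auto)
    from log_dominant(1)[OF v ev_nonzero[OF v h] this]
    have "(\<lambda>k. ln (norm (v k + - 1)) / T k) \<longlonglongrightarrow> h" using h0 by simp
    from tendsto_diff[OF const_over_T[of "ln (norm (b - a))"] this] show ?thesis unfolding xb by simp
  qed
  show "(\<lambda>k. ln (norm (x k - a)) / T k) \<longlonglongrightarrow> h" if h0: "h < 0"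
  proof -
    have "eventually (\<lambda>k. norm (v k) \<le> exp (h / 2 * T k)) sequentially"
      by (rule ev_le_exp[OF v]) (use h0 in auto)
    from log_dominant(1)[OF one _ this]
    have "(\<lambda>k. ln (norm (v k + - 1)) / T k) \<longlonglongrightarrow> 0" using h0 by (simp add: add.commute)
    from tendsto_diff[OF const_over_T[of "ln (norm (b - a))"] this]
    have xb': "(\<lambda>k. ln (norm (x k - b)) / T k) \<longlonglongrightarrow> 0" unfolding xb by simp
    have "eventually (\<lambda>k. ln (norm (v k)) / T k + ln (norm (x k - b)) / T k = ln (norm (x k - a)) / T k) sequentially"
      using ev_nonzero[OF v h]
    proof eventually_elim
      case (elim k)
      have "x k - a = v k * (x k - b)" using x(1)[of k] unfolding x(2) by simp
      thus ?case using elim x(1)[of k] by (simp add: norm_mult ln_mult_pos add_divide_distrib)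
    qed
    from Lim_transform_eventually[OF tendsto_add[OF v xb'] this] show ?thesis by simp
  qed
qed

end

section \<open>Characteristics of shifts and Moebius images\<close>

lemma characteristic_cmult_le:
  assumes f: "f meromorphic_on UNIV" and r: "r \<ge> 1"
  shows "characteristic r (\<lambda>z. c * f z) \<le> characteristic r f + log_plus (norm c)"
  using characteristic_mult[OF meromorphic_on_const f r, of c] characteristic_const[of r c] r by simp

lemma characteristic_add_const_le:
  assumes f: "f meromorphic_on UNIV" and r: "r \<ge> 1"
  shows "characteristic r (\<lambda>z. f z + c) \<le> characteristic r f + log_plus (norm c) + ln 2"
  using characteristic_add[OF f meromorphic_on_const r, of c] characteristic_const[of r c] r by simp

text \<open>A crude bound, with a constant factor and an enlarged radius, is enough: it serves to
  keep the characteristic of the difference product bounded relative to T_k, while exact asymptotics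
  come from the scaling limit.\<close>

lemma characteristic_shift:
  assumes f: "nonzero_mero f"
  obtains D where "D \<ge> 0" "\<And>r. r \<ge> 1 \<Longrightarrow> r \<ge> norm \<eta> \<Longrightarrow>
    characteristic r (\<lambda>z. f (z + \<eta>)) \<le> D * (characteristic (10 * r) f + 1 + ln r)"
proof -
  obtain K where K: "K > 0" and KK: "\<And>f r \<eta>. nonzero_mero f \<Longrightarrow> r \<ge> 1 \<Longrightarrow> norm \<eta> \<le> r \<Longrightarrow>
     integrable circ (\<lambda>t. ln (norm (f (of_real r * cis t + \<eta>)))) \<and>
     (\<integral>t. \<bar>ln (norm (f (of_real r * cis t + \<eta>)))\<bar> \<partial>circ) \<le> K * two_sided (10 * r) f"
    using log_square_bound by blast
  note fm = nonzero_mero_D(1)[OF f]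
  obtain C where C: "C \<ge> 0" "\<And>r. r \<ge> 1 \<Longrightarrow> r \<ge> norm \<eta> \<Longrightarrow>
    int_pole_count r (\<lambda>z. f (z + \<eta>)) \<le> int_pole_count (2 * r) f + C * (1 + ln r)"
    using int_pole_count_shift[OF fm, of \<eta>] by blast
  define D where "D = 2 * K + K * \<bar>Jensen_const f\<bar> + 1 + C"
  show ?thesis
  proof (rule that[of D])
    show "D \<ge> 0" using K C by (simp add: D_def)
    fix r :: real assume r: "r \<ge> 1" "r \<ge> norm \<eta>"
    have r0: "r > 0" using r by simp
    have sh: "(\<lambda>z. f (z + \<eta>)) meromorphic_on UNIV" by (rule mero_shift[OF fm])
    have T0: "characteristic (10 * r) f \<ge> 0" by (rule characteristic_nonneg[OF fm]) (use r in simp)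
    have l0: "ln r \<ge> 0" using r by simp
    note * = KK[OF f r]
    have "proximity r (\<lambda>z. f (z + \<eta>)) \<le> (\<integral>t. \<bar>ln (norm (f (of_real r * cis t + \<eta>)))\<bar> \<partial>circ)"
      unfolding proximity_eq(2)[OF sh r0]
      by (rule integral_mono) (use * proximity_eq(1)[OF sh r0] in \<open>auto simp: log_plus_eq\<close>)
    also have "\<dots> \<le> K * (2 * characteristic (10 * r) f - Jensen_const f)" using * by (simp add: two_sided_def)
    also have "\<dots> \<le> K * (2 * characteristic (10 * r) f + \<bar>Jensen_const f\<bar>)"
      using K by (intro mult_left_mono) auto
    finally have 1: "proximity r (\<lambda>z. f (z + \<eta>)) \<le> 2 * K * characteristic (10 * r) f + K * \<bar>Jensen_const f\<bar>"
      by (simp add: algebra_simps)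
    have "int_pole_count (2 * r) f \<le> characteristic (2 * r) f"
      by (rule int_pole_count_le_characteristic[OF fm]) (use r in simp)
    also have "\<dots> \<le> characteristic (10 * r) f" by (rule characteristic_mono[OF fm]) (use r in auto)
    finally have 2: "int_pole_count r (\<lambda>z. f (z + \<eta>)) \<le> characteristic (10 * r) f + C * (1 + ln r)"
      using C(2)[OF r] by linarith
    have 3: "C * (1 + ln r) \<le> C * (characteristic (10 * r) f + 1 + ln r)"
      using C(1) T0 by (intro mult_left_mono) auto
    have 4: "2 * K * characteristic (10 * r) f \<le> 2 * K * (characteristic (10 * r) f + 1 + ln r)"
      using K l0 by (intro mult_left_mono) auto
    have 5: "K * \<bar>Jensen_const f\<bar> * 1 \<le> K * \<bar>Jensen_const f\<bar> * (characteristic (10 * r) f + 1 + ln r)"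
      using K T0 l0 by (intro mult_left_mono) auto
    have 6: "characteristic (10 * r) f \<le> 1 * (characteristic (10 * r) f + 1 + ln r)" using l0 by simp
    have "characteristic r (\<lambda>z. f (z + \<eta>)) \<le>
      2 * K * (characteristic (10 * r) f + 1 + ln r) + K * \<bar>Jensen_const f\<bar> * (characteristic (10 * r) f + 1 + ln r)
      + 1 * (characteristic (10 * r) f + 1 + ln r) + C * (characteristic (10 * r) f + 1 + ln r)"
      unfolding characteristic_def[of r] using 1 2 3 4 5 6 by linarith
    thus "characteristic r (\<lambda>z. f (z + \<eta>)) \<le> D * (characteristic (10 * r) f + 1 + ln r)"
      by (simp only: D_def distrib_right)
  qed
qed

text \<open>The map is composed of affine maps, which change the characteristic by a bounded amount,
  and one inversion, which changes it by a constant according to the first main theorem: v = (b - a)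
  / (f - b) + 1.\<close>

lemma characteristic_Moebius:
  assumes f: "f meromorphic_on UNIV" and fb: "nonzero_mero (\<lambda>z. f z - b)" and ab: "a \<noteq> b"
  obtains D where "\<And>r. r \<ge> 1 \<Longrightarrow> \<bar>characteristic r (\<lambda>z. (f z - a) / (f z - b)) - characteristic r f\<bar> \<le> D"
proof -
  define v where "v = (\<lambda>z. (f z - a) / (f z - b))"
  define u where "u = (\<lambda>z. f z - b)"
  define w where "w = (\<lambda>z. 1 / u z)"
  have um: "u meromorphic_on UNIV" unfolding u_def by (intro meromorphic_intros f)
  have vm: "v meromorphic_on UNIV" unfolding v_def by (intro meromorphic_intros f)
  have wm: "w meromorphic_on UNIV" unfolding w_def by (intro meromorphic_intros um)
  have un: "nonzero_mero u" using fb by (simp add: u_def)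
  have ev: "\<forall>\<^sub>\<approx>z. u z \<noteq> 0" using un by (simp add: nonzero_mero_def)
  have e1: "\<forall>\<^sub>\<approx>z. v z = (b - a) * w z + 1"
    using ev by eventually_elim (auto simp: v_def w_def u_def field_simps)
  have e2: "\<forall>\<^sub>\<approx>z. w z = 1 / (b - a) * (v z + (- 1))"
    using e1 by eventually_elim (use ab in auto)
  define L where "L = (\<lambda>c. log_plus (norm (c::complex)))"
  define D where "D = L (b - a) + L (1 / (b - a)) + L 1 + L (-1) + L b + L (- b) + 2 * ln 2 + \<bar>Jensen_const u\<bar>"
  have Lpos: "L c \<ge> 0" for c by (simp add: L_def)
  show ?thesis
  proof (rule that[of D])
    fix r :: real assume r: "r \<ge> 1"
    have "characteristic r v = characteristic r (\<lambda>z. (b - a) * w z + 1)"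
      by (rule characteristic_cong[OF vm _ e1 r]) (intro meromorphic_intros wm)
    also have "\<dots> \<le> characteristic r (\<lambda>z. (b - a) * w z) + L 1 + ln 2"
      unfolding L_def by (rule characteristic_add_const_le[OF _ r]) (intro meromorphic_intros wm)
    also have "characteristic r (\<lambda>z. (b - a) * w z) \<le> characteristic r w + L (b - a)"
      unfolding L_def by (rule characteristic_cmult_le[OF wm r])
    finally have 1: "characteristic r v \<le> characteristic r w + L (b - a) + L 1 + ln 2" by simp
    have "characteristic r w = characteristic r (\<lambda>z. 1 / (b - a) * (v z + (- 1)))"
      by (rule characteristic_cong[OF wm _ e2 r]) (intro meromorphic_intros vm)
    also have "\<dots> \<le> characteristic r (\<lambda>z. v z + (- 1)) + L (1 / (b - a))"
      unfolding L_def by (rule characteristic_cmult_le[OF _ r]) (intro meromorphic_intros vm)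
    also have "characteristic r (\<lambda>z. v z + (- 1)) \<le> characteristic r v + L (- 1) + ln 2"
      unfolding L_def by (rule characteristic_add_const_le[OF vm r])
    finally have 2: "characteristic r w \<le> characteristic r v + L (- 1) + ln 2 + L (1 / (b - a))" by simp
    have 3: "characteristic r w = characteristic r u - Jensen_const u"
      unfolding w_def by (rule first_main_theorem[OF un]) (use r in simp)
    have 4: "characteristic r u \<le> characteristic r f + L (- b) + ln 2"
      using characteristic_add_const_le[OF f r, of "- b"] by (simp add: L_def u_def)
    have 5: "characteristic r f \<le> characteristic r u + L b + ln 2"
      using characteristic_add_const_le[OF um r, of b] by (simp add: L_def u_def)
    have "\<bar>characteristic r v - characteristic r f\<bar> \<le> D"
      using 1 2 3 4 5 Lpos[of "b - a"] Lpos[of "1 / (b - a)"] Lpos[of 1] Lpos[of "-1"] Lpos[of b] Lpos[of "-b"]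
      unfolding D_def by linarith
    thus "\<bar>characteristic r (\<lambda>z. (f z - a) / (f z - b)) - characteristic r f\<bar> \<le> D" by (simp add: v_def)
  qed
qed

text \<open>This transfers the exceptional values of \<open>f\<close> to the zeros and poles of v.
  For two finite values, v = (b - a) / (f - b) + 1 and 1/v = (a - b) / (f - a) + 1.\<close>

lemma int_pole_count_affine:
  assumes f: "f meromorphic_on UNIV" and g: "g meromorphic_on UNIV" and c: "c \<noteq> 0"
    and eq: "\<forall>\<^sub>\<approx>z. g z = c * f z + d" and r: "r \<ge> 1"
  shows "int_pole_count r g = int_pole_count r f"
proof (rule int_pole_count_cong[OF g f r])
  fix z
  have m: "(\<lambda>z. c * f z) meromorphic_on UNIV" by (intro meromorphic_intros f)
  have "pmult g z = pmult (\<lambda>z. c * f z + d) z" by (rule pmult_cong[OF eq])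
  also have "\<dots> = pmult (\<lambda>z. c * f z) z" by (rule pmult_add_const[OF m])
  also have "\<dots> = pmult f z"
  proof (rule antisym)
    show "pmult (\<lambda>z. c * f z) z \<le> pmult f z" using pmult_mult[OF meromorphic_on_const f, of c z] by simp
    show "pmult f z \<le> pmult (\<lambda>z. c * f z) z"
      using pmult_mult[OF meromorphic_on_const m, of "1 / c" z] c by simp
  qed
  finally show "pmult g z = pmult f z" .
qed

lemma growth_exponent_cong:
  assumes "eventually (\<lambda>r. g r = h r) at_top"
  shows "growth_exponent g = growth_exponent h"
  unfolding growth_exponent_def
  by (intro Limsup_eq) (use assms in \<open>auto elim: eventually_mono\<close>)

subsection \<open>Choice of scales\<close>

text \<open>Two exponents \<rho>1 < \<rho>2 are inserted between the growth of the two counting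
  functions and the order. At the chosen radii T is at least of size r^\<rho>2, the counting
  functions at most of size r^\<rho>1, and regular growth compares T at the enlarged radii with T at
  r_k.\<close>

lemma good_scales:
  assumes f: "f meromorphic_on UNIV" and v: "nonzero_mero v"
    and D: "\<And>r. r \<ge> 1 \<Longrightarrow> \<bar>characteristic r v - characteristic r f\<bar> \<le> D"
    and fin: "growth_order f < \<infinity>"
    and g1: "growth_exponent (\<lambda>r. int_pole_count r v) < growth_order f"
    and g2: "growth_exponent (\<lambda>r. int_pole_count r (\<lambda>z. 1 / v z)) < growth_order f"
    and s: "small_function s f"
  obtains r :: "nat \<Rightarrow> real" and C where "\<And>k. r k \<ge> max 1 (norm (\<eta>::complex))" "filterlim r at_top sequentially"
    "\<And>k. characteristic (r k) v \<ge> 1" "filterlim (\<lambda>k. characteristic (r k) v) at_top sequentially"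
    "\<And>k. characteristic (100 * r k) v \<le> C * characteristic (r k) v"
    "(\<lambda>k. int_pole_count (10 * r k) v / characteristic (r k) v) \<longlonglongrightarrow> 0"
    "(\<lambda>k. int_pole_count (10 * r k) (\<lambda>z. 1 / v z) / characteristic (r k) v) \<longlonglongrightarrow> 0"
    "(\<lambda>k. characteristic (10 * r k) s / characteristic (r k) v) \<longlonglongrightarrow> 0"
    "(\<lambda>k. (1 + ln (r k)) / characteristic (r k) v) \<longlonglongrightarrow> 0"
proof -
  note vm = nonzero_mero_D(1)[OF v] nonzero_mero_D(1)[OF nonzero_mero_inverse[OF v]]
  have sm: "s meromorphic_on UNIV" using s by (simp add: small_function_def)
  define g where "g = max (growth_exponent (\<lambda>r. int_pole_count r v)) (growth_exponent (\<lambda>r. int_pole_count r (\<lambda>z. 1 / v z)))"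
  have "g < growth_order f" using g1 g2 by (simp add: g_def)
  then obtain \<rho>2 where \<rho>2: "g < ereal \<rho>2" "ereal \<rho>2 < growth_order f" using ereal_dense2 by blast
  then obtain \<rho>1 where \<rho>1: "g < ereal \<rho>1" "ereal \<rho>1 < ereal \<rho>2" using ereal_dense2 by blast
  have "0 \<le> g" using growth_exponent_nonneg by (simp add: g_def le_max_iff_disj)
  hence "(0::ereal) < ereal \<rho>1" using \<rho>1(1) by (rule le_less_trans)
  hence \<rho>: "0 < \<rho>1" "\<rho>1 < \<rho>2" using \<rho>1(2) by auto
  have N1: "eventually (\<lambda>r. int_pole_count r v \<le> r powr \<rho>1) at_top"
    by (rule growth_exponent_less_imp) (use \<rho>1(1) in \<open>simp add: g_def\<close>)
  have N2: "eventually (\<lambda>r. int_pole_count r (\<lambda>z. 1 / v z) \<le> r powr \<rho>1) at_top"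
    by (rule growth_exponent_less_imp) (use \<rho>1(1) in \<open>simp add: g_def\<close>)
  have \<rho>2': "0 \<le> \<rho>2" "ereal \<rho>2 < growth_exponent (\<lambda>r. characteristic r f)"
    "growth_exponent (\<lambda>r. characteristic r f) < \<infinity>"
    using \<rho> \<rho>2(2) fin by (auto simp: growth_order_def)
  \<comment> \<open>The ratio 1000 covers the radius 100 r in the conclusion and the radius 20 r at
    which the small function is compared with \<open>f\<close>.\<close>
  have A: "(1000::real) > 1" by simp
  obtain C where C: "\<And>R. \<exists>r\<ge>R. r powr \<rho>2 \<le> characteristic r f \<and> characteristic (1000 * r) f \<le> C * characteristic r f"
    using regular_scales[OF A \<rho>2'] by blast
  have D0: "D \<ge> 0" using D[of 1] by linarith
  \<comment> \<open>The last entry forces T(r_k, f) >= 2 D + 2. As T(r, v) and T(r, f) differ by at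
    most \<open>D\<close>, this gives T(r_k, f) <= 2 T(r_k, v) and T(r_k, v) >= 1.\<close>
  define R where "R = (\<lambda>k::nat. max (max 1 (norm \<eta>)) (max (real k) ((2 * D + 2) powr (1 / \<rho>2))))"
  have "\<exists>r. \<forall>k. r k \<ge> R k \<and> r k powr \<rho>2 \<le> characteristic (r k) f \<and> characteristic (1000 * r k) f \<le> C * characteristic (r k) f"
    using C by (intro choice allI) blast
  then obtain r where r: "\<And>k. r k \<ge> R k" "\<And>k. r k powr \<rho>2 \<le> characteristic (r k) f"
    "\<And>k. characteristic (1000 * r k) f \<le> C * characteristic (r k) f" by blast
  have r1: "r k \<ge> max 1 (norm \<eta>)" "r k \<ge> 1" "r k \<ge> real k" for k using r(1)[of k] by (auto simp: R_def)
  have rinf: "filterlim r at_top sequentially"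
    by (rule filterlim_at_top_mono[OF filterlim_real_sequentially]) (use r1(3) in auto)
  have big: "r k powr \<rho>2 \<ge> 2 * D + 2" for k
  proof -
    have "((2 * D + 2) powr (1 / \<rho>2)) powr \<rho>2 \<le> r k powr \<rho>2"
      using r(1)[of k] \<rho> by (intro powr_mono2) (auto simp: R_def)
    thus ?thesis using \<rho> D0 by (simp add: powr_powr)
  qed
  define T where "T = (\<lambda>k. characteristic (r k) v)"
  have Tf: "characteristic (r k) f \<le> 2 * T k" for k
    using D[OF r1(2), of k] r(2)[of k] big[of k] by (simp add: T_def abs_le_iff)
  have Tr: "r k powr \<rho>2 \<le> 2 * T k" for k using Tf[of k] r(2)[of k] by linarith
  have T1: "T k \<ge> 1" for k using Tr[of k] big[of k] D0 by linarith
  have Cpos: "C \<ge> 0"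
  proof -
    have "0 \<le> characteristic (1000 * r 0) f" by (rule characteristic_nonneg[OF f]) (use r1(2)[of 0] in simp)
    hence "0 \<le> C * characteristic (r 0) f" using r(3)[of 0] by linarith
    moreover have "characteristic (r 0) f > 0" using r(2)[of 0] big[of 0] D0 by linarith
    ultimately show ?thesis by (simp add: zero_le_mult_iff)
  qed
  have Cf: "characteristic (1000 * r k) f \<le> 2 * C * T k" for k
    using r(3)[of k] mult_left_mono[OF Tf[of k] Cpos] by linarith
  have powr_lim: "(\<lambda>k. a * r k powr \<rho>1 / (r k powr \<rho>2 / 2)) \<longlonglongrightarrow> 0" for a
  proof -
    have "((\<lambda>x. a * x powr \<rho>1 / (x powr \<rho>2 / 2)) \<longlongrightarrow> 0) at_top" using \<rho> by real_asymp
    from filterlim_compose[OF this rinf] show ?thesis .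
  qed
  have cmp: "(\<lambda>k. y k / T k) \<longlonglongrightarrow> 0" if "eventually (\<lambda>k. 0 \<le> y k \<and> y k \<le> z k) sequentially"
    "(\<lambda>k. z k / (r k powr \<rho>2 / 2)) \<longlonglongrightarrow> 0" for y z :: "nat \<Rightarrow> real"
  proof (rule Lim_null_comparison[OF _ that(2)])
    show "eventually (\<lambda>k. norm (y k / T k) \<le> z k / (r k powr \<rho>2 / 2)) sequentially"
      using that(1)
    proof eventually_elim
      case (elim k)
      have "y k / T k \<le> z k / (r k powr \<rho>2 / 2)"
        using elim Tr[of k] big[of k] D0 by (intro frac_le) auto
      thus ?case using elim T1[of k] by simp
    qed
  qed
  have r10: "filterlim (\<lambda>k. 10 * r k) at_top sequentially"
  proof (rule filterlim_at_top_mono[OF rinf], intro always_eventually allI)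
    fix k show "r k \<le> 10 * r k" using r1(2)[of k] by simp
  qed
  have Nlim: "(\<lambda>k. int_pole_count (10 * r k) u / T k) \<longlonglongrightarrow> 0"
    if u: "u meromorphic_on UNIV" and N: "eventually (\<lambda>r. int_pole_count r u \<le> r powr \<rho>1) at_top" for u
  proof (rule cmp[OF _ powr_lim[of "10 powr \<rho>1"]])
    have "eventually (\<lambda>k. int_pole_count (10 * r k) u \<le> (10 * r k) powr \<rho>1) sequentially"
      using eventually_compose_filterlim[OF N r10] .
    thus "eventually (\<lambda>k. 0 \<le> int_pole_count (10 * r k) u \<and> int_pole_count (10 * r k) u \<le> 10 powr \<rho>1 * r k powr \<rho>1) sequentially"
    proof eventually_elim
      case (elim k)
      show ?case using elim int_pole_count_nonneg[OF u, of "10 * r k"] r1(2)[of k] by (simp add: powr_mult)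
    qed
  qed
  have slim: "(\<lambda>k. characteristic (10 * r k) s / T k) \<longlonglongrightarrow> 0"
  proof (rule LIMSEQ_I)
    fix e :: real assume e: "e > 0"
    define \<epsilon> where "\<epsilon> = e / (4 * (C + 1))"
    have \<epsilon>: "\<epsilon> > 0" using e Cpos by (simp add: \<epsilon>_def)
    have "eventually (\<lambda>k. characteristic (10 * r k) s \<le> \<epsilon> * characteristic (2 * (10 * r k)) f) sequentially"
      using eventually_compose_filterlim[OF small_function_characteristic[OF s f \<epsilon>] r10] .
    then obtain k0 where k0: "\<And>k. k \<ge> k0 \<Longrightarrow> characteristic (10 * r k) s \<le> \<epsilon> * characteristic (2 * (10 * r k)) f"
      unfolding eventually_sequentially by blast
    show "\<exists>no. \<forall>k\<ge>no. norm (characteristic (10 * r k) s / T k - 0) < e"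
    proof (intro exI allI impI)
      fix k assume k: "k \<ge> k0"
      have "characteristic (10 * r k) s \<le> \<epsilon> * characteristic (2 * (10 * r k)) f" by (rule k0[OF k])
      also have "\<dots> \<le> \<epsilon> * characteristic (1000 * r k) f"
        using \<epsilon> r1(2)[of k] by (intro mult_left_mono characteristic_mono[OF f]) auto
      also have "\<dots> \<le> \<epsilon> * (2 * C * T k)" using \<epsilon> Cf by (intro mult_left_mono) auto
      also have "\<dots> \<le> \<epsilon> * (2 * (C + 1) * T k)" using \<epsilon> T1[of k] by (intro mult_left_mono mult_right_mono) auto
      also have "\<dots> = e / 2 * T k" using Cpos by (simp add: \<epsilon>_def field_simps)
      also have "\<dots> < e * T k" using e T1[of k] by simp
      finally have "characteristic (10 * r k) s < e * T k" .
      moreover have "characteristic (10 * r k) s \<ge> 0"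
        by (rule characteristic_nonneg[OF sm]) (use r1(2)[of k] in simp)
      ultimately show "norm (characteristic (10 * r k) s / T k - 0) < e" using T1[of k] by (simp add: divide_less_eq)
    qed
  qed
  have lnlim: "(\<lambda>k. (1 + ln (r k)) / T k) \<longlonglongrightarrow> 0"
  proof (rule cmp)
    have "((\<lambda>x. (1 + ln x) / (x powr \<rho>2 / 2)) \<longlongrightarrow> 0) at_top" using \<rho> by real_asymp
    from filterlim_compose[OF this rinf] show "(\<lambda>k. (1 + ln (r k)) / (r k powr \<rho>2 / 2)) \<longlonglongrightarrow> 0" .
  qed (use r1(2) in \<open>auto intro!: always_eventually add_nonneg_nonneg\<close>)
  have Tinf: "filterlim T at_top sequentially"
  proof (rule filterlim_at_top_mono)
    have "filterlim (\<lambda>x::real. x powr \<rho>2 / 2) at_top at_top" using \<rho> by real_asymp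
    from filterlim_compose[OF this rinf] show "filterlim (\<lambda>k. r k powr \<rho>2 / 2) at_top sequentially" .
    show "eventually (\<lambda>k. r k powr \<rho>2 / 2 \<le> T k) sequentially"
    proof (intro always_eventually allI)
      fix k show "r k powr \<rho>2 / 2 \<le> T k" using Tr[of k] by simp
    qed
  qed
  have reg: "characteristic (100 * r k) v \<le> (2 * C + D) * T k" for k
  proof -
    have "characteristic (100 * r k) v \<le> characteristic (1000 * r k) v"
      using r1(2)[of k] by (intro characteristic_mono[OF vm(1)]) auto
    also have "\<dots> \<le> characteristic (1000 * r k) f + D" using D[of "1000 * r k"] r1(2)[of k] by (simp add: abs_le_iff)
    also have "\<dots> \<le> 2 * C * T k + D * T k"
      using Cf[of k] D0 T1[of k] mult_left_mono[of 1 "T k" D] by simp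
    finally show ?thesis by (simp add: distrib_right)
  qed
  show ?thesis
    by (rule that[OF r1(1) rinf T1[unfolded T_def] Tinf[unfolded T_def] reg[unfolded T_def]
        Nlim[OF vm(1) N1, unfolded T_def] Nlim[OF vm(2) N2, unfolded T_def] slim[unfolded T_def] lnlim[unfolded T_def]])
qed

section \<open>Small functions and circle means along the scales\<close>

lemma mean_abs_log_small:
  fixes r T :: "nat \<Rightarrow> real"
  assumes u: "nonzero_mero u" and r: "\<And>k. r k \<ge> 1" and T: "filterlim T at_top sequentially" "\<And>k. T k > 0"
    and small: "(\<lambda>k. characteristic (r k) u / T k) \<longlonglongrightarrow> 0"
  shows "(\<lambda>k. \<integral>t. \<bar>ln (norm (u (of_real (r k) * cis t)))\<bar> / T k \<partial>circ) \<longlonglongrightarrow> 0"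
proof (rule Lim_null_comparison)
  show "eventually (\<lambda>k. norm (\<integral>t. \<bar>ln (norm (u (of_real (r k) * cis t)))\<bar> / T k \<partial>circ) \<le>
      2 * (characteristic (r k) u / T k) - Jensen_const u / T k) sequentially"
  proof (intro always_eventually allI)
    fix k
    have "(\<integral>t. \<bar>ln (norm (u (of_real (r k) * cis t)))\<bar> / T k \<partial>circ) \<le> (2 * characteristic (r k) u - Jensen_const u) / T k"
      using mean_abs_log_le[OF u r[of k]] T(2)[of k] by (simp add: divide_right_mono)
    moreover have "(\<integral>t. \<bar>ln (norm (u (of_real (r k) * cis t)))\<bar> / T k \<partial>circ) \<ge> 0"
      by (rule integral_nonneg_AE) (use T(2)[of k] in auto)
    ultimately show "norm (\<integral>t. \<bar>ln (norm (u (of_real (r k) * cis t)))\<bar> / T k \<partial>circ) \<le>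
      2 * (characteristic (r k) u / T k) - Jensen_const u / T k" by (simp add: diff_divide_distrib)
  qed
  have "(\<lambda>k. 2 * (characteristic (r k) u / T k) - Jensen_const u / T k) \<longlonglongrightarrow> 2 * 0 - 0"
    by (intro tendsto_diff tendsto_mult tendsto_const small const_over_T T(1))
  thus "(\<lambda>k. 2 * (characteristic (r k) u / T k) - Jensen_const u / T k) \<longlonglongrightarrow> 0" by simp
qed

text \<open>Convergence to 0 in mean gives convergence almost everywhere along a subsequence.
  Summing over \<open>U\<close> first yields one subsequence for the whole family.\<close>

lemma AE_log_small_subseq:
  fixes r T :: "nat \<Rightarrow> real"
  assumes U: "finite U" "\<And>u. u \<in> U \<Longrightarrow> nonzero_mero u"
    and r: "\<And>k. r k \<ge> 1" and T: "filterlim T at_top sequentially" "\<And>k. T k > 0"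
    and small: "\<And>u. u \<in> U \<Longrightarrow> (\<lambda>k. characteristic (r k) u / T k) \<longlonglongrightarrow> 0"
  obtains \<psi> :: "nat \<Rightarrow> nat" where "strict_mono \<psi>"
    "\<And>u. u \<in> U \<Longrightarrow> AE t in circ. (\<lambda>k. ln (norm (u (of_real (r (\<psi> k)) * cis t))) / T (\<psi> k)) \<longlonglongrightarrow> 0"
proof -
  define d where "d = (\<lambda>k t. \<Sum>u\<in>U. \<bar>ln (norm (u (of_real (r k) * cis t)))\<bar> / T k)"
  have r0: "r k > 0" for k using r[of k] by linarith
  have I: "integrable circ (\<lambda>t. \<bar>ln (norm (u (of_real (r k) * cis t)))\<bar> / T k)" if "u \<in> U" for u k
    using Jensen(1)[OF U(2)[OF that] r0[of k]] by auto
  have dI: "integrable circ (d k)" for k unfolding d_def using I by (intro Bochner_Integration.integrable_sum)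
  have d0: "norm (d k t) = d k t" for k t
    unfolding d_def using T(2)[of k] by (simp add: sum_nonneg)
  have "(\<lambda>k. \<Sum>u\<in>U. \<integral>t. \<bar>ln (norm (u (of_real (r k) * cis t)))\<bar> / T k \<partial>circ) \<longlonglongrightarrow> (\<Sum>u\<in>U. 0)"
    by (intro tendsto_sum mean_abs_log_small U r T small)
  moreover have "(\<integral>t. norm (d k t) \<partial>circ) = (\<Sum>u\<in>U. \<integral>t. \<bar>ln (norm (u (of_real (r k) * cis t)))\<bar> / T k \<partial>circ)" for k
    unfolding d0 unfolding d_def using I by (rule Bochner_Integration.integral_sum)
  ultimately have "(\<lambda>k. \<integral>t. norm (d k t) \<partial>circ) \<longlonglongrightarrow> 0" by simp
  then obtain \<psi> where \<psi>: "strict_mono \<psi>" and ae: "AE t in circ. (\<lambda>k. d (\<psi> k) t) \<longlonglongrightarrow> 0"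
    using tendsto_L1_AE_subseq[of circ d] dI by blast
  show ?thesis
  proof (rule that[OF \<psi>])
    fix u assume u: "u \<in> U"
    show "AE t in circ. (\<lambda>k. ln (norm (u (of_real (r (\<psi> k)) * cis t))) / T (\<psi> k)) \<longlonglongrightarrow> 0"
      using ae
    proof eventually_elim
      case (elim t)
      show ?case
      proof (rule Lim_null_comparison[OF _ elim], intro always_eventually allI)
        fix k
        have "norm (ln (norm (u (of_real (r (\<psi> k)) * cis t))) / T (\<psi> k)) = \<bar>ln (norm (u (of_real (r (\<psi> k)) * cis t)))\<bar> / T (\<psi> k)"
          using T(2)[of "\<psi> k"] by simp
        also have "\<dots> \<le> d (\<psi> k) t" unfolding d_def
          by (rule member_le_sum[OF u _ U(1)]) (use T(2)[of "\<psi> k"] in auto)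
        finally show "norm (ln (norm (u (of_real (r (\<psi> k)) * cis t))) / T (\<psi> k)) \<le> d (\<psi> k) t" .
      qed
    qed
  qed
qed

text \<open>Boundedness of T(10 r_k, F) / T_k yields the mean square bound, so the almost everywhere
  limit of ln |F| / T_k determines both sides of interest: the Jensen mean and the proximity
  function.\<close>

lemma mean_log_limit:
  fixes r T :: "nat \<Rightarrow> real"
  assumes F: "nonzero_mero F" and r: "\<And>k. r k \<ge> 1" and T: "\<And>k. T k \<ge> 1"
    and bd: "\<And>k. characteristic (10 * r k) F \<le> C * T k"
    and G: "G \<in> borel_measurable borel" "\<And>t. \<bar>G t\<bar> \<le> b"
    and lim: "AE t in circ. (\<lambda>k. ln (norm (F (of_real (r k) * cis t))) / T k) \<longlonglongrightarrow> G t"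
  shows "(\<lambda>k. (Jensen_const F + int_pole_count (r k) (\<lambda>z. 1 / F z) - int_pole_count (r k) F) / T k) \<longlonglongrightarrow> (\<integral>t. G t \<partial>circ)"
    and "(\<lambda>k. proximity (r k) F / T k) \<longlonglongrightarrow> (\<integral>t. max 0 (G t) \<partial>circ)"
proof -
  define x where "x = (\<lambda>k t. ln (norm (F (of_real (r k) * cis t))) / T k)"
  have T0: "T k > 0" for k using T[of k] by linarith
  have r0: "r k > 0" for k using r[of k] by linarith
  obtain K where K: "K > 0" and L2: "\<And>f r \<eta>. nonzero_mero f \<Longrightarrow> r \<ge> 1 \<Longrightarrow> norm \<eta> \<le> r \<Longrightarrow>
     integrable circ (\<lambda>t. ln (norm (f (of_real r * cis t + \<eta>)))) \<and>
     integrable circ (\<lambda>t. (ln (norm (f (of_real r * cis t + \<eta>))))\<^sup>2) \<and>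
     (\<integral>t. (ln (norm (f (of_real r * cis t + \<eta>))))\<^sup>2 \<partial>circ) \<le> K * (two_sided (10 * r) f)\<^sup>2"
    using log_square_bound by blast
  have L2': "integrable circ (\<lambda>t. (ln (norm (F (of_real (r k) * cis t))))\<^sup>2)"
     "(\<integral>t. (ln (norm (F (of_real (r k) * cis t))))\<^sup>2 \<partial>circ) \<le> K * (two_sided (10 * r k) F)\<^sup>2" for k
    using L2[OF F r[of k], of 0] r0[of k] by auto
  define B where "B = K * (2 * C + \<bar>Jensen_const F\<bar>)\<^sup>2"
  have I: "integrable circ (x k)" for k unfolding x_def using Jensen(1)[OF F r0[of k]] by auto
  have I2: "integrable circ (\<lambda>t. (x k t)\<^sup>2)" for k unfolding x_def power_divide using L2'(1) by auto
  have B: "(\<integral>t. (x k t)\<^sup>2 \<partial>circ) \<le> B" for k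
  proof -
    have ts0: "two_sided (10 * r k) F \<ge> 0" by (rule two_sided_bounds(2)[OF F]) (use r[of k] in simp)
    have "\<bar>Jensen_const F\<bar> * 1 \<le> \<bar>Jensen_const F\<bar> * T k" using T[of k] by (intro mult_left_mono) auto
    hence ts: "two_sided (10 * r k) F \<le> (2 * C + \<bar>Jensen_const F\<bar>) * T k"
      using bd[of k] unfolding two_sided_def distrib_right by linarith
    have "(\<integral>t. (x k t)\<^sup>2 \<partial>circ) = (\<integral>t. (ln (norm (F (of_real (r k) * cis t))))\<^sup>2 \<partial>circ) / (T k)\<^sup>2"
      unfolding x_def power_divide by simp
    also have "\<dots> \<le> K * (two_sided (10 * r k) F)\<^sup>2 / (T k)\<^sup>2" by (intro divide_right_mono L2') auto
    also have "\<dots> \<le> K * ((2 * C + \<bar>Jensen_const F\<bar>) * T k)\<^sup>2 / (T k)\<^sup>2"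
      using K ts ts0 by (intro divide_right_mono mult_left_mono power_mono) auto
    also have "\<dots> = B" using T0[of k] by (simp add: B_def power_mult_distrib)
    finally show ?thesis .
  qed
  have xm: "x k \<in> borel_measurable borel" for k
    unfolding x_def using mero_circ_measurable[OF nonzero_mero_D(1)[OF F], of "r k" 0] by simp
  have lim': "AE t in circ. (\<lambda>k. x k t) \<longlonglongrightarrow> G t" using lim by (simp add: x_def)
  have IG: "integrable circ G" by (rule circ_integrable_bounded[OF G(1), of b]) (use G(2) in auto)
  have conv: "(\<lambda>k. \<integral>t. \<psi> (x k t) \<partial>circ) \<longlonglongrightarrow> (\<integral>t. \<psi> (G t) \<partial>circ)"
    if "\<And>u v. \<bar>\<psi> u - \<psi> v\<bar> \<le> \<bar>u - v\<bar>" "\<psi> \<in> borel_measurable borel" for \<psi>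
    by (rule L1_limit_imp[OF I IG L1_limit_of_L2_bounded[OF xm G I2 B lim'] that])
  have "(\<lambda>k. \<integral>t. x k t \<partial>circ) \<longlonglongrightarrow> (\<integral>t. G t \<partial>circ)" by (rule conv[of "\<lambda>u. u"]) auto
  moreover have "(\<integral>t. x k t \<partial>circ) = (Jensen_const F + int_pole_count (r k) (\<lambda>z. 1 / F z) - int_pole_count (r k) F) / T k" for k
    unfolding x_def using Jensen(2)[OF F r0[of k]] by simp
  ultimately show "(\<lambda>k. (Jensen_const F + int_pole_count (r k) (\<lambda>z. 1 / F z) - int_pole_count (r k) F) / T k) \<longlonglongrightarrow> (\<integral>t. G t \<partial>circ)"
    by simp
  have "(\<lambda>k. \<integral>t. max 0 (x k t) \<partial>circ) \<longlonglongrightarrow> (\<integral>t. max 0 (G t) \<partial>circ)" by (rule conv) auto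
  moreover have "(\<integral>t. max 0 (x k t) \<partial>circ) = proximity (r k) F / T k" for k
  proof -
    have "max 0 (x k t) = log_plus (norm (F (of_real (r k) * cis t))) / T k" for t
      using T0[of k] by (simp add: x_def log_plus_eq max_def divide_nonneg_pos zero_le_divide_iff)
    thus ?thesis using proximity_eq(2)[OF nonzero_mero_D(1)[OF F] r0[of k]] by simp
  qed
  ultimately show "(\<lambda>k. proximity (r k) F / T k) \<longlonglongrightarrow> (\<integral>t. max 0 (G t) \<partial>circ)" by simp
qed

lemma difference_product_characteristic:
  assumes f: "nonzero_mero f" and s: "s meromorphic_on UNIV"
  obtains D where "D \<ge> 0" "\<And>r. r \<ge> 1 \<Longrightarrow> r \<ge> norm \<eta> \<Longrightarrow>
    characteristic r (\<lambda>z. f z ^ n * f (z + \<eta>) - s z) \<le> D * (characteristic (10 * r) f + characteristic r s + 1 + ln r)"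
proof -
  note fm = nonzero_mero_D(1)[OF f]
  obtain D where D: "D \<ge> 0" "\<And>r. r \<ge> 1 \<Longrightarrow> r \<ge> norm \<eta> \<Longrightarrow>
    characteristic r (\<lambda>z. f (z + \<eta>)) \<le> D * (characteristic (10 * r) f + 1 + ln r)"
    using characteristic_shift[OF f] by blast
  show ?thesis
  proof (rule that[of "D + n + 1 + (log_plus 1 + ln 2)"])
    have l2: "0 \<le> log_plus 1 + ln 2" by (intro add_nonneg_nonneg) auto
    thus "D + n + 1 + (log_plus 1 + ln 2) \<ge> 0" using D(1) by simp
    fix r :: real assume r: "r \<ge> 1" "r \<ge> norm \<eta>"
    define X where "X = characteristic (10 * r) f + characteristic r s + 1 + ln r"
    have l0: "ln r \<ge> 0" using r by simp
    have pos: "characteristic r s \<ge> 0" "characteristic (10 * r) f \<ge> 0"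
      using characteristic_nonneg[OF s r(1)] characteristic_nonneg[OF fm, of "10 * r"] r by auto
    have fn: "(\<lambda>z. f z ^ n) meromorphic_on UNIV" by (intro meromorphic_intros fm)
    have fs: "(\<lambda>z. f (z + \<eta>)) meromorphic_on UNIV" by (rule mero_shift[OF fm])
    have ns: "(\<lambda>z. (- 1) * s z) meromorphic_on UNIV" by (intro meromorphic_intros s)
    have X: "characteristic r s \<le> X" "characteristic r f \<le> X" "characteristic (10 * r) f + 1 + ln r \<le> X" "1 \<le> X"
    proof -
      have "characteristic r f \<le> characteristic (10 * r) f" by (rule characteristic_mono[OF fm]) (use r in auto)
      thus "characteristic r f \<le> X" using l0 pos unfolding X_def by linarith
    qed (use l0 pos in \<open>simp_all add: X_def\<close>)
    have 1: "characteristic r (\<lambda>z. f z ^ n * f (z + \<eta>)) \<le> n * X + D * X"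
    proof (rule order_trans[OF characteristic_mult[OF fn fs r(1)] add_mono])
      show "characteristic r (\<lambda>z. f z ^ n) \<le> n * X"
        unfolding characteristic_power[OF f r(1)] by (rule mult_left_mono[OF X(2)]) simp
      show "characteristic r (\<lambda>z. f (z + \<eta>)) \<le> D * X"
        by (rule order_trans[OF D(2)[OF r] mult_left_mono[OF X(3) D(1)]])
    qed
    have 2: "characteristic r (\<lambda>z. (- 1) * s z) \<le> X + log_plus 1"
      using characteristic_cmult_le[OF s r(1), of "-1"] X(1) by simp
    have 3: "log_plus 1 + ln 2 \<le> (log_plus 1 + ln 2) * X"
      using mult_left_mono[OF X(4) l2] by simp
    have "characteristic r (\<lambda>z. f z ^ n * f (z + \<eta>) + (- 1) * s z) \<le> (n * X + D * X) + (X + log_plus 1) + ln 2"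
      by (rule order_trans[OF characteristic_add[OF _ ns r(1)]])
         (intro meromorphic_intros fn fs add_mono 1 2 order_refl)+
    also have "\<dots> = (n * X + D * X + X) + (log_plus 1 + ln 2)" by simp
    also have "\<dots> \<le> (n * X + D * X + X) + (log_plus 1 + ln 2) * X" by (rule add_left_mono[OF 3])
    finally have "characteristic r (\<lambda>z. f z ^ n * f (z + \<eta>) + (- 1) * s z) \<le> D * X + n * X + X + (log_plus 1 + ln 2) * X"
      by (simp only: add_ac)
    thus "characteristic r (\<lambda>z. f z ^ n * f (z + \<eta>) - s z) \<le>
      (D + n + 1 + (log_plus 1 + ln 2)) * (characteristic (10 * r) f + characteristic r s + 1 + ln r)"
      unfolding X_def[symmetric] by (simp add: distrib_right)
  qed
qed

subsection \<open>Zeros of the difference product\<close>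

lemma bounded_of_ratio_null:
  fixes y T :: "nat \<Rightarrow> real"
  assumes "(\<lambda>k. y k / T k) \<longlonglongrightarrow> 0" "\<And>k. T k > 0"
  obtains K where "K \<ge> 0" "\<And>k. y k \<le> K * T k"
proof -
  have "Bseq (\<lambda>k. y k / T k)" using assms(1) by (intro convergent_imp_Bseq convergentI)
  then obtain K where K: "K > 0" "\<And>k. norm (y k / T k) \<le> K" by (auto elim: BseqE)
  show ?thesis
  proof (rule that[of K])
    show "K \<ge> 0" using K by simp
    show "y k \<le> K * T k" for k
    proof -
      have "y k / T k \<le> K" using K(2)[of k] abs_ge_self[of "y k / T k"] by (simp only: real_norm_def)
      thus ?thesis using assms(2)[of k] by (simp add: divide_le_eq)
    qed
  qed
qed

text \<open>All asymptotic information is collected along a single sequence, obtained from the good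
  scales by two successive subsequences: one for the limit of \<open>v\<close>, one for the
  functions in \<open>U\<close>. The family \<open>U\<close> is meant for \<open>s\<close> and for
  the differences c^(n+1) - s, whose characteristics exceed that of \<open>s\<close> by a bounded
  amount.\<close>

lemma scaling_limit:
  assumes f: "f meromorphic_on UNIV" and v: "nonzero_mero v"
    and D: "\<And>r. r \<ge> 1 \<Longrightarrow> \<bar>characteristic r v - characteristic r f\<bar> \<le> D"
    and fin: "growth_order f < \<infinity>"
    and g1: "growth_exponent (\<lambda>r. int_pole_count r v) < growth_order f"
    and g2: "growth_exponent (\<lambda>r. int_pole_count r (\<lambda>z. 1 / v z)) < growth_order f"
    and s: "small_function s f"
    and U: "finite U" "\<And>u. u \<in> U \<Longrightarrow> nonzero_mero u"
    and Us: "\<And>u r. u \<in> U \<Longrightarrow> r \<ge> 1 \<Longrightarrow> characteristic r u \<le> characteristic r s + M"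
  obtains r T :: "nat \<Rightarrow> real" and C :: real and H :: "real \<Rightarrow> real" and b :: real where
    "\<And>k. r k \<ge> 1" "\<And>k. r k \<ge> norm (\<eta>::complex)" "\<And>k. T k = characteristic (r k) v" "\<And>k. T k \<ge> 1"
    "filterlim T at_top sequentially" "C \<ge> 0"
    "\<And>k. characteristic (100 * r k) v \<le> C * T k"
    "(\<lambda>k. int_pole_count (10 * r k) v / T k) \<longlonglongrightarrow> 0"
    "(\<lambda>k. characteristic (10 * r k) s / T k) \<longlonglongrightarrow> 0"
    "(\<lambda>k. (1 + ln (r k)) / T k) \<longlonglongrightarrow> 0"
    "H \<in> borel_measurable borel" "\<And>t. \<bar>H t\<bar> \<le> b" "AE t in circ. H t \<noteq> 0"
    "(\<integral>t. max 0 (H t) \<partial>circ) = 1" "(\<integral>t. H t \<partial>circ) = 0"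
    "AE t in circ. (\<lambda>k. ln (norm (v (of_real (r k) * cis t))) / T k) \<longlonglongrightarrow> H t"
    "AE t in circ. (\<lambda>k. ln (norm (v (of_real (r k) * cis t + \<eta>))) / T k) \<longlonglongrightarrow> H t"
    "(\<lambda>k. proximity (r k) (\<lambda>z. v (z + \<eta>)) / T k) \<longlonglongrightarrow> 1"
    "\<And>u. u \<in> U \<Longrightarrow> AE t in circ. (\<lambda>k. ln (norm (u (of_real (r k) * cis t))) / T k) \<longlonglongrightarrow> 0"
proof -
  note vm = nonzero_mero_D(1)[OF v] nonzero_mero_D(1)[OF nonzero_mero_inverse[OF v]]
  have sm: "s meromorphic_on UNIV" using s by (simp add: small_function_def)
  obtain r0 C0 where r0: "\<And>k. r0 k \<ge> max 1 (norm \<eta>)" "filterlim r0 at_top sequentially"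
    "\<And>k. characteristic (r0 k) v \<ge> 1" "filterlim (\<lambda>k. characteristic (r0 k) v) at_top sequentially"
    "\<And>k. characteristic (100 * r0 k) v \<le> C0 * characteristic (r0 k) v"
    "(\<lambda>k. int_pole_count (10 * r0 k) v / characteristic (r0 k) v) \<longlonglongrightarrow> 0"
    "(\<lambda>k. int_pole_count (10 * r0 k) (\<lambda>z. 1 / v z) / characteristic (r0 k) v) \<longlonglongrightarrow> 0"
    "(\<lambda>k. characteristic (10 * r0 k) s / characteristic (r0 k) v) \<longlonglongrightarrow> 0"
    "(\<lambda>k. (1 + ln (r0 k)) / characteristic (r0 k) v) \<longlonglongrightarrow> 0"
    by (rule good_scales[OF f v D fin g1 g2 s, of \<eta>]) auto
  have r0': "\<And>k. r0 k \<ge> 1" "\<And>k. norm \<eta> \<le> r0 k" using r0(1) by auto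
  define T0 where "T0 = (\<lambda>k. characteristic (r0 k) v)"
  have T0: "\<And>k. T0 k \<ge> 1" "\<And>k. T0 k > 0" using r0(3) by (auto simp: T0_def intro: less_le_trans[OF zero_less_one])
  have two: "two_sided (10 * r0 k) v \<le> (2 * C0 + \<bar>Jensen_const v\<bar>) * T0 k" for k
  proof -
    have "characteristic (10 * r0 k) v \<le> characteristic (100 * r0 k) v"
      using r0'(1)[of k] by (intro characteristic_mono[OF vm(1)]) auto
    moreover have "\<bar>Jensen_const v\<bar> * 1 \<le> \<bar>Jensen_const v\<bar> * T0 k" using T0(1)[of k] by (intro mult_left_mono) auto
    ultimately have "two_sided (10 * r0 k) v \<le> 2 * (C0 * T0 k) + \<bar>Jensen_const v\<bar> * T0 k"
      using r0(5)[of k] unfolding two_sided_def T0_def by linarith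
    thus ?thesis by (simp add: distrib_right)
  qed
  have N: "(\<lambda>k. (int_pole_count (10 * r0 k) v + int_pole_count (10 * r0 k) (\<lambda>z. 1 / v z)) / T0 k) \<longlonglongrightarrow> 0"
    using tendsto_add[OF r0(6,7)] by (simp add: T0_def add_divide_distrib)
  have T0eq: "T0 k = characteristic (r0 k) v" for k by (simp add: T0_def)
  have T0inf: "filterlim T0 at_top sequentially" using r0(4) by (simp add: T0_def)
  obtain \<phi> H b where \<phi>: "strict_mono \<phi>" and H: "H \<in> borel_measurable borel" "\<And>t. \<bar>H t\<bar> \<le> b"
    "AE t in circ. (\<lambda>k. ln (norm (v (of_real (r0 (\<phi> k)) * cis t))) / T0 (\<phi> k)) \<longlonglongrightarrow> H t"
    "AE t in circ. (\<lambda>k. ln (norm (v (of_real (r0 (\<phi> k)) * cis t + \<eta>))) / T0 (\<phi> k)) \<longlonglongrightarrow> H t"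
    "AE t in circ. H t \<noteq> 0" "(\<integral>t. max 0 (H t) \<partial>circ) = 1" "(\<integral>t. H t \<partial>circ) = 0"
    "(\<lambda>k. proximity (r0 (\<phi> k)) (\<lambda>z. v (z + \<eta>)) / T0 (\<phi> k)) \<longlonglongrightarrow> 1"
  proof -
    show thesis
      by (rule log_limit[OF v r0' r0(2) T0eq T0(2) T0inf two N]) (assumption | fact that)+
  qed
  have usm: "(\<lambda>k. characteristic (r0 (\<phi> k)) u / T0 (\<phi> k)) \<longlonglongrightarrow> 0" if u: "u \<in> U" for u
  proof -
    have "(\<lambda>k. characteristic (r0 k) u / T0 k) \<longlonglongrightarrow> 0"
    proof (rule Lim_null_comparison)
      show "eventually (\<lambda>k. norm (characteristic (r0 k) u / T0 k) \<le> characteristic (10 * r0 k) s / T0 k + M / T0 k) sequentially"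
      proof (intro always_eventually allI)
        fix k
        have "characteristic (r0 k) u \<le> characteristic (r0 k) s + M" by (rule Us[OF u r0'(1)])
        also have "characteristic (r0 k) s \<le> characteristic (10 * r0 k) s"
          using r0'(1)[of k] by (intro characteristic_mono[OF sm]) auto
        finally have "characteristic (r0 k) u / T0 k \<le> (characteristic (10 * r0 k) s + M) / T0 k"
          using T0(2)[of k] by (intro divide_right_mono) auto
        moreover have "characteristic (r0 k) u \<ge> 0"
          by (rule characteristic_nonneg[OF nonzero_mero_D(1)[OF U(2)[OF u]] r0'(1)])
        ultimately show "norm (characteristic (r0 k) u / T0 k) \<le> characteristic (10 * r0 k) s / T0 k + M / T0 k"
          using T0(2)[of k] by (simp add: add_divide_distrib)
      qed
      show "(\<lambda>k. characteristic (10 * r0 k) s / T0 k + M / T0 k) \<longlonglongrightarrow> 0"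
        using tendsto_add[OF r0(8)[folded T0eq] const_over_T[OF T0inf, of M]] by simp
    qed
    from LIMSEQ_subseq_LIMSEQ[OF this \<phi>] show ?thesis by (simp add: o_def)
  qed
  have T\<phi>: "filterlim (\<lambda>k. T0 (\<phi> k)) at_top sequentially"
    using filterlim_compose[OF T0inf filterlim_subseq[OF \<phi>]] .
  obtain \<psi> where \<psi>: "strict_mono \<psi>"
    and ae: "\<And>u. u \<in> U \<Longrightarrow> AE t in circ. (\<lambda>k. ln (norm (u (of_real (r0 (\<phi> (\<psi> k))) * cis t))) / T0 (\<phi> (\<psi> k))) \<longlonglongrightarrow> 0"
    using AE_log_small_subseq[OF U r0'(1) T\<phi> T0(2) usm] by blast
  define \<omega> where "\<omega> = (\<lambda>k. \<phi> (\<psi> k))"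
  have \<omega>: "strict_mono \<omega>" using strict_mono_o[OF \<phi> \<psi>] by (simp add: \<omega>_def o_def)
  have sub: "(\<lambda>k. a (\<omega> k)) \<longlonglongrightarrow> l" if "a \<longlonglongrightarrow> l" for a :: "nat \<Rightarrow> real" and l
    using LIMSEQ_subseq_LIMSEQ[OF that \<omega>] by (simp add: o_def)
  have sub2: "(\<lambda>k. a (\<omega> k)) \<longlonglongrightarrow> l" if "(\<lambda>k. a (\<phi> k)) \<longlonglongrightarrow> l" for a :: "nat \<Rightarrow> real" and l
    using LIMSEQ_subseq_LIMSEQ[OF that \<psi>] by (simp add: o_def \<omega>_def)
  have AEsub: "AE t in circ. (\<lambda>k. a (\<omega> k) t) \<longlonglongrightarrow> H t" if "AE t in circ. (\<lambda>k. a (\<phi> k) t) \<longlonglongrightarrow> H t"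
    for a :: "nat \<Rightarrow> real \<Rightarrow> real"
    using that by eventually_elim (rule sub2)
  show ?thesis
  proof (rule that[of "\<lambda>k. r0 (\<omega> k)" "\<lambda>k. T0 (\<omega> k)" "max 0 C0" H b])
    show "filterlim (\<lambda>k. T0 (\<omega> k)) at_top sequentially"
      using filterlim_compose[OF T0inf filterlim_subseq[OF \<omega>]] .
    show "characteristic (100 * r0 (\<omega> k)) v \<le> max 0 C0 * T0 (\<omega> k)" for k
    proof -
      have "C0 * T0 (\<omega> k) \<le> max 0 C0 * T0 (\<omega> k)" using T0(2)[of "\<omega> k"] by (intro mult_right_mono) auto
      thus ?thesis using r0(5)[of "\<omega> k"] unfolding T0_def by linarith
    qed
    show "(\<lambda>k. int_pole_count (10 * r0 (\<omega> k)) v / T0 (\<omega> k)) \<longlonglongrightarrow> 0"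
      using sub[OF r0(6)] by (simp add: T0_def)
    show "(\<lambda>k. characteristic (10 * r0 (\<omega> k)) s / T0 (\<omega> k)) \<longlonglongrightarrow> 0"
      using sub[OF r0(8)] by (simp add: T0_def)
    show "(\<lambda>k. (1 + ln (r0 (\<omega> k))) / T0 (\<omega> k)) \<longlonglongrightarrow> 0"
      using sub[OF r0(9)] by (simp add: T0_def)
    show "AE t in circ. (\<lambda>k. ln (norm (v (of_real (r0 (\<omega> k)) * cis t))) / T0 (\<omega> k)) \<longlonglongrightarrow> H t"
      by (rule AEsub[where a = "\<lambda>k t. ln (norm (v (of_real (r0 k) * cis t))) / T0 k", OF H(3)])
    show "AE t in circ. (\<lambda>k. ln (norm (v (of_real (r0 (\<omega> k)) * cis t + \<eta>))) / T0 (\<omega> k)) \<longlonglongrightarrow> H t"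
      by (rule AEsub[where a = "\<lambda>k t. ln (norm (v (of_real (r0 k) * cis t + \<eta>))) / T0 k", OF H(4)])
    show "(\<lambda>k. proximity (r0 (\<omega> k)) (\<lambda>z. v (z + \<eta>)) / T0 (\<omega> k)) \<longlonglongrightarrow> 1"
      by (rule sub2[where a = "\<lambda>k. proximity (r0 k) (\<lambda>z. v (z + \<eta>)) / T0 k", OF H(8)])
    show "AE t in circ. (\<lambda>k. ln (norm (u (of_real (r0 (\<omega> k)) * cis t))) / T0 (\<omega> k)) \<longlonglongrightarrow> 0" if "u \<in> U" for u
      using ae[OF that] by (simp add: \<omega>_def)
  qed (use r0' T0 T0eq H in auto)
qed

lemma AE_circ_False: "\<not> (AE t in circ. False)"
proof
  assume *: "AE t in circ. False"
  have "(\<integral>t. 1 \<partial>circ) = (\<integral>t. 0 \<partial>circ :: real)"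
    by (rule integral_cong_AE) (use * in auto)
  thus False by simp
qed

lemma finite_zeros_int_pole_count:
  assumes F: "nonzero_mero F" and fin: "finite {z. isolated_zero F z}"
  obtains C where "C \<ge> 0" "\<And>r. r \<ge> 1 \<Longrightarrow> int_pole_count r (\<lambda>z. 1 / F z) \<le> C * (1 + ln r)"
proof -
  have m: "(\<lambda>z. 1 / F z) meromorphic_on UNIV" by (rule nonzero_mero_D(1)[OF nonzero_mero_inverse[OF F]])
  have "finite {z. is_pole (\<lambda>z. 1 / F z) z}"
    using fin is_pole_inverse_iff[of F] by (simp add: inverse_eq_divide)
  from int_pole_count_finite_poles[OF m this] that show ?thesis by blast
qed

text \<open>Mean square bounds for the difference product at r_k involve its characteristic at 10
  r_k, and the shift costs another factor 10; this is why regularity of T is provided up to 100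
  r_k.\<close>

lemma difference_product_regular:
  fixes r T :: "nat \<Rightarrow> real"
  assumes f: "nonzero_mero f" and v: "nonzero_mero v" and s: "s meromorphic_on UNIV"
    and D: "\<And>r. r \<ge> 1 \<Longrightarrow> \<bar>characteristic r v - characteristic r f\<bar> \<le> D"
    and r: "\<And>k. r k \<ge> 1" "\<And>k. r k \<ge> norm \<eta>" and T: "\<And>k. T k \<ge> 1"
    and C: "\<And>k. characteristic (100 * r k) v \<le> C * T k"
    and sT: "(\<lambda>k. characteristic (10 * r k) s / T k) \<longlonglongrightarrow> 0" and lT: "(\<lambda>k. (1 + ln (r k)) / T k) \<longlonglongrightarrow> 0"
  obtains C' where "\<And>k. characteristic (10 * r k) (\<lambda>z. f z ^ n * f (z + \<eta>) - s z) \<le> C' * T k"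
proof -
  have T0: "T k > 0" for k using T[of k] by linarith
  obtain D' where D': "D' \<ge> 0" "\<And>r. r \<ge> 1 \<Longrightarrow> r \<ge> norm \<eta> \<Longrightarrow>
    characteristic r (\<lambda>z. f z ^ n * f (z + \<eta>) - s z) \<le> D' * (characteristic (10 * r) f + characteristic r s + 1 + ln r)"
    using difference_product_characteristic[OF f s] by blast
  obtain K1 where K1: "\<And>k. characteristic (10 * r k) s \<le> K1 * T k" using bounded_of_ratio_null[OF sT T0] by blast
  obtain K2 where K2: "\<And>k. 1 + ln (r k) \<le> K2 * T k" using bounded_of_ratio_null[OF lT T0] by blast
  have D0: "D \<ge> 0" using D[of 1] by linarith
  show ?thesis
  proof (rule that[of "D' * (C + D + K1 + K2 + ln 10)"])
    fix k
    have r10: "10 * r k \<ge> 1" "10 * r k \<ge> norm \<eta>" using r(1)[of k] r(2)[of k] by auto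
    have "characteristic (10 * (10 * r k)) f \<le> characteristic (100 * r k) v + D"
      using D[of "100 * r k"] r(1)[of k] by (simp add: abs_le_iff)
    also have "\<dots> \<le> C * T k + D * T k" using C[of k] mult_left_mono[OF T[of k] D0] by linarith
    finally have 1: "characteristic (10 * (10 * r k)) f \<le> C * T k + D * T k" .
    have "1 + ln (10 * r k) = 1 + ln (r k) + ln 10" using r(1)[of k] by (simp add: ln_mult_pos)
    moreover have "ln 10 * 1 \<le> ln 10 * T k" using T[of k] by (intro mult_left_mono) auto
    ultimately have 2: "1 + ln (10 * r k) \<le> K2 * T k + ln 10 * T k" using K2[of k] by linarith
    have "characteristic (10 * (10 * r k)) f + characteristic (10 * r k) s + 1 + ln (10 * r k) \<le> (C + D + K1 + K2 + ln 10) * T k"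
      unfolding distrib_right using 1 2 K1[of k] by linarith
    hence "D' * (characteristic (10 * (10 * r k)) f + characteristic (10 * r k) s + 1 + ln (10 * r k)) \<le> D' * ((C + D + K1 + K2 + ln 10) * T k)"
      by (rule mult_left_mono[OF _ D'(1)])
    thus "characteristic (10 * r k) (\<lambda>z. f z ^ n * f (z + \<eta>) - s z) \<le> D' * (C + D + K1 + K2 + ln 10) * T k"
      using D'(2)[OF r10] by (simp only: mult.assoc)
  qed
qed

lemma characteristic_const_minus_le:
  assumes s: "s meromorphic_on UNIV" and r: "r \<ge> 1"
  shows "characteristic r (\<lambda>z. c - s z) \<le> characteristic r s + (log_plus 1 + log_plus (norm c) + ln 2)"
proof -
  have ns: "(\<lambda>z. (- 1) * s z) meromorphic_on UNIV" by (intro meromorphic_intros s)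
  have "characteristic r (\<lambda>z. (- 1) * s z + c) \<le> characteristic r (\<lambda>z. (- 1) * s z) + log_plus (norm c) + ln 2"
    by (rule characteristic_add_const_le[OF ns r])
  thus ?thesis using characteristic_cmult_le[OF s r, of "-1"] by (simp add: add.commute)
qed

lemma AE_nonzero_on_circles:
  assumes u: "nonzero_mero u" and r: "\<And>k::nat. r k \<ge> (1::real)"
  shows "AE t in circ. \<forall>k. u (of_real (r k) * cis t + \<eta>) \<noteq> 0"
  unfolding AE_all_countable
proof
  fix k
  have "r k \<noteq> 0" using r[of k] by auto
  thus "AE t in circ. u (of_real (r k) * cis t + \<eta>) \<noteq> 0"
    using u by (intro AE_circ_cosparse) (auto simp: nonzero_mero_def)
qed

text \<open>That f^n f(z + \<eta>) - s does not vanish identically is not given but read off from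
  its asymptotics: otherwise it would vanish, for almost every angle, on all of the countably many
  circles.\<close>

lemma nonzero_mero_if_AE_nonzero:
  assumes F: "F meromorphic_on UNIV" and r: "\<And>k::nat. r k \<ge> (1::real)"
    and ev: "AE t in circ. eventually (\<lambda>k. F (of_real (r k) * cis t) \<noteq> 0) sequentially"
  shows "nonzero_mero F"
proof (rule nonzero_meroI[OF F], rule notI)
  assume 0: "\<forall>\<^sub>\<approx>z. F z = 0"
  have "AE t in circ. F (of_real (r k) * cis t + 0) = 0" for k
    by (rule AE_circ_cosparse[OF 0]) (use r[of k] in auto)
  hence "AE t in circ. \<forall>k. F (of_real (r k) * cis t + 0) = 0" by (simp add: AE_all_countable)
  with ev have "AE t in circ. False"
    by eventually_elim (auto simp: eventually_sequentially)
  thus False using AE_circ_False by blast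
qed

text \<open>Jensen's formula is used only as an upper bound for the mean of ln |F|: poles of F enter
  it with a negative sign, so N(r, F) is bounded below by 0 and discarded. Finitely many zeros
  contribute O(ln r), which is o(T_k), whereas the limiting mean is n + 1.\<close>

lemma infinite_zeros_pole_exceptional:
  fixes a \<eta> :: complex
  assumes f: "nonzero_mero f" and v: "nonzero_mero (\<lambda>z. f z - a)"
    and fin: "growth_order f < \<infinity>"
    and g1: "growth_exponent (\<lambda>r. int_pole_count r f) < growth_order f"
    and g2: "growth_exponent (\<lambda>r. int_pole_count r (\<lambda>z. 1 / (f z - a))) < growth_order f"
    and s: "small_function s f" "nonzero_mero s" and sa: "nonzero_mero (\<lambda>z. a ^ (n + 1) - s z)"
  shows "infinite {z. isolated_zero (\<lambda>z. f z ^ n * f (z + \<eta>) - s z) z}"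
proof
  define F where "F = (\<lambda>z. f z ^ n * f (z + \<eta>) - s z)"
  define v where "v = (\<lambda>z. f z - a)"
  assume "finite {z. isolated_zero (\<lambda>z. f z ^ n * f (z + \<eta>) - s z) z}"
  hence finF: "finite {z. isolated_zero F z}" by (simp add: F_def)
  note fm = nonzero_mero_D(1)[OF f]
  have sm: "s meromorphic_on UNIV" using s by (simp add: small_function_def)
  have vn: "nonzero_mero v" using v by (simp add: v_def)
  have vm: "v meromorphic_on UNIV" by (rule nonzero_mero_D(1)[OF vn])
  have Fm: "F meromorphic_on UNIV" unfolding F_def by (intro meromorphic_intros fm sm mero_shift)
  define D where "D = log_plus (norm (- a)) + ln 2 + log_plus (norm a)"
  have D: "\<bar>characteristic r v - characteristic r f\<bar> \<le> D" if r: "r \<ge> 1" for r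
  proof -
    have "characteristic r v \<le> characteristic r f + log_plus (norm (- a)) + ln 2"
      using characteristic_add_const_le[OF fm r, of "- a"] by (simp add: v_def)
    moreover have "characteristic r f \<le> characteristic r v + log_plus (norm a) + ln 2"
      using characteristic_add_const_le[OF vm r, of a] by (simp add: v_def)
    ultimately show ?thesis unfolding D_def abs_le_iff
      using log_plus_nonneg[of "norm a"] log_plus_nonneg[of "norm (- a)"] by linarith
  qed
  have "eventually (\<lambda>r. int_pole_count r v = int_pole_count r f) at_top"
    using eventually_ge_at_top[of 1]
    by eventually_elim (rule int_pole_count_affine[OF fm vm, of 1 "- a"], auto simp: v_def)
  hence g1': "growth_exponent (\<lambda>r. int_pole_count r v) < growth_order f"
    using g1 growth_exponent_cong by metis
  have g2': "growth_exponent (\<lambda>r. int_pole_count r (\<lambda>z. 1 / v z)) < growth_order f"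
    using g2 by (simp add: v_def)
  define M where "M = log_plus 1 + log_plus (norm (a ^ (n + 1))) + ln 2"
  have M0: "M \<ge> 0" unfolding M_def by (intro add_nonneg_nonneg) auto
  \<comment> \<open>Where H > 0, \<open>s\<close> has to be negligible against the product; where H
    < 0, \<open>w\<close> is the dominant term and must not be exponentially small. Both therefore
    go into the family of small functions.\<close>
  define w where "w = (\<lambda>z. a ^ (n + 1) - s z)"
  have wn: "nonzero_mero w" using sa by (simp add: w_def)
  have Us: "characteristic r u \<le> characteristic r s + M" if "u \<in> {s, w}" "r \<ge> 1" for u r
    using that characteristic_const_minus_le[OF sm that(2), of "a ^ (n + 1)"] M0 by (auto simp: M_def w_def)
  have Un: "nonzero_mero u" if "u \<in> {s, w}" for u using that s(2) wn by auto
  have Uf: "finite {s, w}" by simp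
  obtain r T :: "nat \<Rightarrow> real" and C :: real and H :: "real \<Rightarrow> real" and b :: real where
    r: "\<And>k. r k \<ge> 1" "\<And>k. r k \<ge> norm \<eta>" and T: "\<And>k. T k = characteristic (r k) v" "\<And>k. T k \<ge> 1"
    "filterlim T at_top sequentially" and C: "C \<ge> 0" "\<And>k. characteristic (100 * r k) v \<le> C * T k"
    and NT: "(\<lambda>k. int_pole_count (10 * r k) v / T k) \<longlonglongrightarrow> 0"
    and sT: "(\<lambda>k. characteristic (10 * r k) s / T k) \<longlonglongrightarrow> 0"
    and lT: "(\<lambda>k. (1 + ln (r k)) / T k) \<longlonglongrightarrow> 0"
    and H: "H \<in> borel_measurable borel" "\<And>t. \<bar>H t\<bar> \<le> b" "AE t in circ. H t \<noteq> 0"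
    "(\<integral>t. max 0 (H t) \<partial>circ) = 1" "(\<integral>t. H t \<partial>circ) = 0"
    and lim: "AE t in circ. (\<lambda>k. ln (norm (v (of_real (r k) * cis t))) / T k) \<longlonglongrightarrow> H t"
    "AE t in circ. (\<lambda>k. ln (norm (v (of_real (r k) * cis t + \<eta>))) / T k) \<longlonglongrightarrow> H t"
    and "(\<lambda>k. proximity (r k) (\<lambda>z. v (z + \<eta>)) / T k) \<longlonglongrightarrow> 1"
    and limU: "\<And>u. u \<in> {s, w} \<Longrightarrow> AE t in circ. (\<lambda>k. ln (norm (u (of_real (r k) * cis t))) / T k) \<longlonglongrightarrow> 0"
  proof -
    show thesis
      by (rule scaling_limit[OF fm vn D fin g1' g2' s(1) Uf Un Us, of \<eta>]) (assumption | fact that)+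
  qed
  have w0: "AE t in circ. \<forall>k. w (of_real (r k) * cis t + 0) \<noteq> 0" by (rule AE_nonzero_on_circles[OF wn r(1)])
  have ws: "AE t in circ. (\<lambda>k. ln (norm (w (of_real (r k) * cis t))) / T k) \<longlonglongrightarrow> 0" by (rule limU) simp
  have ss: "AE t in circ. (\<lambda>k. ln (norm (s (of_real (r k) * cis t))) / T k) \<longlonglongrightarrow> 0" by (rule limU) simp
  have Flim: "AE t in circ. (\<lambda>k. ln (norm (F (of_real (r k) * cis t))) / T k) \<longlonglongrightarrow> (n + 1) * max 0 (H t) \<and>
     eventually (\<lambda>k. F (of_real (r k) * cis t) \<noteq> 0) sequentially"
    using lim(1) lim(2) H(3) w0 ws ss
  proof eventually_elim
    case (elim t)
    note e = elim[unfolded v_def w_def add_0_right]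
    have w0': "a ^ (n + 1) - s (of_real (r k) * cis t) \<noteq> 0" for k using e(4) by blast
    show ?case
    proof (cases "H t > 0")
      case True
      show ?thesis unfolding F_def
        using log_limit_far[OF T(3) e(1,2) True e(6), of n] True by (simp add: max_def)
    next
      case False
      hence h: "H t < 0" using e(3) by linarith
      show ?thesis unfolding F_def
        using log_limit_near(1,2)[OF T(3) e(1,2) h e(5) w0'] h by (simp add: max_def)
    qed
  qed
  have Fn: "nonzero_mero F" by (rule nonzero_mero_if_AE_nonzero[OF Fm r(1)]) (use Flim in auto)
  obtain C' where C': "\<And>k. characteristic (10 * r k) F \<le> C' * T k"
    unfolding F_def using difference_product_regular[OF f vn sm D r T(2) C(2) sT lT] by blast
  have G: "(\<lambda>t. (n + 1) * max 0 (H t)) \<in> borel_measurable borel" using H(1) by measurable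
  have Gb: "\<bar>real (n + 1) * max 0 (H t)\<bar> \<le> (n + 1) * b" for t
    using H(2)[of t] by (simp add: abs_mult abs_le_iff)
  have Fl: "AE t in circ. (\<lambda>k. ln (norm (F (of_real (r k) * cis t))) / T k) \<longlonglongrightarrow> (n + 1) * max 0 (H t)"
    using Flim by auto
  have L: "(\<lambda>k. (Jensen_const F + int_pole_count (r k) (\<lambda>z. 1 / F z) - int_pole_count (r k) F) / T k) \<longlonglongrightarrow>
    (\<integral>t. (n + 1) * max 0 (H t) \<partial>circ)"
    by (rule mean_log_limit(1)[OF Fn r(1) T(2) C' G Gb Fl])
  obtain K where K: "K \<ge> 0" "\<And>r. r \<ge> 1 \<Longrightarrow> int_pole_count r (\<lambda>z. 1 / F z) \<le> K * (1 + ln r)"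
    using finite_zeros_int_pole_count[OF Fn finF] by blast
  have "(\<lambda>k. Jensen_const F / T k + K * ((1 + ln (r k)) / T k)) \<longlonglongrightarrow> 0 + K * 0"
    by (intro tendsto_add tendsto_mult tendsto_const lT const_over_T T(3))
  moreover have "(Jensen_const F + int_pole_count (r k) (\<lambda>z. 1 / F z) - int_pole_count (r k) F) / T k
      \<le> Jensen_const F / T k + K * ((1 + ln (r k)) / T k)" for k
  proof -
    have "Jensen_const F + int_pole_count (r k) (\<lambda>z. 1 / F z) - int_pole_count (r k) F \<le> Jensen_const F + K * (1 + ln (r k))"
      using K(2)[OF r(1)[of k]] int_pole_count_nonneg[OF Fm r(1)[of k]] by linarith
    hence "(Jensen_const F + int_pole_count (r k) (\<lambda>z. 1 / F z) - int_pole_count (r k) F) / T k \<le> (Jensen_const F + K * (1 + ln (r k))) / T k"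
      using T(2)[of k] by (intro divide_right_mono) auto
    thus ?thesis by (simp only: add_divide_distrib[of "Jensen_const F"] times_divide_eq_right)
  qed
  ultimately have "(\<integral>t. (n + 1) * max 0 (H t) \<partial>circ) \<le> 0 + K * 0"
    by (intro LIMSEQ_le[OF L]) auto
  thus False using H(4) by simp
qed

text \<open>A count as in the case of an infinite value gives no contradiction here, because ln |F|
  / T_k tends to 0. What remains exploitable is the exponential closeness of f^n f(z + \<eta>) to
  b^(n+1) and a^(n+1) on sets of positive measure.\<close>

lemma infinite_zeros_two_finite_exceptional:
  fixes a b \<eta> :: complex
  assumes f: "nonzero_mero f" and ab: "a \<noteq> b" and n: "n \<ge> 2"
    and fa: "nonzero_mero (\<lambda>z. f z - a)" and fb: "nonzero_mero (\<lambda>z. f z - b)"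
    and fin: "growth_order f < \<infinity>"
    and g1: "growth_exponent (\<lambda>r. int_pole_count r (\<lambda>z. 1 / (f z - a))) < growth_order f"
    and g2: "growth_exponent (\<lambda>r. int_pole_count r (\<lambda>z. 1 / (f z - b))) < growth_order f"
    and s: "small_function s f"
    and sa: "nonzero_mero (\<lambda>z. a ^ (n + 1) - s z)" and sb: "nonzero_mero (\<lambda>z. b ^ (n + 1) - s z)"
  shows "infinite {z. isolated_zero (\<lambda>z. f z ^ n * f (z + \<eta>) - s z) z}"
proof
  define F where "F = (\<lambda>z. f z ^ n * f (z + \<eta>) - s z)"
  define v where "v = (\<lambda>z. (f z - a) / (f z - b))"
  assume "finite {z. isolated_zero (\<lambda>z. f z ^ n * f (z + \<eta>) - s z) z}"
  hence finF: "finite {z. isolated_zero F z}" by (simp add: F_def)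
  note fm = nonzero_mero_D(1)[OF f]
  have sm: "s meromorphic_on UNIV" using s by (simp add: small_function_def)
  have vn: "nonzero_mero v"
    using nonzero_mero_mult[OF fa nonzero_mero_inverse[OF fb]] by (simp add: v_def)
  have vm: "v meromorphic_on UNIV" by (rule nonzero_mero_D(1)[OF vn])
  have ivm: "(\<lambda>z. 1 / v z) meromorphic_on UNIV" by (rule nonzero_mero_D(1)[OF nonzero_mero_inverse[OF vn]])
  have Fm: "F meromorphic_on UNIV" unfolding F_def by (intro meromorphic_intros fm sm mero_shift)
  have eva: "\<forall>\<^sub>\<approx>z. f z - a \<noteq> 0" and evb: "\<forall>\<^sub>\<approx>z. f z - b \<noteq> 0" using fa fb by (auto simp: nonzero_mero_def)
  obtain D where D: "\<And>r. r \<ge> 1 \<Longrightarrow> \<bar>characteristic r v - characteristic r f\<bar> \<le> D"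
    using characteristic_Moebius[OF fm fb ab] unfolding v_def by blast
  have ev1: "\<forall>\<^sub>\<approx>z. v z = (b - a) * (1 / (f z - b)) + 1"
    using evb by eventually_elim (auto simp: v_def field_simps)
  have ev2: "\<forall>\<^sub>\<approx>z. 1 / v z = (a - b) * (1 / (f z - a)) + 1"
    using eva evb by eventually_elim (auto simp: v_def field_simps)
  have "eventually (\<lambda>r. int_pole_count r v = int_pole_count r (\<lambda>z. 1 / (f z - b))) at_top"
    using eventually_ge_at_top[of 1]
    by eventually_elim
       (rule int_pole_count_affine[OF nonzero_mero_D(1)[OF nonzero_mero_inverse[OF fb]] vm _ ev1], use ab in auto)
  hence g1': "growth_exponent (\<lambda>r. int_pole_count r v) < growth_order f"
    using g2 growth_exponent_cong by metis
  have "eventually (\<lambda>r. int_pole_count r (\<lambda>z. 1 / v z) = int_pole_count r (\<lambda>z. 1 / (f z - a))) at_top"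
    using eventually_ge_at_top[of 1]
    by eventually_elim
       (rule int_pole_count_affine[OF nonzero_mero_D(1)[OF nonzero_mero_inverse[OF fa]] ivm _ ev2], use ab in auto)
  hence g2': "growth_exponent (\<lambda>r. int_pole_count r (\<lambda>z. 1 / v z)) < growth_order f"
    using g1 growth_exponent_cong by metis
  define M where "M = log_plus 1 + (log_plus (norm (a ^ (n + 1))) + log_plus (norm (b ^ (n + 1)))) + ln 2"
  define wa where "wa = (\<lambda>z. a ^ (n + 1) - s z)"
  define wb where "wb = (\<lambda>z. b ^ (n + 1) - s z)"
  have wan: "nonzero_mero wa" and wbn: "nonzero_mero wb" using sa sb by (simp_all add: wa_def wb_def)
  have Us: "characteristic r u \<le> characteristic r s + M" if u: "u \<in> {wa, wb}" "r \<ge> 1" for u r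
  proof -
    have "characteristic r wa \<le> characteristic r s + M"
      using characteristic_const_minus_le[OF sm u(2), of "a ^ (n + 1)"] log_plus_nonneg[of "norm (b ^ (n + 1))"]
      unfolding M_def wa_def by linarith
    moreover have "characteristic r wb \<le> characteristic r s + M"
      using characteristic_const_minus_le[OF sm u(2), of "b ^ (n + 1)"] log_plus_nonneg[of "norm (a ^ (n + 1))"]
      unfolding M_def wb_def by linarith
    ultimately show ?thesis using u(1) by blast
  qed
  have Un: "nonzero_mero u" if "u \<in> {wa, wb}" for u using that wan wbn by auto
  have Uf: "finite {wa, wb}" by simp
  obtain r T :: "nat \<Rightarrow> real" and C :: real and H :: "real \<Rightarrow> real" and c :: real where
    r: "\<And>k. r k \<ge> 1" "\<And>k. r k \<ge> norm \<eta>" and T: "\<And>k. T k = characteristic (r k) v" "\<And>k. T k \<ge> 1"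
    "filterlim T at_top sequentially" and C: "C \<ge> 0" "\<And>k. characteristic (100 * r k) v \<le> C * T k"
    and NT: "(\<lambda>k. int_pole_count (10 * r k) v / T k) \<longlonglongrightarrow> 0"
    and sT: "(\<lambda>k. characteristic (10 * r k) s / T k) \<longlonglongrightarrow> 0"
    and lT: "(\<lambda>k. (1 + ln (r k)) / T k) \<longlonglongrightarrow> 0"
    and H: "H \<in> borel_measurable borel" "\<And>t. \<bar>H t\<bar> \<le> c" "AE t in circ. H t \<noteq> 0"
    "(\<integral>t. max 0 (H t) \<partial>circ) = 1" "(\<integral>t. H t \<partial>circ) = 0"
    and lim: "AE t in circ. (\<lambda>k. ln (norm (v (of_real (r k) * cis t))) / T k) \<longlonglongrightarrow> H t"
    "AE t in circ. (\<lambda>k. ln (norm (v (of_real (r k) * cis t + \<eta>))) / T k) \<longlonglongrightarrow> H t"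
    and prox: "(\<lambda>k. proximity (r k) (\<lambda>z. v (z + \<eta>)) / T k) \<longlonglongrightarrow> 1"
    and limU: "\<And>u. u \<in> {wa, wb} \<Longrightarrow> AE t in circ. (\<lambda>k. ln (norm (u (of_real (r k) * cis t))) / T k) \<longlonglongrightarrow> 0"
  proof -
    show thesis
      by (rule scaling_limit[OF fm vn D fin g1' g2' s Uf Un Us, of \<eta>]) (assumption | fact that)+
  qed
  have T0: "T k > 0" for k using T(2)[of k] by linarith
  define P where "P = (\<lambda>t k. f (of_real (r k) * cis t) ^ n * f (of_real (r k) * cis t + \<eta>))"
  have aeab: "AE t in circ. \<forall>k. wa (of_real (r k) * cis t + 0) \<noteq> 0" "AE t in circ. \<forall>k. wb (of_real (r k) * cis t + 0) \<noteq> 0"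
    "AE t in circ. \<forall>k. f (of_real (r k) * cis t + 0) - b \<noteq> 0" "AE t in circ. \<forall>k. f (of_real (r k) * cis t + \<eta>) - b \<noteq> 0"
    by (intro AE_nonzero_on_circles wan wbn fb r(1))+
  have la: "AE t in circ. (\<lambda>k. ln (norm (wa (of_real (r k) * cis t))) / T k) \<longlonglongrightarrow> 0"
    and lb: "AE t in circ. (\<lambda>k. ln (norm (wb (of_real (r k) * cis t))) / T k) \<longlonglongrightarrow> 0" by (rule limU, simp)+
  \<comment> \<open>By the Moebius relation, both f and its shift are exponentially close to
    \<open>b\<close> where H > 0 and to \<open>a\<close> where H < 0; either way F is dominated by a
    small function that does not vanish identically.\<close>
  have Flim: "AE t in circ. (\<lambda>k. ln (norm (F (of_real (r k) * cis t))) / T k) \<longlonglongrightarrow> 0 \<and>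
     eventually (\<lambda>k. F (of_real (r k) * cis t) \<noteq> 0) sequentially \<and>
     (H t > 0 \<longrightarrow> (\<exists>\<delta>>0. eventually (\<lambda>k. norm (P t k - b ^ (n + 1)) \<le> exp (- \<delta> * T k)) sequentially)) \<and>
     (H t < 0 \<longrightarrow> (\<exists>\<delta>>0. eventually (\<lambda>k. norm (P t k - a ^ (n + 1)) \<le> exp (- \<delta> * T k)) sequentially))"
    using lim(1) lim(2) H(3) aeab la lb
  proof eventually_elim
    case (elim t)
    note e = elim[unfolded wa_def wb_def add_0_right]
    have a0: "a ^ (n + 1) - s (of_real (r k) * cis t) \<noteq> 0" for k using e(4) by blast
    have b0: "b ^ (n + 1) - s (of_real (r k) * cis t) \<noteq> 0" for k using e(5) by blast
    have x0: "f (of_real (r k) * cis t) \<noteq> b" for k using e(6)[rule_format, of k] by auto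
    have x0': "f (of_real (r k) * cis t + \<eta>) \<noteq> b" for k using e(7)[rule_format, of k] by auto
    note mo = log_limit_Moebius[OF T(3) e(1,3) x0 _ ab, unfolded v_def, OF refl]
    note mo' = log_limit_Moebius[OF T(3) e(2,3) x0' _ ab, unfolded v_def, OF refl]
    show ?case
    proof (cases "H t > 0")
      case True
      hence h: "- H t < 0" by simp
      show ?thesis unfolding F_def P_def
        using log_limit_near[OF T(3) mo(1)[OF True] mo'(1)[OF True] h e(9) b0] True by simp
    next
      case False
      hence h: "H t < 0" using e(3) by linarith
      show ?thesis unfolding F_def P_def
        using log_limit_near[OF T(3) mo(2)[OF h] mo'(2)[OF h] h e(8) a0] h by simp
    qed
  qed
  have Fn: "nonzero_mero F" by (rule nonzero_mero_if_AE_nonzero[OF Fm r(1)]) (use Flim in auto)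
  obtain C' where C': "\<And>k. characteristic (10 * r k) F \<le> C' * T k"
    unfolding F_def using difference_product_regular[OF f vn sm D r T(2) C(2) sT lT] by blast
  have Fl: "AE t in circ. (\<lambda>k. ln (norm (F (of_real (r k) * cis t))) / T k) \<longlonglongrightarrow> 0" using Flim by auto
  have z: "(\<lambda>t::real. 0::real) \<in> borel_measurable borel" "\<And>t::real. \<bar>0::real\<bar> \<le> 0" by auto
  note L = mean_log_limit[OF Fn r(1) T(2) C' z Fl]
  obtain K where K: "K \<ge> 0" "\<And>r. r \<ge> 1 \<Longrightarrow> int_pole_count r (\<lambda>z. 1 / F z) \<le> K * (1 + ln r)"
    using finite_zeros_int_pole_count[OF Fn finF] by blast
  have FT: "(\<lambda>k. characteristic (r k) F / T k) \<longlonglongrightarrow> 0"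
  proof (rule Lim_null_comparison)
    \<comment> \<open>Jensen's formula is solved for N(r, F): it equals the constant plus N(r, 1/F)
      minus the mean of ln |F|. All three are o(T_k), and so is the proximity function, the limit
      being 0.\<close>
    define J where "J = (\<lambda>k. (Jensen_const F + int_pole_count (r k) (\<lambda>z. 1 / F z) - int_pole_count (r k) F) / T k)"
    have "(\<lambda>k. proximity (r k) F / T k + (Jensen_const F / T k + K * ((1 + ln (r k)) / T k) - J k)) \<longlonglongrightarrow> 0 + (0 + K * 0 - 0)"
      using L unfolding J_def by (intro tendsto_add tendsto_diff tendsto_mult tendsto_const lT const_over_T T(3)) auto
    thus "(\<lambda>k. proximity (r k) F / T k + (Jensen_const F / T k + K * ((1 + ln (r k)) / T k) - J k)) \<longlonglongrightarrow> 0" by simp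
    show "eventually (\<lambda>k. norm (characteristic (r k) F / T k) \<le>
        proximity (r k) F / T k + (Jensen_const F / T k + K * ((1 + ln (r k)) / T k) - J k)) sequentially"
    proof (intro always_eventually allI)
      fix k
      have "characteristic (r k) F \<le> proximity (r k) F + (Jensen_const F + K * (1 + ln (r k)) -
         (Jensen_const F + int_pole_count (r k) (\<lambda>z. 1 / F z) - int_pole_count (r k) F))"
        using K(2)[OF r(1)[of k]] unfolding characteristic_def by linarith
      hence "characteristic (r k) F / T k \<le> (proximity (r k) F + (Jensen_const F + K * (1 + ln (r k)) -
         (Jensen_const F + int_pole_count (r k) (\<lambda>z. 1 / F z) - int_pole_count (r k) F))) / T k"
        using T0[of k] by (intro divide_right_mono) auto
      also have "\<dots> = proximity (r k) F / T k + (Jensen_const F / T k + K * ((1 + ln (r k)) / T k) - J k)"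
        unfolding times_divide_eq_right J_def by (simp only: add_divide_distrib diff_divide_distrib)
      finally show "norm (characteristic (r k) F / T k) \<le> proximity (r k) F / T k + (Jensen_const F / T k + K * ((1 + ln (r k)) / T k) - J k)"
        using characteristic_nonneg[OF Fm r(1)[of k]] T0[of k] by simp
    qed
  qed
  \<comment> \<open>If the difference \<open>E\<close> of the two sides did not vanish identically,
    its characteristic would be o(T_k), since E = F + s - d^(n+1). Then ln |E| / T_k would tend to 0
    almost everywhere along a subsequence, contradicting the exponential smallness on the angles
    with \<open>Q\<close>, which do not form a null set.\<close>
  have const: "\<forall>\<^sub>\<approx>z. f z ^ n * f (z + \<eta>) = d ^ (n + 1)"
    if near: "AE t in circ. Q t \<longrightarrow> (\<exists>\<delta>>0. eventually (\<lambda>k. norm (P t k - d ^ (n + 1)) \<le> exp (- \<delta> * T k)) sequentially)"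
    and Q: "\<not> (AE t in circ. \<not> Q t)" for d Q
  proof (rule ccontr)
    assume neg: "\<not> (\<forall>\<^sub>\<approx>z. f z ^ n * f (z + \<eta>) = d ^ (n + 1))"
    define E where "E = (\<lambda>z. f z ^ n * f (z + \<eta>) - d ^ (n + 1))"
    have Em: "E meromorphic_on UNIV" unfolding E_def by (intro meromorphic_intros fm mero_shift)
    have En: "nonzero_mero E" by (rule nonzero_meroI[OF Em]) (use neg in \<open>simp add: E_def\<close>)
    have sd: "(\<lambda>z. s z + - (d ^ (n + 1))) meromorphic_on UNIV" by (intro meromorphic_intros sm)
    have Eeq: "E = (\<lambda>z. F z + (s z + - (d ^ (n + 1))))" by (simp add: E_def F_def fun_eq_iff)
    define B where "B = log_plus (norm (- (d ^ (n + 1)))) + 2 * ln 2"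
    have ET: "(\<lambda>k. characteristic (r k) E / T k) \<longlonglongrightarrow> 0"
    proof (rule Lim_null_comparison)
      show "eventually (\<lambda>k. norm (characteristic (r k) E / T k) \<le>
        characteristic (r k) F / T k + characteristic (10 * r k) s / T k + B / T k) sequentially"
      proof (intro always_eventually allI)
        fix k
        have "characteristic (r k) E \<le> characteristic (r k) F + characteristic (r k) (\<lambda>z. s z + - (d ^ (n + 1))) + ln 2"
          unfolding Eeq by (rule characteristic_add[OF Fm sd r(1)])
        moreover have "characteristic (r k) (\<lambda>z. s z + - (d ^ (n + 1))) \<le> characteristic (r k) s + log_plus (norm (- (d ^ (n + 1)))) + ln 2"
          by (rule characteristic_add_const_le[OF sm r(1)])
        moreover have "characteristic (r k) s \<le> characteristic (10 * r k) s"
          using r(1)[of k] by (intro characteristic_mono[OF sm]) auto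
        ultimately have "characteristic (r k) E \<le> characteristic (r k) F + characteristic (10 * r k) s + B"
          unfolding B_def by linarith
        hence "characteristic (r k) E / T k \<le> (characteristic (r k) F + characteristic (10 * r k) s + B) / T k"
          using T0[of k] by (intro divide_right_mono) auto
        thus "norm (characteristic (r k) E / T k) \<le>
          characteristic (r k) F / T k + characteristic (10 * r k) s / T k + B / T k"
          using characteristic_nonneg[OF Em r(1)[of k]] T0[of k] by (simp add: add_divide_distrib)
      qed
      have "(\<lambda>k. characteristic (r k) F / T k + characteristic (10 * r k) s / T k + B / T k) \<longlonglongrightarrow> 0 + 0 + 0"
        by (intro tendsto_add FT sT const_over_T T(3))
      thus "(\<lambda>k. characteristic (r k) F / T k + characteristic (10 * r k) s / T k + B / T k) \<longlonglongrightarrow> 0" by simp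
    qed
    have fE: "finite {E}" by simp
    obtain \<psi> where \<psi>: "strict_mono \<psi>"
      and ae: "\<And>u. u \<in> {E} \<Longrightarrow> AE t in circ. (\<lambda>k. ln (norm (u (of_real (r (\<psi> k)) * cis t))) / T (\<psi> k)) \<longlonglongrightarrow> 0"
      by (rule AE_log_small_subseq[where U = "{E}" and r = r and T = T]) (use En ET r T T0 in auto)
    have aeE: "AE t in circ. (\<lambda>k. ln (norm (E (of_real (r (\<psi> k)) * cis t))) / T (\<psi> k)) \<longlonglongrightarrow> 0"
      by (rule ae) simp
    have E0: "AE t in circ. \<forall>k. E (of_real (r k) * cis t + 0) \<noteq> 0" by (rule AE_nonzero_on_circles[OF En r(1)])
    have "AE t in circ. \<not> Q t"
      using near aeE E0
    proof eventually_elim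
      case (elim t)
      show ?case
      proof
        assume "Q t"
        then obtain \<delta> where \<delta>: "\<delta> > 0" "eventually (\<lambda>k. norm (P t k - d ^ (n + 1)) \<le> exp (- \<delta> * T k)) sequentially"
          using elim(1) by blast
        have "eventually (\<lambda>k. norm (P t (\<psi> k) - d ^ (n + 1)) \<le> exp (- \<delta> * T (\<psi> k))) sequentially"
          using eventually_compose_filterlim[OF \<delta>(2) filterlim_subseq[OF \<psi>]] .
        hence "eventually (\<lambda>k. ln (norm (E (of_real (r (\<psi> k)) * cis t))) / T (\<psi> k) \<le> - \<delta>) sequentially"
        proof eventually_elim
          case (elim k)
          have ne: "E (of_real (r (\<psi> k)) * cis t) \<noteq> 0" using \<open>\<forall>k. E (of_real (r k) * cis t + 0) \<noteq> 0\<close> by (metis add_0_right)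
          have "norm (E (of_real (r (\<psi> k)) * cis t)) \<le> exp (- \<delta> * T (\<psi> k))" using elim by (simp add: E_def P_def)
          hence "ln (norm (E (of_real (r (\<psi> k)) * cis t))) \<le> ln (exp (- \<delta> * T (\<psi> k)))"
            using ne by (subst ln_le_cancel_iff) auto
          thus ?case using T0[of "\<psi> k"] by (simp add: divide_le_eq)
        qed
        hence "0 \<le> - \<delta>"
          by (intro tendsto_upperbound[OF elim(2)]) auto
        thus False using \<delta>(1) by simp
      qed
    qed
    thus False using Q by blast
  qed
  \<comment> \<open>Both signs occur with positive measure: the positive part has mean 1, and the
    mean 0 of H forces the negative part to balance it.\<close>
  have Hpos: "\<not> (AE t in circ. \<not> H t > 0)"
  proof
    assume "AE t in circ. \<not> H t > 0"
    hence "AE t in circ. max 0 (H t) = 0" by eventually_elim auto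
    hence "(\<integral>t. max 0 (H t) \<partial>circ) = (\<integral>t. 0 \<partial>circ)" using H(1) by (intro integral_cong_AE) auto
    thus False using H(4) by simp
  qed
  have Hneg: "\<not> (AE t in circ. \<not> H t < 0)"
  proof
    assume "AE t in circ. \<not> H t < 0"
    hence "AE t in circ. max 0 (H t) = H t" by eventually_elim auto
    hence "(\<integral>t. max 0 (H t) \<partial>circ) = (\<integral>t. H t \<partial>circ)" using H(1) by (intro integral_cong_AE) auto
    thus False using H(4,5) by simp
  qed
  have cb: "\<forall>\<^sub>\<approx>z. f z ^ n * f (z + \<eta>) = b ^ (n + 1)" by (rule const[OF _ Hpos]) (use Flim in auto)
  have ca: "\<forall>\<^sub>\<approx>z. f z ^ n * f (z + \<eta>) = a ^ (n + 1)" by (rule const[OF _ Hneg]) (use Flim in auto)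
  have abn: "a ^ (n + 1) = b ^ (n + 1)"
  proof -
    from ca cb have "\<forall>\<^sub>\<approx>z::complex. a ^ (n + 1) = b ^ (n + 1)" by eventually_elim simp
    thus ?thesis by simp
  qed
  \<comment> \<open>If this power were 0, the equality of the two powers would make both
    \<open>a\<close> and \<open>b\<close> equal to 0.\<close>
  have c0: "b ^ (n + 1) \<noteq> 0" using abn ab by auto
  define f1 where "f1 = (\<lambda>z. f (z + \<eta>))"
  have f1n: "nonzero_mero f1" unfolding f1_def by (rule nonzero_mero_shift[OF f])
  have f1m: "f1 meromorphic_on UNIV" by (rule nonzero_mero_D(1)[OF f1n])
  have f1b: "nonzero_mero (\<lambda>z. f1 z - b)" unfolding f1_def using nonzero_mero_shift[OF fb] by simp
  obtain D1 where D1: "\<And>r. r \<ge> 1 \<Longrightarrow> \<bar>characteristic r (\<lambda>z. (f1 z - a) / (f1 z - b)) - characteristic r f1\<bar> \<le> D1"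
    using characteristic_Moebius[OF f1m f1b ab] by blast
  have v1: "(\<lambda>z. (f1 z - a) / (f1 z - b)) = (\<lambda>z. v (z + \<eta>))" by (simp add: f1_def v_def)
  have fnm: "(\<lambda>z. f z ^ n) meromorphic_on UNIV" by (intro meromorphic_intros fm)
  have if1m: "(\<lambda>z. 1 / f1 z) meromorphic_on UNIV" by (rule nonzero_mero_D(1)[OF nonzero_mero_inverse[OF f1n]])
  have cf: "\<forall>\<^sub>\<approx>z. f z ^ n = b ^ (n + 1) * (1 / f1 z)"
    using cb
  proof eventually_elim
    case (elim z)
    hence "f (z + \<eta>) \<noteq> 0" using c0 by (intro notI) simp
    thus ?case using elim by (simp add: f1_def eq_divide_eq)
  qed
  define D2 where "D2 = log_plus (norm (b ^ (n + 1))) + \<bar>Jensen_const f1\<bar>"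
  \<comment> \<open>f^n is a nonzero constant times 1 / f1, and the first main theorem removes the
    reciprocal.\<close>
  have nT: "n * characteristic r f \<le> characteristic r f1 + D2" if r: "r \<ge> 1" for r
  proof -
    have "n * characteristic r f = characteristic r (\<lambda>z. f z ^ n)" by (rule characteristic_power[OF f r, symmetric])
    also have "\<dots> = characteristic r (\<lambda>z. b ^ (n + 1) * (1 / f1 z))"
      by (rule characteristic_cong[OF fnm _ cf r]) (intro meromorphic_on_mult meromorphic_on_const if1m)
    also have "\<dots> \<le> characteristic r (\<lambda>z. 1 / f1 z) + log_plus (norm (b ^ (n + 1)))"
      by (rule characteristic_cmult_le[OF if1m r])
    also have "characteristic r (\<lambda>z. 1 / f1 z) = characteristic r f1 - Jensen_const f1"
      by (rule first_main_theorem[OF f1n]) (use r in simp)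
    finally show ?thesis unfolding D2_def by linarith
  qed
  obtain Cs where Cs: "Cs \<ge> 0" "\<And>r. r \<ge> 1 \<Longrightarrow> r \<ge> norm \<eta> \<Longrightarrow>
    int_pole_count r (\<lambda>z. v (z + \<eta>)) \<le> int_pole_count (2 * r) v + Cs * (1 + ln r)"
    using int_pole_count_shift[OF vm, of \<eta>] by blast
  define D3 where "D3 = D1 + D2 + n * D"
  \<comment> \<open>The characteristic of the shifted \<open>f\<close> is passed to that of the
    shifted \<open>v\<close> by the Moebius comparison, then split into proximity and counting
    function; the proximity part is the only one that survives division by T_k.\<close>
  have main: "real n \<le> proximity (r k) (\<lambda>z. v (z + \<eta>)) / T k + int_pole_count (10 * r k) v / T k
     + Cs * ((1 + ln (r k)) / T k) + D3 / T k" for k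
  proof -
    have "int_pole_count (2 * r k) v \<le> int_pole_count (10 * r k) v"
      using r(1)[of k] by (intro int_pole_count_mono[OF vm]) auto
    hence 1: "characteristic (r k) (\<lambda>z. v (z + \<eta>)) \<le> proximity (r k) (\<lambda>z. v (z + \<eta>)) + int_pole_count (10 * r k) v + Cs * (1 + ln (r k))"
      using Cs(2)[OF r(1)[of k] r(2)[of k]] unfolding characteristic_def by linarith
    have 2: "characteristic (r k) f1 \<le> characteristic (r k) (\<lambda>z. v (z + \<eta>)) + D1"
      using D1[OF r(1)[of k]] unfolding v1 by (simp add: abs_le_iff)
    have "T k - D \<le> characteristic (r k) f" using D[OF r(1)[of k]] unfolding T(1) by (simp add: abs_le_iff)
    hence "n * (T k - D) \<le> n * characteristic (r k) f" by (rule mult_left_mono) simp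
    hence "n * T k \<le> proximity (r k) (\<lambda>z. v (z + \<eta>)) + int_pole_count (10 * r k) v + Cs * (1 + ln (r k)) + D3"
      using 1 2 nT[OF r(1)[of k]] unfolding D3_def right_diff_distrib by linarith
    hence "real n \<le> (proximity (r k) (\<lambda>z. v (z + \<eta>)) + int_pole_count (10 * r k) v + Cs * (1 + ln (r k)) + D3) / T k"
      using T0[of k] by (simp add: le_divide_eq)
    also have "\<dots> = proximity (r k) (\<lambda>z. v (z + \<eta>)) / T k + int_pole_count (10 * r k) v / T k
       + Cs * ((1 + ln (r k)) / T k) + D3 / T k"
      unfolding times_divide_eq_right by (simp only: add_divide_distrib)
    finally show ?thesis .
  qed
  have "(\<lambda>k. proximity (r k) (\<lambda>z. v (z + \<eta>)) / T k + int_pole_count (10 * r k) v / T k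
     + Cs * ((1 + ln (r k)) / T k) + D3 / T k) \<longlonglongrightarrow> 1 + 0 + Cs * 0 + 0"
    by (intro tendsto_add tendsto_mult tendsto_const prox NT lT const_over_T T(3))
  \<comment> \<open>The limit gives n <= 1, against n >= 2.\<close>
  hence "real n \<le> 1 + 0 + Cs * 0 + 0"
    by (rule LIMSEQ_le_const) (intro exI[of _ 0] allI impI main)
  thus False using n by simp
qed

lemma transcendental_imp_nonzero_mero:
  assumes "transcendental_meromorphic f"
  shows "nonzero_mero (\<lambda>z. f z - c)"
proof (rule nonzero_meroI)
  have f: "f meromorphic_on UNIV" using assms by (simp add: transcendental_meromorphic_def)
  show "(\<lambda>z. f z - c) meromorphic_on UNIV" by (intro meromorphic_intros f)
  show "\<not> (\<forall>\<^sub>\<approx>z. f z - c = 0)"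
  proof
    assume "\<forall>\<^sub>\<approx>z. f z - c = 0"
    hence "\<forall>\<^sub>\<approx>z. f z = poly [:c:] z / poly [:1:] z" by eventually_elim simp
    moreover have "[:1:] \<noteq> (0 :: complex poly)" by simp
    ultimately show False using assms unfolding transcendental_meromorphic_def by blast
  qed
qed

theorem corollary1p4:
  fixes f s :: "complex \<Rightarrow> complex" and a b :: ext_complex and \<eta> :: complex and n :: nat
  assumes "transcendental_meromorphic f"
    and "growth_order f < \<infinity>"
    and "a \<noteq> b"
    and "borel_exceptional f a"
    and "borel_exceptional f b"
    and "\<eta> \<noteq> 0"
    and "n \<ge> 2"
    and "small_function s f"
    and "\<not> (\<forall>\<^sub>\<approx>z. s z = 0)"
    and "(\<exists>a' b'. a = Fin a' \<and> b = Fin b' \<and>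
             \<not> (\<forall>\<^sub>\<approx>z. a' ^ (n + 1) - s z = 0) \<and> \<not> (\<forall>\<^sub>\<approx>z. b' ^ (n + 1) - s z = 0)) \<or>
         (\<exists>a'. a = Fin a' \<and> b = Infty \<and> \<not> (\<forall>\<^sub>\<approx>z. a' ^ (n + 1) - s z = 0))"
  shows "infinite {z. isolated_zero (\<lambda>z. f z ^ n * f (z + \<eta>) - s z) z}"
proof -
  note tr = transcendental_imp_nonzero_mero[OF assms(1)]
  have f: "nonzero_mero f" using tr[of 0] by simp
  have sm: "s meromorphic_on UNIV" using assms(8) by (simp add: small_function_def)
  have sn: "nonzero_mero s" by (rule nonzero_meroI[OF sm assms(9)])
  have cs: "(\<lambda>z. c - s z) meromorphic_on UNIV" for c by (intro meromorphic_intros sm)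
  from assms(10) show ?thesis
  proof (elim disjE exE conjE)
    fix a' b'
    assume ab: "a = Fin a'" "b = Fin b'"
      and nz: "\<not> (\<forall>\<^sub>\<approx>z. a' ^ (n + 1) - s z = 0)" "\<not> (\<forall>\<^sub>\<approx>z. b' ^ (n + 1) - s z = 0)"
    show ?thesis
      by (rule infinite_zeros_two_finite_exceptional[OF f _ assms(7) tr tr assms(2) _ _ assms(8)
            nonzero_meroI[OF cs nz(1)] nonzero_meroI[OF cs nz(2)]])
         (use ab assms(3,4,5) in \<open>auto simp: borel_exceptional_def\<close>)
  next
    fix a'
    assume ab: "a = Fin a'" "b = Infty" and nz: "\<not> (\<forall>\<^sub>\<approx>z. a' ^ (n + 1) - s z = 0)"
    show ?thesis
      by (rule infinite_zeros_pole_exceptional[OF f tr assms(2) _ _ assms(8) sn nonzero_meroI[OF cs nz]])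
         (use ab assms(4,5) in \<open>auto simp: borel_exceptional_def\<close>)
  qed
qed

end
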